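(* Let $\mathbb{H}^3$ be the three-dimensional hyperbolic space of constant sectional curvature $k<0$ and let $h(t,x,y)$ be its heat kernel (for the operator $\frac12\Delta$). Then for every $x\in\mathbb{H}^3$, $$-k\,(2-\log\sqrt2\,)\le\liminf_{t\to\infty}\frac{d}{dt}\mathrm{Ent}(h(t,x,\cdot))\le\limsup_{t\to\infty}\frac{d}{dt}\mathrm{Ent}(h(t,x,\cdot))\le -k\,(2+\log\sqrt2\,).$$
   Context: With $d$ the Riemannian distance on $\mathbb{H}^3$, the heat kernel has the explicit formula $$h(t,x,y)=e^{-d(x,y)^2/2t}(2\pi t)^{-3/2}\,\frac{\sqrt{-k}\,d(x,y)}{\sinh(\sqrt{-k}\,d(x,y))}\,e^{kt/2},\quad t>0,\ x,y\in\mathbb{H}^3.$$ The entropy is $\mathrm{Ent}(h(t,x,\cdot))=-\int_{\mathbb{H}^3}h(t,x,y)\log h(t,x,y)\,dV_{\mathbb{H}^3}(y)$, where $V_{\mathbb{H}^3}$ is the Riemannian volume measure on $\mathbb{H}^3$. *)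

theory Defs
  imports "HOL-Analysis.Analysis"
begin

text \<open>
  Riemannian geometry of a manifold covered by one global chart: an open set U of
  \<open>real^'n\<close> with a metric tensor g, given by its Gram matrix \<open>g y\<close> at the point y.
\<close>

definition partial_deriv :: "'n::finite \<Rightarrow> (real^'n \<Rightarrow> real) \<Rightarrow> real^'n \<Rightarrow> real" where
  "partial_deriv i f y = deriv (\<lambda>s. f (y + s *\<^sub>R axis i 1)) 0"

definition riem_volume :: "(real^'n) set \<Rightarrow> (real^'n \<Rightarrow> real^'n^'n) \<Rightarrow> (real^'n::finite) measure" where
  "riem_volume U g = density (restrict_space lborel U) (\<lambda>y. ennreal (sqrt (det (g y))))"

definition laplace_beltrami ::
    "(real^'n \<Rightarrow> real^'n^'n) \<Rightarrow> (real^'n \<Rightarrow> real) \<Rightarrow> real^'n::finite \<Rightarrow> real" where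
  "laplace_beltrami g f y =
     (\<Sum>i\<in>UNIV. partial_deriv i
        (\<lambda>z. sqrt (det (g z)) * (\<Sum>j\<in>UNIV. matrix_inv (g z) $ i $ j * partial_deriv j f z)) y)
     / sqrt (det (g y))"

text \<open>Once continuously differentiable in time, twice in space, jointly, on \<open>(0,\<infinity>) \<times> U\<close>.\<close>

definition C12_on :: "(real^'n::finite) set \<Rightarrow> (real \<Rightarrow> real^'n \<Rightarrow> real) \<Rightarrow> bool" where
  "C12_on U u \<longleftrightarrow>
     (\<forall>t>0. \<forall>y\<in>U. (\<lambda>s. u s y) differentiable (at t)) \<and>
     (\<forall>t>0. \<forall>y\<in>U. u t differentiable (at y)) \<and>
     (\<forall>i. \<forall>t>0. \<forall>y\<in>U. partial_deriv i (u t) differentiable (at y)) \<and>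
     continuous_on ({0<..} \<times> U) (\<lambda>(t, y). u t y) \<and>
     continuous_on ({0<..} \<times> U) (\<lambda>(t, y). deriv (\<lambda>s. u s y) t) \<and>
     (\<forall>i. continuous_on ({0<..} \<times> U) (\<lambda>(t, y). partial_deriv i (u t) y)) \<and>
     (\<forall>i j. continuous_on ({0<..} \<times> U) (\<lambda>(t, y). partial_deriv j (partial_deriv i (u t)) y))"

text \<open>
  A positive solution p of the heat equation for half the Laplacian whose initial value is the
  Dirac mass at x, tested against the continuous functions with compact support in U.
\<close>

definition positive_fundamental_solution ::
    "(real^'n::finite) set \<Rightarrow> (real^'n \<Rightarrow> real^'n^'n) \<Rightarrow> real^'n \<Rightarrow> (real \<Rightarrow> real^'n \<Rightarrow> real) \<Rightarrow> bool" where
  "positive_fundamental_solution U g x p \<longleftrightarrow>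
     (\<forall>t>0. \<forall>y\<in>U. p t y > 0) \<and>
     C12_on U p \<and>
     (\<forall>t>0. \<forall>y\<in>U. deriv (\<lambda>s. p s y) t = 1 / 2 * laplace_beltrami g (p t) y) \<and>
     (\<forall>f :: real^'n \<Rightarrow> real.
        continuous_on U f \<and> (\<exists>K. compact K \<and> K \<subseteq> U \<and> (\<forall>y\<in>U - K. f y = 0)) \<longrightarrow>
        ((\<lambda>t. \<integral>y. p t y * f y \<partial>riem_volume U g) \<longlongrightarrow> f x) (at_right 0))"

text \<open>The heat kernel is the minimal positive fundamental solution.\<close>

definition is_heat_kernel ::
    "(real^'n::finite) set \<Rightarrow> (real^'n \<Rightarrow> real^'n^'n) \<Rightarrow> (real \<Rightarrow> real^'n \<Rightarrow> real^'n \<Rightarrow> real) \<Rightarrow> bool" where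
  "is_heat_kernel U g h \<longleftrightarrow>
     (\<forall>x\<in>U. positive_fundamental_solution U g x (\<lambda>t. h t x) \<and>
        (\<forall>p. positive_fundamental_solution U g x p \<longrightarrow> (\<forall>t>0. \<forall>y\<in>U. h t x y \<le> p t y)))"

definition entropy :: "'a measure \<Rightarrow> ('a \<Rightarrow> real) \<Rightarrow> real" where
  "entropy M f = - (\<integral>y. f y * ln (f y) \<partial>M)"

text \<open>
  Hyperbolic 3-space in the upper half-space model. The metric \<open>|dy|\<^sup>2 / (y\<^sub>3)\<^sup>2\<close> has
  curvature \<open>-1\<close>, so dividing it by \<open>-k\<close> gives constant sectional curvature \<open>k < 0\<close>.
\<close>

definition hyp3 :: "(real^3) set" where
  "hyp3 = {y. y $ 3 > 0}"

definition hyp3_metric :: "real \<Rightarrow> real^3 \<Rightarrow> real^3^3" where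
  "hyp3_metric k y = mat (1 / (- k * (y $ 3)\<^sup>2))"

abbreviation hyp3_volume :: "real \<Rightarrow> (real^3) measure" where
  "hyp3_volume k \<equiv> riem_volume hyp3 (hyp3_metric k)"

end

theory Submission
  imports Defs "HOL-Probability.Probability" "HOL-Real_Asymp.Real_Asymp"
begin

text \<open>
  Write \<open>q\<close> for the hyperbolic cosine of the distance \<open>r\<close> (in curvature \<open>-1\<close>) and \<open>\<tau> = -k t\<close>. The explicit
  kernel \<open>p\<close> is a smooth function of \<open>q\<close>, solves the heat equation and has mass one, so it is a
  positive fundamental solution and \<open>h \<le> p\<close> by minimality. Testing the nonnegative solution \<open>p - h\<close>
  against \<open>max 0 (1 - q / R) ^ 3\<close> and letting \<open>R\<close> tend to infinity shows that it has mass zero, hence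
  \<open>h = p\<close> almost everywhere. Under \<open>p\<close> the distance \<open>r\<close> is distributed like the absolute value of a Gaussian \<open>X\<close> of
  mean and variance \<open>\<tau>\<close>, weighted by \<open>X / \<tau>\<close>. This gives
  \<open>Ent = 3/2 ln (2 pi t) + \<tau> + 3/2 + E (ln (sinh r / r))\<close>,
  and dominated convergence shows that the derivative of the last term in \<open>\<tau>\<close> tends to \<open>1\<close>. So the derivative of the
  entropy in \<open>t\<close> converges to \<open>-2 k\<close>, which lies between the two bounds.
\<close>

section \<open>A special function: r / sinh r as a function of cosh r\<close>

text \<open>Minimality says nothing about derivatives or tails of h beyond h \<le> p. Testing
  against a compactly supported function moves the Laplacian off h, and what remains is controlled
  by h \<le> p alone. Equality almost everywhere is enough, since entropy sees h only through
  integrals. The variable q replaces r because r is not differentiable at y = x while q is smooth in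
  y. Moreover |grad q|^2 = q^2 - 1 and Laplacian q = 3 q (curvature -1), so the Laplacian acts on
  functions of q with polynomial coefficients. A cutoff linear in q / R then has Laplacian O(q / R),
  and the mean of q under p is the finite number exp (3 \<tau> / 2); this mean also yields the Dirac
  initial value as t tends to 0. For large \<tau>, r sits near \<tau> with spread sqrt \<tau>. There
  the increments of ln (sinh r / r) are those of r to leading order, the logarithmic
  \<tau>-derivative of the density is about z / sqrt \<tau> with z standard normal, and the product
  of the two averages to E z^2 = 1. This term gives one -k; the other comes from the explicit \<tau>
  in the entropy.\<close>

text \<open>This integral representation makes \<open>r / sinh r\<close> a smooth function of \<open>q = cosh r\<close> across \<open>q = 1\<close>.\<close>

definition rsinh_int :: "nat \<Rightarrow> real \<Rightarrow> real" where
  "rsinh_int n q = integral {0..1} (\<lambda>x. x ^ n / (x\<^sup>2 + 2 * q * x + 1) ^ Suc n)"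

lemma rsinh_denom_pos:
  fixes q x :: real
  assumes "-1 < q" "0 \<le> x"
  shows "0 < x\<^sup>2 + 2 * q * x + 1"
proof (cases "x = 0")
  case False
  then have "0 < 2 * (q + 1) * x" using assms by simp
  moreover have "x\<^sup>2 + 2 * q * x + 1 = (x - 1)\<^sup>2 + 2 * (q + 1) * x"
    by (simp add: power2_eq_square algebra_simps)
  ultimately show ?thesis by (simp add: add_nonneg_pos)
qed simp

lemma rsinh_int_integrable:
  assumes "-1 < q"
  shows "(\<lambda>x. x ^ m / (x\<^sup>2 + 2 * q * x + 1) ^ n) integrable_on {0..1::real}"
proof (intro integrable_continuous_interval continuous_intros ballI)
  fix x :: real assume "x \<in> {0..1}"
  then show "(x\<^sup>2 + 2 * q * x + 1) ^ n \<noteq> 0"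
    using rsinh_denom_pos[OF assms, of x] by simp
qed

text \<open>Leibniz rule on the open convex set q > -1, where the denominator has no zero on [0,1].
  The value q = 1, which is the case of coinciding points, is interior there; \<open>arcosh\<close>
  offers no derivative at it.\<close>

lemma DERIV_rsinh_int:
  assumes "-1 < q"
  shows "(rsinh_int n has_real_derivative - 2 * real (Suc n) * rsinh_int (Suc n) q) (at q)"
proof -
  let ?D = "\<lambda>q x::real. x\<^sup>2 + 2 * q * x + 1"
  have "((\<lambda>q. integral (cbox 0 1) (\<lambda>x. x ^ n / ?D q x ^ Suc n)) has_real_derivative
      integral (cbox 0 1) (\<lambda>x. - 2 * real (Suc n) * (x ^ Suc n / ?D q x ^ Suc (Suc n))))
      (at q within {-1<..})"
  proof (rule leibniz_rule_field_derivative)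
    fix p x :: real assume "p \<in> {-1<..}" "x \<in> cbox 0 1"
    then have D: "?D p x \<noteq> 0" using rsinh_denom_pos[of p x] by auto
    have "((\<lambda>p. ?D p x) has_real_derivative 2 * x) (at p within {-1<..})"
      by (auto intro!: derivative_eq_intros)
    from DERIV_divide[OF DERIV_const[of "x ^ n"] DERIV_power_Suc[OF this, of n]] D
    have "((\<lambda>p. x ^ n / ?D p x ^ Suc n) has_real_derivative
       - (x ^ n * (real (Suc n) * ?D p x ^ n * (2 * x))) / (?D p x ^ Suc n * ?D p x ^ Suc n)) (at p within {-1<..})"
      by (simp add: algebra_simps del: power_Suc)
    also have "- (x ^ n * (real (Suc n) * ?D p x ^ n * (2 * x))) / (?D p x ^ Suc n * ?D p x ^ Suc n)
        = - 2 * real (Suc n) * (x ^ Suc n / ?D p x ^ Suc (Suc n))"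
      using D by (simp add: divide_simps) (simp add: algebra_simps)
    finally show "((\<lambda>p. x ^ n / ?D p x ^ Suc n) has_real_derivative
        - 2 * real (Suc n) * (x ^ Suc n / ?D p x ^ Suc (Suc n))) (at p within {-1<..})" .
  next
    show "continuous_on ({- 1<..} \<times> cbox 0 1) (\<lambda>(p, x). - 2 * real (Suc n) * (x ^ Suc n / ?D p x ^ Suc (Suc n)))"
      unfolding split_beta
    proof (intro continuous_intros ballI)
      fix z :: "real \<times> real" assume "z \<in> {-1<..} \<times> cbox 0 1"
      then show "?D (fst z) (snd z) ^ Suc (Suc n) \<noteq> 0"
        using rsinh_denom_pos[of "fst z" "snd z"] by (auto simp del: power_Suc)
    qed
  next
    fix p :: real assume "p \<in> {-1<..}"
    then show "(\<lambda>x. x ^ n / ?D p x ^ Suc n) integrable_on cbox 0 1"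
      using rsinh_int_integrable[of p n "Suc n"] by (simp only: cbox_interval greaterThan_iff)
  qed (use assms in auto)
  then have "(rsinh_int n has_real_derivative - 2 * real (Suc n) * rsinh_int (Suc n) q) (at q within {-1<..})"
    unfolding rsinh_int_def[abs_def] by (simp only: integral_mult_right cbox_interval)
  then show ?thesis
    using assms by (simp add: at_within_open[of q "{-1<..}"])
qed

text \<open>For q = cosh r the denominator factors as (x + e^r) (x + e^-r), and partial fractions
  give r / (2 sinh r) for \<open>rsinh_int 0 q\<close>; hence the factor 2. The constants -4 and 16
  come from the factors -2 and -4 that the next two differentiations produce.\<close>

definition rsinh :: "real \<Rightarrow> real" where "rsinh q = 2 * rsinh_int 0 q"
definition rsinh' :: "real \<Rightarrow> real" where "rsinh' q = - 4 * rsinh_int 1 q"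
definition rsinh'' :: "real \<Rightarrow> real" where "rsinh'' q = 16 * rsinh_int 2 q"

lemma DERIV_rsinh: "-1 < q \<Longrightarrow> (rsinh has_real_derivative rsinh' q) (at q)"
  unfolding rsinh_def[abs_def] rsinh'_def
  by (auto intro!: derivative_eq_intros DERIV_rsinh_int)

lemma DERIV_rsinh': "-1 < q \<Longrightarrow> (rsinh' has_real_derivative rsinh'' q) (at q)"
  unfolding rsinh'_def[abs_def] rsinh''_def
  by (auto intro!: derivative_eq_intros DERIV_rsinh_int simp: numeral_2_eq_2)

lemma continuous_on_rsinh: "continuous_on {-1<..} rsinh"
  by (meson DERIV_rsinh DERIV_isCont continuous_at_imp_continuous_on greaterThan_iff)

lemma continuous_on_rsinh': "continuous_on {-1<..} rsinh'"
  by (meson DERIV_rsinh' DERIV_isCont continuous_at_imp_continuous_on greaterThan_iff)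

lemma continuous_on_rsinh'': "continuous_on {-1<..} rsinh''"
  unfolding rsinh''_def[abs_def] using DERIV_isCont[OF DERIV_rsinh_int]
  by (intro continuous_intros continuous_at_imp_continuous_on) auto

text \<open>With f = \<open>rsinh\<close> this is the r-derivative of f (cosh r) * sinh r = r. It is
  obtained from the integral instead, so that it holds through q = 1 and serves to prove that very
  identity afterwards.\<close>

lemma rsinh_ode1:
  assumes "-1 < q"
  shows "(q\<^sup>2 - 1) * rsinh' q + q * rsinh q = 1"
proof -
  let ?D = "\<lambda>x::real. x\<^sup>2 + 2 * q * x + 1"
  let ?f = "\<lambda>x. 2 * q * (x ^ 0 / ?D x ^ Suc 0) - 4 * (q\<^sup>2 - 1) * (x ^ 1 / ?D x ^ Suc 1)"
  \<comment> \<open>The combination of integrands is exact: -2 (q x + 1) / D(x) is an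
    antiderivative, with value -1 at x = 1 and -2 at x = 0.\<close>
  have fi: "(?f has_integral (- 2 * (q * 1 + 1) / ?D 1) - (- 2 * (q * 0 + 1) / ?D 0)) {0..1}"
  proof (rule fundamental_theorem_of_calculus)
    fix x :: real assume "x \<in> {0..1}"
    then have D: "?D x \<noteq> 0" using rsinh_denom_pos[OF assms, of x] by auto
    have "(?D has_real_derivative 2 * x + 2 * q) (at x within {0..1})"
      "((\<lambda>x. - 2 * (q * x + 1)) has_real_derivative - 2 * q) (at x within {0..1})"
      by (auto intro!: derivative_eq_intros)
    from DERIV_divide[OF this(2,1) D]
    have "((\<lambda>x. - 2 * (q * x + 1) / ?D x) has_real_derivative
        (- 2 * q * ?D x - (- 2 * (q * x + 1)) * (2 * x + 2 * q)) / (?D x * ?D x)) (at x within {0..1})" .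
    also have "(- 2 * q * ?D x - (- 2 * (q * x + 1)) * (2 * x + 2 * q)) / (?D x * ?D x) =
       (2 * q * ?D x - 4 * (q\<^sup>2 - 1) * x) / (?D x * ?D x)"
      by (rule arg_cong2[where f="(/)"]) (auto simp: power2_eq_square algebra_simps)
    also have "\<dots> = ?f x"
      using D by (simp add: diff_divide_distrib)
    finally show "((\<lambda>x. - 2 * (q * x + 1) / ?D x) has_vector_derivative ?f x) (at x within {0..1})"
      by (simp add: has_real_derivative_iff_has_vector_derivative)
  qed simp
  have eq: "- 2 * (q * 1 + 1) / ?D 1 - (- 2 * (q * 0 + 1) / ?D 0) = 1"
    using assms by (simp add: field_simps)
  have "integral {0..1} ?f = 1"
    using integral_unique[OF fi] by (simp only: eq)
  moreover have "integral {0..1} ?f = 2 * q * rsinh_int 0 q - 4 * (q\<^sup>2 - 1) * rsinh_int 1 q"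
    unfolding rsinh_int_def
    using integral_diff[OF integrable_on_cmult_left[OF rsinh_int_integrable[OF assms, of 0 "Suc 0"], of "2 * q"]
        integrable_on_cmult_left[OF rsinh_int_integrable[OF assms, of 1 "Suc 1"], of "4 * (q\<^sup>2 - 1)"]]
    by (simp only: integral_mult_right of_real_eq_id id_apply)
  ultimately show ?thesis by (simp add: rsinh_def rsinh'_def algebra_simps)
qed

lemma rsinh_ode2:
  assumes "-1 < q"
  shows "(q\<^sup>2 - 1) * rsinh'' q + 3 * q * rsinh' q + rsinh q = 0"
proof -
  let ?g = "\<lambda>q. (q\<^sup>2 - 1) * rsinh' q + q * rsinh q"
  have "(?g has_real_derivative (q\<^sup>2 - 1) * rsinh'' q + 3 * q * rsinh' q + rsinh q) (at q)"
    using assms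
    by (auto intro!: derivative_eq_intros DERIV_rsinh DERIV_rsinh' simp: algebra_simps)
  moreover have "(?g has_real_derivative 0) (at q)"
  proof (rule has_field_derivative_transform_within_open[where f="\<lambda>_. 1" and S="{-1<..}"])
  qed (use assms rsinh_ode1 in auto)
  ultimately show ?thesis by (rule DERIV_unique)
qed

text \<open>The difference of the two sides has derivative zero by \<open>rsinh_ode1\<close> and
  vanishes at r = 0. The product form avoids the exception at r = 0.\<close>

lemma rsinh_cosh_mult_sinh: "rsinh (cosh r) * sinh r = r" for r :: real
proof -
  have "((\<lambda>r. rsinh (cosh r) * sinh r - r) has_real_derivative 0) (at x)" for x :: real
  proof -
    have c: "-1 < cosh x" using cosh_real_ge_1[of x] by linarith
    have "((\<lambda>r. rsinh (cosh r) * sinh r - r) has_real_derivative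
      (rsinh' (cosh x) * sinh x) * sinh x + rsinh (cosh x) * cosh x - 1) (at x)"
      by (auto intro!: derivative_eq_intros DERIV_chain2[where f=rsinh] DERIV_rsinh c simp: algebra_simps)
    also have "(rsinh' (cosh x) * sinh x) * sinh x + rsinh (cosh x) * cosh x - 1 = 0"
      using rsinh_ode1[OF c] cosh_square_eq[of x] by algebra
    finally show ?thesis .
  qed
  from DERIV_isconst_all[rule_format, OF this, of r 0] show ?thesis by simp
qed

lemma rsinh_1: "rsinh 1 = 1"
  using rsinh_ode1[of 1] by simp

lemma rsinh_cosh: "r \<noteq> 0 \<Longrightarrow> rsinh (cosh r) = r / sinh r"
  using rsinh_cosh_mult_sinh[of r] by (simp add: field_simps)

lemma rsinh_pos:
  assumes "1 \<le> q" shows "0 < rsinh q"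
proof -
  obtain r where r: "q = cosh r" using cosh_arcosh_real[OF assms] by metis
  show ?thesis
  proof (cases "r = 0")
    case False
    then show ?thesis unfolding r rsinh_cosh[OF False]
      by (cases "r > 0") (auto simp: divide_neg_neg)
  qed (simp add: r rsinh_1)
qed

text \<open>The squared distance r^2 as a function of q = cosh r, from r = sinh r * (r / sinh r). In
  this form it is differentiable on all of q > -1, although \<open>arcosh\<close> is not
  differentiable at 1.\<close>

definition arcosh_sq :: "real \<Rightarrow> real" where
  "arcosh_sq q = (q\<^sup>2 - 1) * (rsinh q)\<^sup>2"

lemma arcosh_sq_cosh: "arcosh_sq (cosh r) = r\<^sup>2"
proof -
  have "arcosh_sq (cosh r) = (rsinh (cosh r) * sinh r)\<^sup>2"
    by (simp add: arcosh_sq_def cosh_square_eq power_mult_distrib)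
  then show ?thesis by (simp add: rsinh_cosh_mult_sinh)
qed

lemma DERIV_arcosh_sq:
  assumes "-1 < q"
  shows "(arcosh_sq has_real_derivative 2 * rsinh q) (at q)"
proof -
  have "(arcosh_sq has_real_derivative 2 * rsinh q * ((q\<^sup>2 - 1) * rsinh' q + q * rsinh q)) (at q)"
    unfolding arcosh_sq_def[abs_def] using assms
    by (auto intro!: derivative_eq_intros DERIV_rsinh simp: algebra_simps power2_eq_square)
  then show ?thesis by (simp add: rsinh_ode1[OF assms])
qed

lemma continuous_on_arcosh_sq: "continuous_on {-1<..} arcosh_sq"
  by (meson DERIV_arcosh_sq DERIV_isCont continuous_at_imp_continuous_on greaterThan_iff)

text \<open>The even function ln (sinh r / r), with its removable singularity at r = 0 filled by the
  value 0.\<close>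

definition log_sinhc :: "real \<Rightarrow> real" where
  "log_sinhc r = - ln (rsinh (cosh r))"

lemma log_sinhc_0: "log_sinhc 0 = 0"
  by (simp add: log_sinhc_def rsinh_1)

lemma log_sinhc_eq: "r \<noteq> 0 \<Longrightarrow> log_sinhc r = ln (sinh r / r)"
  unfolding log_sinhc_def by (simp add: rsinh_cosh) (metis inverse_divide ln_inverse minus_minus)

lemma tanh_real_le_self:
  assumes "0 \<le> x" shows "tanh x \<le> (x::real)"
proof -
  have "(\<lambda>x. x - tanh x) 0 \<le> (\<lambda>x. x - tanh x) x"
  proof (rule DERIV_nonneg_imp_nondecreasing[OF assms], rule exI, rule conjI)
    fix y :: real
    show "((\<lambda>x. x - tanh x) has_real_derivative (tanh y)\<^sup>2) (at y)"
      by (auto intro!: derivative_eq_intros)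
  qed simp
  then show ?thesis by simp
qed

text \<open>Away from 0 the derivative is coth r - 1/r. For r > 0 it is nonnegative because tanh r
  \<le> r, and at most 1 because coth r - 1 = 2 / (e^(2r) - 1) \<le> 1/r; oddness covers r < 0. The
  resulting Lipschitz constant 1 is what makes the later Gaussian integrands dominated.\<close>

lemma DERIV_log_sinhc: "\<exists>D. (log_sinhc has_real_derivative D) (at x) \<and> \<bar>D\<bar> \<le> 1"
proof -
  have c: "-1 < cosh y" for y :: real using cosh_real_ge_1[of y] by linarith
  have p: "0 < rsinh (cosh y)" for y :: real using cosh_real_ge_1[of y] by (rule rsinh_pos)
  let ?D = "- (rsinh' (cosh x) * sinh x / rsinh (cosh x))"
  have D: "(log_sinhc has_real_derivative ?D) (at x)"
    unfolding log_sinhc_def[abs_def] using p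
    by (auto intro!: derivative_eq_intros DERIV_chain2[where f=rsinh] DERIV_rsinh c simp: field_simps)
  have bnd: "\<bar>1 / tanh y - 1 / y\<bar> \<le> 1" if "0 < y" for y :: real
  proof -
    have t: "0 < tanh y" using that by simp
    have "1 / y \<le> 1 / tanh y"
      using tanh_real_le_self[of y] that t by (intro divide_left_mono) auto
    moreover have "1 / tanh y - 1 \<le> 1 / y"
    proof -
      have e: "2 * y \<le> exp (2 * y) - 1" using exp_ge_add_one_self[of "2 * y"] by linarith
      have "1 / tanh y - 1 = 2 / (exp (2 * y) - 1)"
      proof -
        have E: "exp (2 * y) = exp y * exp y" by (simp add: exp_add[symmetric])
        have "exp y > 1" using that by simp
        then have "exp y * exp y > 1" by (simp add: less_1_mult)
        then show ?thesis using t
          unfolding tanh_def sinh_field_def cosh_field_def E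
          by (simp add: field_simps exp_minus)
      qed
      also have "\<dots> \<le> 2 / (2 * y)" using e that by (intro divide_left_mono) auto
      finally show ?thesis by simp
    qed
    ultimately show ?thesis by (simp add: abs_le_iff)
  qed
  have "\<bar>?D\<bar> \<le> 1"
  proof (cases "x = 0")
    case False
    have sh: "sinh x \<noteq> 0" using False by simp
    have "?D = 1 / tanh x - 1 / x"
    proof -
      have "(sinh x)\<^sup>2 * rsinh' (cosh x) = 1 - cosh x * (x / sinh x)"
        using rsinh_ode1[OF c, of x] by (simp add: cosh_square_eq rsinh_cosh[OF False])
      then have *: "rsinh' (cosh x) = (1 - cosh x * (x / sinh x)) / (sinh x)\<^sup>2"
        using sh by (simp add: field_simps)
      show ?thesis unfolding * rsinh_cosh[OF False] tanh_def using False sh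
        by (simp add: field_simps power2_eq_square)
    qed
    moreover have "\<bar>1 / tanh x - 1 / x\<bar> \<le> 1"
      using bnd[of x] bnd[of "-x"] False by (cases "x > 0") (auto simp: abs_le_iff)
    ultimately show ?thesis by simp
  qed simp
  with D show ?thesis by blast
qed

lemma log_sinhc_lipschitz: "\<bar>log_sinhc a - log_sinhc b\<bar> \<le> \<bar>a - b\<bar>"
proof -
  obtain D where D: "\<And>x. (log_sinhc has_real_derivative D x) (at x)" "\<And>x. \<bar>D x\<bar> \<le> 1"
    using DERIV_log_sinhc by metis
  have "norm (log_sinhc a - log_sinhc b) \<le> 1 * norm (a - b)"
    by (rule field_differentiable_bound[of UNIV log_sinhc D]) (use D in auto)
  then show ?thesis by simp
qed

lemma log_sinhc_bound: "\<bar>log_sinhc a\<bar> \<le> \<bar>a\<bar>"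
  using log_sinhc_lipschitz[of a 0] by (simp add: log_sinhc_0)

lemma log_sinhc_minus: "log_sinhc (- a) = log_sinhc a"
  by (simp add: log_sinhc_def)

lemma continuous_on_log_sinhc: "continuous_on A log_sinhc"
  by (meson DERIV_log_sinhc DERIV_isCont continuous_at_imp_continuous_on)

lemma borel_measurable_log_sinhc [measurable]: "log_sinhc \<in> borel_measurable borel"
  by (rule borel_measurable_continuous_onI[OF continuous_on_log_sinhc])


section \<open>Radial density and the mean of the logarithm of sinh r / r\<close>

text \<open>The mean value inequality turns the bound w on the derivative into a bound on the
  difference quotients, and dominated convergence applies along every sequence tending to t. It is
  used for the \<tau>-derivative of the mean, for translations, and for solutions tested against a
  fixed function.\<close>

lemma has_real_derivative_integral:
  fixes f f' :: "real \<Rightarrow> 'a \<Rightarrow> real"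
  assumes t: "t \<in> {a<..<b}"
    and int: "\<And>s. s \<in> {a<..<b} \<Longrightarrow> integrable M (f s)"
    and der: "\<And>s y. s \<in> {a<..<b} \<Longrightarrow> y \<in> space M \<Longrightarrow> ((\<lambda>s. f s y) has_real_derivative f' s y) (at s)"
    and bnd: "\<And>s y. s \<in> {a<..<b} \<Longrightarrow> y \<in> space M \<Longrightarrow> \<bar>f' s y\<bar> \<le> w y"
    and w: "integrable M w"
    and meas[measurable]: "f' t \<in> borel_measurable M"
  shows "((\<lambda>s. \<integral>y. f s y \<partial>M) has_real_derivative (\<integral>y. f' t y \<partial>M)) (at t)"
proof -
  have "((\<lambda>s. ((\<integral>y. f s y \<partial>M) - (\<integral>y. f t y \<partial>M)) / (s - t)) \<longlongrightarrow> (\<integral>y. f' t y \<partial>M)) (at t within {a<..<b})"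
    unfolding tendsto_at_iff_sequentially
  proof (intro allI impI)
    fix X :: "nat \<Rightarrow> real" assume X: "\<forall>i. X i \<in> {a<..<b} - {t}" and lim: "X \<longlonglongrightarrow> t"
    have m: "f (X i) \<in> borel_measurable M" "f t \<in> borel_measurable M" for i
      using int[of "X i"] int[OF t] X by auto
    have "(\<lambda>i. \<integral>y. (f (X i) y - f t y) / (X i - t) \<partial>M) \<longlonglongrightarrow> (\<integral>y. f' t y \<partial>M)"
    proof (rule integral_dominated_convergence[OF meas _ w])
      show "(\<lambda>y. (f (X i) y - f t y) / (X i - t)) \<in> borel_measurable M" for i
        using m by measurable
      show "AE y in M. (\<lambda>i. (f (X i) y - f t y) / (X i - t)) \<longlonglongrightarrow> f' t y"
      proof (rule AE_I2)
        fix y assume y: "y \<in> space M"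
        have "((\<lambda>s. (f s y - f t y) / (s - t)) \<longlongrightarrow> f' t y) (at t within {a<..<b})"
          using has_field_derivative_at_within[OF der[OF t y], of "{a<..<b}"]
          by (simp add: has_field_derivative_iff)
        then show "(\<lambda>i. (f (X i) y - f t y) / (X i - t)) \<longlonglongrightarrow> f' t y"
          using X lim by (simp add: tendsto_at_iff_sequentially comp_def)
      qed
      show "AE y in M. norm ((f (X i) y - f t y) / (X i - t)) \<le> w y" for i
      proof (rule AE_I2)
        fix y assume y: "y \<in> space M"
        have Xi: "X i \<in> {a<..<b}" "X i \<noteq> t" using X by auto
        have "norm (f (X i) y - f t y) \<le> w y * norm (X i - t)"
        proof (rule field_differentiable_bound[of "{a<..<b}" _ "\<lambda>s. f' s y"])
          fix s assume s: "s \<in> {a<..<b}"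
          show "((\<lambda>s. f s y) has_real_derivative f' s y) (at s within {a<..<b})"
            by (rule has_field_derivative_at_within[OF der[OF s y]])
          show "norm (f' s y) \<le> w y" using bnd[OF s y] by simp
        qed (use Xi t in auto)
        then show "norm ((f (X i) y - f t y) / (X i - t)) \<le> w y"
          using Xi by (simp add: divide_le_eq)
      qed
    qed
    moreover have eq: "(\<integral>y. (f (X i) y - f t y) / (X i - t) \<partial>M)
        = ((\<integral>y. f (X i) y \<partial>M) - (\<integral>y. f t y \<partial>M)) / (X i - t)" for i
      using int[of "X i"] int[OF t] X by simp
    ultimately show "((\<lambda>s. ((\<integral>y. f s y \<partial>M) - (\<integral>y. f t y \<partial>M)) / (s - t)) \<circ> X)
        \<longlonglongrightarrow> (\<integral>y. f' t y \<partial>M)"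
      by (simp only: comp_def eq)
  qed
  then show ?thesis
    using t by (simp add: has_field_derivative_iff at_within_open[of t "{a<..<b}"])
qed

text \<open>The reflection x -> -x moves the negative half-line onto the positive one; the point 0
  is null. Gaussian integrals over the line thereby become integrals over distances.\<close>

lemma has_bochner_integral_fold_real:
  fixes H :: "real \<Rightarrow> real"
  assumes "has_bochner_integral lborel H I"
  shows "has_bochner_integral lborel (\<lambda>x. indicator {0<..} x * (H x + H (- x))) I"
proof -
  have H: "integrable lborel H" and I: "I = (\<integral>x. H x \<partial>lborel)"
    using assms by (auto simp: has_bochner_integral_iff)
  have p: "integrable lborel (\<lambda>x. indicator {0<..} x * H x)"
    and n: "integrable lborel (\<lambda>x. indicator {..<0} x * H x)"
    using integrable_mult_indicator[OF _ H] by auto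
  have "has_bochner_integral lborel (\<lambda>x. indicator {..<0} (0 + (-1) * x) * H (0 + (-1) * x))
      (\<integral>x. indicator {..<0} x * H x \<partial>lborel)"
    using lborel_has_bochner_integral_real_affine_iff[of "-1" "\<lambda>x. indicator {..<0} x * H x" _ 0,
        THEN iffD1, OF _ has_bochner_integral_integrable[OF n]]
    by simp
  moreover have "indicator {..<0} (0 + (-1) * x) = (indicator {0<..} x :: real)" for x :: real
    by (auto split: split_indicator)
  ultimately have "has_bochner_integral lborel (\<lambda>x. indicator {0<..} x * H (- x))
      (\<integral>x. indicator {..<0} x * H x \<partial>lborel)"
    by simp
  then have "has_bochner_integral lborel
      (\<lambda>x. indicator {0<..} x * H x + indicator {0<..} x * H (- x))
      ((\<integral>x. indicator {0<..} x * H x \<partial>lborel) + (\<integral>x. indicator {..<0} x * H x \<partial>lborel))"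
    using p by (intro has_bochner_integral_add) (simp add: has_bochner_integral_iff)
  moreover have "(\<integral>x. indicator {0<..} x * H x \<partial>lborel) + (\<integral>x. indicator {..<0} x * H x \<partial>lborel) = I"
  proof -
    have "AE x in lborel. (x::real) \<noteq> 0" by (rule AE_lborel_singleton)
    then have "(\<integral>x. H x \<partial>lborel)
        = (\<integral>x. indicator {0<..} x * H x + indicator {..<0} x * H x \<partial>lborel)"
      using H p n by (intro integral_cong_AE) (auto split: split_indicator)
    then show ?thesis unfolding I using p n by simp
  qed
  ultimately show ?thesis by (simp add: distrib_left)
qed

text \<open>The area 4 pi (sinh r)^2 of the sphere of radius r in curvature -1 times the kernel at
  time \<tau>; one factor sinh r cancels against r / sinh r.\<close>

definition radial_density :: "real \<Rightarrow> real \<Rightarrow> real" where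
  "radial_density \<tau> r = 2 / (\<tau> * sqrt (2 * pi * \<tau>)) * exp (- \<tau> / 2) * (r * sinh r * exp (- r\<^sup>2 / (2 * \<tau>)))"

lemma measurable_radial_density [measurable]: "radial_density \<tau> \<in> borel_measurable borel"
  unfolding radial_density_def[abs_def] sinh_field_def by measurable

lemma radial_density_nonneg: "0 < \<tau> \<Longrightarrow> 0 < r \<Longrightarrow> 0 \<le> radial_density \<tau> r"
  by (simp add: radial_density_def)

text \<open>Split 2 sinh r into e^r - e^-r and complete the square in each exponent: both terms
  become the normal density of mean and variance \<tau>, evaluated at r and at -r.\<close>

lemma radial_density_normal:
  assumes "0 < \<tau>"
  shows "radial_density \<tau> r
    = r / \<tau> * normal_density \<tau> (sqrt \<tau>) r + (- r) / \<tau> * normal_density \<tau> (sqrt \<tau>) (- r)"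
proof -
  have [simp]: "(sqrt \<tau>)\<^sup>2 = \<tau>" using assms by simp
  have "- (r - \<tau>)\<^sup>2 / (2 * \<tau>) = - \<tau> / 2 + - r\<^sup>2 / (2 * \<tau>) + r"
    "- (- r - \<tau>)\<^sup>2 / (2 * \<tau>) = - \<tau> / 2 + - r\<^sup>2 / (2 * \<tau>) + - r"
    using assms by (simp_all add: field_simps power2_eq_square)
  then have "exp (- (r - \<tau>)\<^sup>2 / (2 * \<tau>)) = exp (- \<tau> / 2) * exp (- r\<^sup>2 / (2 * \<tau>)) * exp r"
    "exp (- (- r - \<tau>)\<^sup>2 / (2 * \<tau>)) = exp (- \<tau> / 2) * exp (- r\<^sup>2 / (2 * \<tau>)) * exp (- r)"
    by (simp_all only: exp_add)
  then have "normal_density \<tau> (sqrt \<tau>) r = 1 / sqrt (2 * pi * \<tau>) * (exp (- \<tau> / 2) * exp (- r\<^sup>2 / (2 * \<tau>)) * exp r)"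
    "normal_density \<tau> (sqrt \<tau>) (- r) = 1 / sqrt (2 * pi * \<tau>) * (exp (- \<tau> / 2) * exp (- r\<^sup>2 / (2 * \<tau>)) * exp (- r))"
    by (simp_all only: normal_density_def \<open>(sqrt \<tau>)\<^sup>2 = \<tau>\<close>)
  then show ?thesis
    unfolding radial_density_def sinh_field_def using assms by (simp add: field_simps)
qed

text \<open>The radial part of the heat kernel is the law of the absolute value of a Gaussian variable of
  mean and variance \<open>\<tau>\<close>, biased by its value.\<close>

lemma has_bochner_integral_radial:
  assumes \<tau>: "0 < \<tau>" and even: "\<And>r. G (- r) = G r"
    and G: "has_bochner_integral lborel
      (\<lambda>z. std_normal_density z * ((1 + z / sqrt \<tau>) * G (\<tau> + sqrt \<tau> * z))) I"
  shows "has_bochner_integral lborel (\<lambda>r. indicator {0<..} r * (radial_density \<tau> r * G r)) I"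
proof -
  let ?H = "\<lambda>r. r / \<tau> * normal_density \<tau> (sqrt \<tau>) r * G r"
  \<comment> \<open>Standardization r = \<tau> + sqrt \<tau> z. The factor 1 / sqrt \<tau> of the
    normal density cancels against the Jacobian.\<close>
  have "?H (\<tau> + sqrt \<tau> * z) = (std_normal_density z * ((1 + z / sqrt \<tau>) * G (\<tau> + sqrt \<tau> * z))) / sqrt \<tau>" for z
  proof -
    have "normal_density \<tau> (sqrt \<tau>) (\<tau> + sqrt \<tau> * z) = std_normal_density z / sqrt \<tau>"
      using \<tau> by (simp add: normal_density_def power_mult_distrib real_sqrt_mult)
    moreover have "(\<tau> + sqrt \<tau> * z) / \<tau> = 1 + z / sqrt \<tau>"
      using \<tau> by (simp add: field_simps)
    ultimately show ?thesis by simp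
  qed
  then have "has_bochner_integral lborel (\<lambda>z. ?H (\<tau> + sqrt \<tau> * z)) (I / sqrt \<tau>)"
    using G by (simp add: has_bochner_integral_divide_zero)
  then have "has_bochner_integral lborel ?H I"
    using lborel_has_bochner_integral_real_affine_iff[of "sqrt \<tau>" ?H I \<tau>] \<tau>
    by (simp add: divide_inverse mult.commute)
  from has_bochner_integral_fold_real[OF this] show ?thesis
    by (simp add: even radial_density_normal[OF \<tau>] algebra_simps)
qed

lemma radial_mass:
  assumes "0 < \<tau>"
  shows "has_bochner_integral lborel (\<lambda>r. indicator {0<..} r * radial_density \<tau> r) 1"
proof -
  have "has_bochner_integral lborel
      (\<lambda>z. std_normal_density z + std_normal_density z * z / sqrt \<tau>) (1 + 0 / sqrt \<tau>)"
    using std_normal_moment_even[of 0] std_normal_moment_odd[of 0]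
    by (intro has_bochner_integral_add has_bochner_integral_divide_zero) simp_all
  then show ?thesis
    using has_bochner_integral_radial[OF assms, of "\<lambda>_. 1" 1] by (simp add: distrib_left)
qed

text \<open>The integrand is sqrt \<tau> (sqrt \<tau> + z)^3 times the Gaussian, and only the even
  moments of z survive. The value is exactly the one for which \<open>radial_rate\<close> has mean
  zero.\<close>

lemma radial_second_moment:
  assumes "0 < \<tau>"
  shows "has_bochner_integral lborel (\<lambda>r. indicator {0<..} r * (radial_density \<tau> r * r\<^sup>2)) (\<tau>\<^sup>2 + 3 * \<tau>)"
proof (rule has_bochner_integral_radial[OF assms])
  let ?n = std_normal_density
  have "has_bochner_integral lborel
      (\<lambda>z. \<tau>\<^sup>2 * ?n z + 3 * \<tau> * sqrt \<tau> * (?n z * z) + 3 * \<tau> * (?n z * z\<^sup>2) + sqrt \<tau> * (?n z * z ^ 3))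
      (\<tau>\<^sup>2 * 1 + 3 * \<tau> * sqrt \<tau> * 0 + 3 * \<tau> * 1 + sqrt \<tau> * 0)"
    using std_normal_moment_even[of 0] std_normal_moment_odd[of 0]
      std_normal_moment_even[of 1] std_normal_moment_odd[of 1]
    by (intro has_bochner_integral_add has_bochner_integral_mult_right)
      (simp_all add: numeral_3_eq_3)
  moreover have "?n z * ((1 + z / sqrt \<tau>) * (\<tau> + sqrt \<tau> * z)\<^sup>2)
      = \<tau>\<^sup>2 * ?n z + 3 * \<tau> * sqrt \<tau> * (?n z * z) + 3 * \<tau> * (?n z * z\<^sup>2) + sqrt \<tau> * (?n z * z ^ 3)" for z
  proof -
    define s where "s = sqrt \<tau>"
    have s: "s > 0" "\<tau> = s\<^sup>2" using assms by (auto simp: s_def)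
    show ?thesis unfolding s_def[symmetric] using s
      by (simp add: field_simps power2_eq_square power3_eq_cube)
  qed
  ultimately show "has_bochner_integral lborel (\<lambda>z. ?n z * ((1 + z / sqrt \<tau>) * (\<tau> + sqrt \<tau> * z)\<^sup>2)) (\<tau>\<^sup>2 + 3 * \<tau>)"
    by simp
qed simp

text \<open>The growth rate 3/2 reflects that cosh r is an eigenfunction of the Laplacian with
  eigenvalue 3. In the computation, e^r tilts the Gaussian to mean s = sqrt \<tau>, where the weight
  1 + z/s averages to 2, and e^-r tilts it to mean -s, where the weight averages to 0. This moment
  controls both the initial value and the error of the cutoff.\<close>

lemma radial_cosh_moment:
  assumes "0 < \<tau>"
  shows "has_bochner_integral lborel (\<lambda>r. indicator {0<..} r * (radial_density \<tau> r * cosh r)) (exp (3 * \<tau> / 2))"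
proof (rule has_bochner_integral_radial[OF assms])
  let ?n = std_normal_density
  define s where "s = sqrt \<tau>"
  have s: "s > 0" "\<tau> = s\<^sup>2" using assms by (auto simp: s_def)
  have n: "has_bochner_integral lborel (\<lambda>z. (normal_density m 1 z + normal_density m 1 z * z / s)) (1 + m / s)" for m
    by (intro has_bochner_integral_add has_bochner_integral_divide_zero normal_moment_nz_1)
      (auto simp: has_bochner_integral_iff)
  have "has_bochner_integral lborel
      (\<lambda>z. exp (3 * \<tau> / 2) / 2 * (normal_density s 1 z + normal_density s 1 z * z / s)
        + exp (- \<tau> / 2) / 2 * (normal_density (- s) 1 z + normal_density (- s) 1 z * z / s))
      (exp (3 * \<tau> / 2) / 2 * (1 + s / s) + exp (- \<tau> / 2) / 2 * (1 + (- s) / s))"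
    by (intro has_bochner_integral_add has_bochner_integral_mult_right n)
  moreover have "?n z * ((1 + z / sqrt \<tau>) * cosh (\<tau> + sqrt \<tau> * z)) =
      exp (3 * \<tau> / 2) / 2 * (normal_density s 1 z + normal_density s 1 z * z / s)
        + exp (- \<tau> / 2) / 2 * (normal_density (- s) 1 z + normal_density (- s) 1 z * z / s)" for z
  proof -
    have "- z\<^sup>2 / 2 + (s\<^sup>2 + s * z) = 3 * s\<^sup>2 / 2 + - (z - s)\<^sup>2 / 2"
      "- z\<^sup>2 / 2 + - (s\<^sup>2 + s * z) = - s\<^sup>2 / 2 + - (z - - s)\<^sup>2 / 2"
      by (simp_all add: field_simps power2_eq_square)
    then have "?n z * exp (s\<^sup>2 + s * z) = exp (3 * s\<^sup>2 / 2) * normal_density s 1 z"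
      "?n z * exp (- (s\<^sup>2 + s * z)) = exp (- s\<^sup>2 / 2) * normal_density (- s) 1 z"
      by (simp_all add: normal_density_def mult_exp_exp)
    note E = this
    have "?n z * ((1 + z / s) * cosh (s\<^sup>2 + s * z))
        = (1 + z / s) / 2 * (?n z * exp (s\<^sup>2 + s * z)) + (1 + z / s) / 2 * (?n z * exp (- (s\<^sup>2 + s * z)))"
      unfolding cosh_field_def by (simp add: field_simps)
    then show ?thesis
      using s(1) unfolding E s_def[symmetric] s(2) by (simp add: field_simps)
  qed
  ultimately show "has_bochner_integral lborel
      (\<lambda>z. ?n z * ((1 + z / sqrt \<tau>) * cosh (\<tau> + sqrt \<tau> * z))) (exp (3 * \<tau> / 2))"
    using s by simp
qed simp

lemma integrable_normal_affine_power:
  "integrable lborel (\<lambda>z. std_normal_density z * (z ^ i * (a + b * z) ^ m))"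
proof (induction m arbitrary: i)
  case 0
  then show ?case using integrable_std_normal_moment[of i] by simp
next
  case (Suc m)
  have "integrable lborel (\<lambda>z. a * (std_normal_density z * (z ^ i * (a + b * z) ^ m))
      + b * (std_normal_density z * (z ^ Suc i * (a + b * z) ^ m)))"
    using Suc[of i] Suc[of "Suc i"] by simp
  then show ?case by (simp add: algebra_simps)
qed

text \<open>\<open>has_bochner_integral_radial\<close> accepts even integrands only, so r^n is
  dominated by 1 + r^(2n).\<close>

lemma integrable_radial_power:
  assumes "0 < \<tau>"
  shows "integrable lborel (\<lambda>r. indicator {0<..} r * (radial_density \<tau> r * r ^ n))"
proof -
  have e: "integrable lborel (\<lambda>r. indicator {0<..} r * (radial_density \<tau> r * r ^ (2 * n)))"
  proof -
    have "integrable lborel (\<lambda>z. std_normal_density z * (z ^ 0 * (\<tau> + sqrt \<tau> * z) ^ (2 * n))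
      + (1 / sqrt \<tau>) * (std_normal_density z * (z ^ 1 * (\<tau> + sqrt \<tau> * z) ^ (2 * n))))"
      by (intro Bochner_Integration.integrable_add integrable_mult_right integrable_normal_affine_power)
    then have "integrable lborel (\<lambda>z. std_normal_density z * ((1 + z / sqrt \<tau>) * (\<tau> + sqrt \<tau> * z) ^ (2 * n)))"
      by (simp add: algebra_simps)
    from has_bochner_integral_radial[OF assms _ has_bochner_integral_integrable[OF this]]
    show ?thesis by (auto simp: has_bochner_integral_iff)
  qed
  have "integrable lborel (\<lambda>r. indicator {0<..} r * radial_density \<tau> r +
      indicator {0<..} r * (radial_density \<tau> r * r ^ (2 * n)))"
    using e radial_mass[OF assms] by (auto simp: has_bochner_integral_iff)
  then show ?thesis
  proof (rule Bochner_Integration.integrable_bound)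
    show "AE r in lborel. norm (indicator {0<..} r * (radial_density \<tau> r * r ^ n)) \<le>
      norm (indicator {0<..} r * radial_density \<tau> r + indicator {0<..} r * (radial_density \<tau> r * r ^ (2 * n)))"
    proof (rule AE_I2)
      fix r :: real
      show "norm (indicator {0<..} r * (radial_density \<tau> r * r ^ n)) \<le>
        norm (indicator {0<..} r * radial_density \<tau> r + indicator {0<..} r * (radial_density \<tau> r * r ^ (2 * n)))"
      proof (cases "0 < r")
        case True
        have "0 \<le> (r ^ n - 1)\<^sup>2" by simp
        also have "(r ^ n - 1)\<^sup>2 = r ^ (2 * n) - 2 * r ^ n + 1"
          by (simp add: power_even_eq power2_diff)
        finally have "2 * r ^ n \<le> 1 + r ^ (2 * n)" by simp
        moreover have "0 < r ^ n" using True by simp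
        ultimately have "r ^ n \<le> 1 + r ^ (2 * n)" by linarith
        then have "radial_density \<tau> r * r ^ n \<le> radial_density \<tau> r * (1 + r ^ (2 * n))"
          using radial_density_nonneg[OF assms True] by (intro mult_left_mono)
        then show ?thesis
          using True radial_density_nonneg[OF assms True] by (simp add: algebra_simps)
      qed simp
    qed
  qed measurable
qed

section \<open>The mean of ln (sinh r / r) and its derivative in \<tau>\<close>

definition mean_log_sinhc :: "real \<Rightarrow> real" where
  "mean_log_sinhc \<tau> = (\<integral>r. indicator {0<..} r * (radial_density \<tau> r * log_sinhc r) \<partial>lborel)"

lemma integrable_radial_log_sinhc:
  assumes "0 < \<tau>"
  shows "integrable lborel (\<lambda>r. indicator {0<..} r * (radial_density \<tau> r * (log_sinhc r * r ^ n)))"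
proof (rule Bochner_Integration.integrable_bound[OF integrable_radial_power[OF assms, of "Suc n"]])
  show "AE r in lborel. norm (indicator {0<..} r * (radial_density \<tau> r * (log_sinhc r * r ^ n)))
      \<le> norm (indicator {0<..} r * (radial_density \<tau> r * r ^ Suc n))"
  proof (rule AE_I2)
    fix r :: real
    show "norm (indicator {0<..} r * (radial_density \<tau> r * (log_sinhc r * r ^ n)))
        \<le> norm (indicator {0<..} r * (radial_density \<tau> r * r ^ Suc n))"
    proof (cases "0 < r")
      case True
      have "\<bar>log_sinhc r\<bar> * r ^ n \<le> r ^ Suc n"
        using log_sinhc_bound[of r] True by (simp add: mult_right_mono)
      then show ?thesis
        using True radial_density_nonneg[OF assms True] by (simp add: abs_mult mult_left_mono)
    qed simp
  qed
qed measurable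

text \<open>The logarithmic derivative of \<open>radial_density\<close> in \<tau>.\<close>

definition radial_rate :: "real \<Rightarrow> real \<Rightarrow> real" where
  "radial_rate \<tau> r = r\<^sup>2 / (2 * \<tau>\<^sup>2) - 3 / (2 * \<tau>) - 1 / 2"

lemma DERIV_gaussian_const:
  assumes "0 < \<tau>"
  shows "((\<lambda>\<tau>. 2 / (\<tau> * sqrt (2 * pi * \<tau>))) has_real_derivative
    - (3 / (2 * \<tau>)) * (2 / (\<tau> * sqrt (2 * pi * \<tau>)))) (at \<tau>)"
proof -
  define S where "S = sqrt (2 * pi * \<tau>)"
  have p: "0 < 2 * pi * \<tau>" using assms by simp
  have S: "S * S = 2 * pi * \<tau>" "0 < S"
    unfolding S_def by (simp_all only: real_sqrt_mult_self abs_of_pos[OF p] real_sqrt_gt_zero[OF p])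
  have "((\<lambda>\<tau>. sqrt (2 * pi * \<tau>)) has_real_derivative inverse S / 2 * (2 * pi)) (at \<tau>)"
    unfolding S_def
    by (rule DERIV_chain2[where f=sqrt], rule DERIV_real_sqrt[OF p]) (auto intro!: derivative_eq_intros)
  also have "inverse S / 2 * (2 * pi) = S / (2 * \<tau>)"
    using S assms by (simp add: field_simps)
  finally have "((\<lambda>\<tau>. \<tau> * sqrt (2 * pi * \<tau>)) has_real_derivative 1 * S + S / (2 * \<tau>) * \<tau>) (at \<tau>)"
    unfolding S_def by (rule DERIV_mult[OF DERIV_ident])
  also have "1 * S + S / (2 * \<tau>) * \<tau> = 3 / 2 * S" using assms by simp
  finally show ?thesis
    using DERIV_divide[OF DERIV_const[of 2], of "\<lambda>\<tau>. \<tau> * sqrt (2 * pi * \<tau>)" "3 / 2 * S" \<tau>] assms S(2)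
    unfolding S_def[symmetric] by (simp add: field_simps)
qed

lemma DERIV_radial_density:
  assumes "0 < \<tau>"
  shows "((\<lambda>\<tau>. radial_density \<tau> r) has_real_derivative radial_density \<tau> r * radial_rate \<tau> r) (at \<tau>)"
proof -
  let ?c = "\<lambda>\<tau>. 2 / (\<tau> * sqrt (2 * pi * \<tau>))" and ?e = "\<lambda>\<tau>. r * sinh r * exp (- r\<^sup>2 / (2 * \<tau>))"
  have "(?c has_real_derivative - (3 / (2 * \<tau>)) * ?c \<tau>) (at \<tau>)"
    by (rule DERIV_gaussian_const[OF assms])
  moreover have "((\<lambda>\<tau>. exp (- \<tau> / 2)) has_real_derivative - (1 / 2) * exp (- \<tau> / 2)) (at \<tau>)"
    by (auto intro!: derivative_eq_intros)
  moreover have "(?e has_real_derivative r\<^sup>2 / (2 * \<tau>\<^sup>2) * ?e \<tau>) (at \<tau>)"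
    using assms by (auto intro!: derivative_eq_intros simp: field_simps power2_eq_square)
  ultimately have "((\<lambda>\<tau>. ?c \<tau> * exp (- \<tau> / 2) * ?e \<tau>) has_real_derivative
      (- (3 / (2 * \<tau>)) * ?c \<tau> * exp (- \<tau> / 2) + - (1 / 2) * exp (- \<tau> / 2) * ?c \<tau>) * ?e \<tau>
      + r\<^sup>2 / (2 * \<tau>\<^sup>2) * ?e \<tau> * (?c \<tau> * exp (- \<tau> / 2))) (at \<tau>)"
    by (intro DERIV_mult)
  also have "(- (3 / (2 * \<tau>)) * ?c \<tau> * exp (- \<tau> / 2) + - (1 / 2) * exp (- \<tau> / 2) * ?c \<tau>) * ?e \<tau>
      + r\<^sup>2 / (2 * \<tau>\<^sup>2) * ?e \<tau> * (?c \<tau> * exp (- \<tau> / 2)) = radial_density \<tau> r * radial_rate \<tau> r"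
    unfolding radial_density_def radial_rate_def by algebra
  finally show ?thesis unfolding radial_density_def .
qed

text \<open>A majorant uniform over the window T/4 < \<tau> < T: the factor exp (- r^2 / (2 \<tau>))
  increases with \<tau>, the power \<tau>^(-3/2) costs at most 4^(3/2) = 8, and bounding exp
  (-\<tau>/2) by 1 costs exp (T/2).\<close>

lemma radial_density_le:
  assumes "0 < T" "T / 4 < \<tau>" "\<tau> < T" "0 < r"
  shows "radial_density \<tau> r \<le> 8 * exp (T / 2) * radial_density T r"
proof -
  have \<tau>: "0 < \<tau>" using assms by simp
  have 1: "2 / (\<tau> * sqrt (2 * pi * \<tau>)) \<le> 8 * (2 / (T * sqrt (2 * pi * T)))"
  proof -
    have "sqrt (2 * pi * T) \<le> sqrt (4 * (2 * pi * \<tau>))" using assms by simp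
    also have "\<dots> = 2 * sqrt (2 * pi * \<tau>)" by (simp only: real_sqrt_mult[of 4] real_sqrt_four)
    finally have "T * sqrt (2 * pi * T) \<le> (4 * \<tau>) * (2 * sqrt (2 * pi * \<tau>))"
      using assms by (intro mult_mono) auto
    then show ?thesis using assms \<tau> by (simp add: field_simps)
  qed
  have 2: "exp (- \<tau> / 2) \<le> exp (T / 2) * exp (- T / 2)" using \<tau> by (simp add: exp_add[symmetric])
  have "r\<^sup>2 / (2 * T) \<le> r\<^sup>2 / (2 * \<tau>)" using assms \<tau> by (intro divide_left_mono) auto
  then have 3: "r * sinh r * exp (- r\<^sup>2 / (2 * \<tau>)) \<le> r * sinh r * exp (- r\<^sup>2 / (2 * T))"
    using assms by (intro mult_left_mono) auto
  have "radial_density \<tau> r \<le> (8 * (2 / (T * sqrt (2 * pi * T)))) * (exp (T / 2) * exp (- T / 2))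
      * (r * sinh r * exp (- r\<^sup>2 / (2 * T)))"
    unfolding radial_density_def using assms \<tau> by (intro mult_mono 1 2 3) auto
  then show ?thesis by (simp add: radial_density_def mult_ac)
qed

lemma DERIV_mean_log_sinhc:
  assumes \<tau>: "0 < \<tau>"
  shows "(mean_log_sinhc has_real_derivative
    (\<integral>r. indicator {0<..} r * (radial_density \<tau> r * radial_rate \<tau> r * log_sinhc r) \<partial>lborel)) (at \<tau>)"
proof -
  define T where "T = 2 * \<tau>"
  have T: "0 < T" "\<tau> \<in> {T/4<..<T}" using \<tau> by (auto simp: T_def)
  \<comment> \<open>On the window the rate is at most 8 r^2 / T^2 + 6 / T + 1/2 in absolute value,
    from inserting T/4 for s. The extra factor r comes from |ln (sinh r / r)| \<le> r, and 64 is 8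
    times the constant 8 of \<open>radial_density_le\<close>.\<close>
  let ?w = "\<lambda>r. 64 * exp (T / 2) / T\<^sup>2 * (indicator {0<..} r * (radial_density T r * r ^ 3)) +
    8 * exp (T / 2) * (6 / T + 1 / 2) * (indicator {0<..} r * (radial_density T r * r ^ 1))"
  show ?thesis
    unfolding mean_log_sinhc_def[abs_def]
  proof (rule has_real_derivative_integral[OF T(2), where w="?w"])
    fix s r assume s: "s \<in> {T/4<..<T}"
    then have s0: "0 < s" using T by auto
    show "((\<lambda>s. indicator {0<..} r * (radial_density s r * log_sinhc r)) has_real_derivative
      indicator {0<..} r * (radial_density s r * radial_rate s r * log_sinhc r)) (at s)"
      by (auto intro!: derivative_eq_intros DERIV_radial_density s0)
    show "\<bar>indicator {0<..} r * (radial_density s r * radial_rate s r * log_sinhc r)\<bar> \<le> ?w r"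
    proof (cases "0 < r")
      case True
      have "\<bar>radial_rate s r\<bar> \<le> r\<^sup>2 / (2 * s\<^sup>2) + 3 / (2 * s) + 1 / 2"
        unfolding radial_rate_def using s0 by (simp add: abs_le_iff)
      also have "\<dots> \<le> 8 * r\<^sup>2 / T\<^sup>2 + 6 / T + 1 / 2"
      proof -
        have "(T / 4)\<^sup>2 \<le> s\<^sup>2" using s T by (intro power_mono) auto
        then have "r\<^sup>2 / (2 * s\<^sup>2) \<le> r\<^sup>2 / (2 * (T / 4)\<^sup>2)"
          using T s0 by (intro divide_left_mono) auto
        moreover have "3 / (2 * s) \<le> 3 / (2 * (T / 4))"
          using T s0 s by (intro divide_left_mono) auto
        ultimately show ?thesis by (simp add: power_divide)
      qed
      finally have "radial_density s r * \<bar>radial_rate s r\<bar> * \<bar>log_sinhc r\<bar>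
          \<le> (8 * exp (T / 2) * radial_density T r) * (8 * r\<^sup>2 / T\<^sup>2 + 6 / T + 1 / 2) * r"
        using log_sinhc_bound[of r] True radial_density_le[of T s r] s T radial_density_nonneg
        by (intro mult_mono mult_nonneg_nonneg) auto
      also have "\<dots> = ?w r" using True by (simp add: algebra_simps power2_eq_square power3_eq_cube)
      finally show ?thesis using True radial_density_nonneg[OF s0 True] by (simp add: abs_mult)
    qed simp
  next
    fix s assume "s \<in> {T/4<..<T}"
    then show "integrable lborel (\<lambda>r. indicator {0<..} r * (radial_density s r * log_sinhc r))"
      using integrable_radial_log_sinhc[of s 0] T by simp
  next
    show "integrable lborel ?w"
      using T by (intro Bochner_Integration.integrable_add integrable_mult_right integrable_radial_power)
    show "(\<lambda>r. indicator {0<..} r * (radial_density \<tau> r * radial_rate \<tau> r * log_sinhc r)) \<in> borel_measurable lborel"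
      unfolding radial_rate_def[abs_def] by measurable
  qed
qed

section \<open>The limit of the derivative under Gaussian rescaling\<close>

lemma radial_rate_affine:
  assumes "0 < \<tau>"
  shows "radial_rate \<tau> (\<tau> + sqrt \<tau> * z) = z / sqrt \<tau> + (z\<^sup>2 - 3) / (2 * \<tau>)"
proof -
  define s where "s = sqrt \<tau>"
  have s: "s > 0" "\<tau> = s\<^sup>2" using assms by (auto simp: s_def)
  show ?thesis unfolding s_def[symmetric] s(2) radial_rate_def using s(1)
    by (simp add: field_simps power2_eq_square)
qed

text \<open>Beyond its linear part the function has only a logarithmic term, whose variation over an
  increment of order sqrt \<tau> is negligible against sqrt \<tau>.\<close>

lemma log_sinhc_asymp:
  fixes z :: real
  shows "((\<lambda>\<tau>. (log_sinhc (\<tau> + sqrt \<tau> * z) - log_sinhc \<tau>) / sqrt \<tau>) \<longlongrightarrow> z) at_top"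
proof -
  have eq: "log_sinhc x = x + ln ((1 - exp (- 2 * x)) / (2 * x))" if "0 < x" for x
  proof -
    have e: "exp (- 2 * x) < 1" using that by simp
    have "sinh x / x = exp x * ((1 - exp (- 2 * x)) / (2 * x))"
      unfolding sinh_field_def using that by (simp add: field_simps exp_add[symmetric])
    moreover have "ln (exp x * ((1 - exp (- 2 * x)) / (2 * x))) = x + ln ((1 - exp (- 2 * x)) / (2 * x))"
      using that e by (subst ln_mult) auto
    ultimately show ?thesis using that by (simp only: log_sinhc_eq less_imp_neq[symmetric] not_False_eq_True)
  qed
  have lim: "((\<lambda>\<tau>. ((\<tau> + sqrt \<tau> * z) + ln ((1 - exp (- 2 * (\<tau> + sqrt \<tau> * z))) / (2 * (\<tau> + sqrt \<tau> * z)))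
     - (\<tau> + ln ((1 - exp (- 2 * \<tau>)) / (2 * \<tau>)))) / sqrt \<tau>) \<longlongrightarrow> z) at_top"
  proof (cases z "0 :: real" rule: linorder_cases)
    case less
    then show ?thesis by real_asymp
  next
    case greater
    then show ?thesis by real_asymp
  qed simp
  have "\<forall>\<^sub>F \<tau> in at_top. 0 < \<tau> + sqrt \<tau> * z" by real_asymp
  then have "\<forall>\<^sub>F \<tau> in at_top. ((\<tau> + sqrt \<tau> * z)
      + ln ((1 - exp (- 2 * (\<tau> + sqrt \<tau> * z))) / (2 * (\<tau> + sqrt \<tau> * z)))
      - (\<tau> + ln ((1 - exp (- 2 * \<tau>)) / (2 * \<tau>)))) / sqrt \<tau>
      = (log_sinhc (\<tau> + sqrt \<tau> * z) - log_sinhc \<tau>) / sqrt \<tau>"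
    using eventually_gt_at_top[of "0::real"]
    by eventually_elim (simp only: eq)
  with lim show ?thesis by (rule Lim_transform_eventually)
qed

text \<open>Subtracting the constant \<open>log_sinhc \<tau>\<close> is harmless because the rate has mean zero; what remains is
  a standard Gaussian integral to which dominated convergence applies.\<close>

definition gaussian_rate :: "real \<Rightarrow> real \<Rightarrow> real" where
  "gaussian_rate \<tau> z = std_normal_density z * ((1 + z / sqrt \<tau>) *
    ((log_sinhc (\<tau> + sqrt \<tau> * z) - log_sinhc \<tau>) * radial_rate \<tau> (\<tau> + sqrt \<tau> * z)))"

definition gaussian_bound :: "real \<Rightarrow> real" where
  "gaussian_bound z = std_normal_density z * ((1 + \<bar>z\<bar>) * (\<bar>z\<bar> * (\<bar>z\<bar> + (z\<^sup>2 + 3) / 2)))"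

lemma measurable_gaussian_rate [measurable]: "gaussian_rate \<tau> \<in> borel_measurable borel"
  unfolding gaussian_rate_def[abs_def] radial_rate_def[abs_def] by measurable

lemma integrable_gaussian_bound: "integrable lborel gaussian_bound"
proof -
  let ?g = "\<lambda>k z. std_normal_density z * \<bar>z\<bar> ^ k"
  have "integrable lborel (\<lambda>z. ?g 2 z + ?g 3 z / 2 + 3 / 2 * ?g 1 z + ?g 3 z + ?g 4 z / 2 + 3 / 2 * ?g 2 z)"
    by (intro Bochner_Integration.integrable_add integrable_divide integrable_mult_right
        integrable_std_normal_moment_abs)
  moreover have "gaussian_bound = (\<lambda>z. ?g 2 z + ?g 3 z / 2 + 3 / 2 * ?g 1 z + ?g 3 z + ?g 4 z / 2 + 3 / 2 * ?g 2 z)"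
  proof
    fix z :: real
    have "z\<^sup>2 = \<bar>z\<bar> * \<bar>z\<bar>" by (simp add: power2_eq_square)
    then show "gaussian_bound z = ?g 2 z + ?g 3 z / 2 + 3 / 2 * ?g 1 z + ?g 3 z + ?g 4 z / 2 + 3 / 2 * ?g 2 z"
      unfolding gaussian_bound_def by (simp add: field_simps power2_eq_square power3_eq_cube power4_eq_xxxx)
  qed
  ultimately show ?thesis by simp
qed

text \<open>The Lipschitz bound gives sqrt \<tau> |z| for the increment, and the rate carries a
  factor 1 / sqrt \<tau>. The two cancel, which leaves a majorant independent of \<tau>.\<close>

lemma gaussian_rate_le:
  assumes "1 \<le> \<tau>"
  shows "\<bar>gaussian_rate \<tau> z\<bar> \<le> gaussian_bound z"
proof -
  have s: "1 \<le> sqrt \<tau>" "sqrt \<tau> * sqrt \<tau> = \<tau>" using assms by auto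
  have "\<bar>1 + z / sqrt \<tau>\<bar> \<le> 1 + \<bar>z\<bar> / sqrt \<tau>" using s abs_triangle_ineq[of 1 "z / sqrt \<tau>"] by (simp add: abs_divide)
  also have "\<bar>z\<bar> / sqrt \<tau> \<le> \<bar>z\<bar> / 1" using s(1) by (intro divide_left_mono) auto
  finally have 1: "\<bar>1 + z / sqrt \<tau>\<bar> \<le> 1 + \<bar>z\<bar>" by simp
  have 2: "\<bar>log_sinhc (\<tau> + sqrt \<tau> * z) - log_sinhc \<tau>\<bar> \<le> sqrt \<tau> * \<bar>z\<bar>"
    using log_sinhc_lipschitz[of "\<tau> + sqrt \<tau> * z" \<tau>] s by (simp add: abs_mult)
  have "radial_rate \<tau> (\<tau> + sqrt \<tau> * z) = (z + (z\<^sup>2 - 3) / (2 * sqrt \<tau>)) / sqrt \<tau>"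
    using s assms by (simp add: radial_rate_affine add_divide_distrib)
  moreover have "\<bar>z + (z\<^sup>2 - 3) / (2 * sqrt \<tau>)\<bar> \<le> \<bar>z\<bar> + (z\<^sup>2 + 3) / 2"
  proof -
    have "\<bar>(z\<^sup>2 - 3) / (2 * sqrt \<tau>)\<bar> \<le> (z\<^sup>2 + 3) / 2"
      unfolding abs_divide using s by (intro frac_le) (auto simp: abs_le_iff)
    then show ?thesis by linarith
  qed
  ultimately have 3: "\<bar>radial_rate \<tau> (\<tau> + sqrt \<tau> * z)\<bar> \<le> (\<bar>z\<bar> + (z\<^sup>2 + 3) / 2) / sqrt \<tau>"
    using s by (simp add: abs_divide divide_right_mono)
  have "\<bar>gaussian_rate \<tau> z\<bar> = std_normal_density z * (\<bar>1 + z / sqrt \<tau>\<bar> *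
    (\<bar>log_sinhc (\<tau> + sqrt \<tau> * z) - log_sinhc \<tau>\<bar> * \<bar>radial_rate \<tau> (\<tau> + sqrt \<tau> * z)\<bar>))"
    unfolding gaussian_rate_def by (simp add: abs_mult)
  also have "\<dots> \<le> std_normal_density z * ((1 + \<bar>z\<bar>) * ((sqrt \<tau> * \<bar>z\<bar>) * ((\<bar>z\<bar> + (z\<^sup>2 + 3) / 2) / sqrt \<tau>)))"
    using s by (intro mult_mono 1 2 3 mult_nonneg_nonneg order_refl) auto
  also have "\<dots> = gaussian_bound z"
    unfolding gaussian_bound_def using s by simp
  finally show ?thesis .
qed

lemma deriv_mean_log_sinhc:
  assumes "1 \<le> \<tau>"
  shows "deriv mean_log_sinhc \<tau> = (\<integral>z. gaussian_rate \<tau> z \<partial>lborel)"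
proof -
  have \<tau>: "0 < \<tau>" using assms by simp
  have "integrable lborel (gaussian_rate \<tau>)"
    by (rule Bochner_Integration.integrable_bound[OF integrable_gaussian_bound])
      (use gaussian_rate_le[OF assms] in \<open>auto intro!: AE_I2 intro: order_trans[OF _ abs_ge_self]\<close>)
  then have g: "has_bochner_integral lborel (gaussian_rate \<tau>) (\<integral>z. gaussian_rate \<tau> z \<partial>lborel)"
    by (rule has_bochner_integral_integrable)
  have "has_bochner_integral lborel (\<lambda>r. indicator {0<..} r *
      (radial_density \<tau> r * ((log_sinhc r - log_sinhc \<tau>) * radial_rate \<tau> r))) (\<integral>z. gaussian_rate \<tau> z \<partial>lborel)"
    by (rule has_bochner_integral_radial[OF \<tau>])
      (use g in \<open>simp_all add: gaussian_rate_def[abs_def] log_sinhc_minus radial_rate_def\<close>)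
  \<comment> \<open>The rate integrates to zero against the density, as differentiating the constant
    mass 1 in \<tau> predicts; here it follows from the mass and the second moment.\<close>
  moreover have "has_bochner_integral lborel (\<lambda>r. 1 / (2 * \<tau>\<^sup>2) * (indicator {0<..} r * (radial_density \<tau> r * r\<^sup>2))
      + (- 3 / (2 * \<tau>) - 1 / 2) * (indicator {0<..} r * radial_density \<tau> r))
      (1 / (2 * \<tau>\<^sup>2) * (\<tau>\<^sup>2 + 3 * \<tau>) + (- 3 / (2 * \<tau>) - 1 / 2) * 1)"
    by (intro has_bochner_integral_add has_bochner_integral_mult_right radial_second_moment radial_mass \<tau>)
  moreover have "1 / (2 * \<tau>\<^sup>2) * (\<tau>\<^sup>2 + 3 * \<tau>) + (- 3 / (2 * \<tau>) - 1 / 2) * 1 = 0"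
    using \<tau> by (simp add: field_simps power2_eq_square)
  ultimately have "has_bochner_integral lborel (\<lambda>r. indicator {0<..} r *
      (radial_density \<tau> r * ((log_sinhc r - log_sinhc \<tau>) * radial_rate \<tau> r))
      + log_sinhc \<tau> * (1 / (2 * \<tau>\<^sup>2) * (indicator {0<..} r * (radial_density \<tau> r * r\<^sup>2))
      + (- 3 / (2 * \<tau>) - 1 / 2) * (indicator {0<..} r * radial_density \<tau> r)))
      ((\<integral>z. gaussian_rate \<tau> z \<partial>lborel) + log_sinhc \<tau> * 0)"
    by (intro has_bochner_integral_add has_bochner_integral_mult_right) simp_all
  moreover have "indicator {0<..} r *
      (radial_density \<tau> r * ((log_sinhc r - log_sinhc \<tau>) * radial_rate \<tau> r))
      + log_sinhc \<tau> * (1 / (2 * \<tau>\<^sup>2) * (indicator {0<..} r * (radial_density \<tau> r * r\<^sup>2))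
      + (- 3 / (2 * \<tau>) - 1 / 2) * (indicator {0<..} r * radial_density \<tau> r))
      = indicator {0<..} r * (radial_density \<tau> r * radial_rate \<tau> r * log_sinhc r)" for r
    unfolding radial_rate_def by (simp add: algebra_simps add_divide_distrib diff_divide_distrib)
  ultimately have "(\<integral>r. indicator {0<..} r * (radial_density \<tau> r * radial_rate \<tau> r * log_sinhc r) \<partial>lborel)
      = (\<integral>z. gaussian_rate \<tau> z \<partial>lborel)"
    by (simp add: has_bochner_integral_iff)
  then show ?thesis using DERIV_imp_deriv[OF DERIV_mean_log_sinhc[OF \<tau>]] by simp
qed

text \<open>Pointwise in z, the weight tends to 1, the increment divided by sqrt \<tau> tends to z,
  and the rate multiplied by sqrt \<tau> tends to z. The limit is therefore the second moment of a
  standard normal variable.\<close>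

lemma deriv_mean_log_sinhc_tendsto: "(deriv mean_log_sinhc \<longlongrightarrow> 1) at_top"
proof -
  have "((\<lambda>\<tau>. \<integral>z. gaussian_rate \<tau> z \<partial>lborel) \<longlongrightarrow> (\<integral>z. std_normal_density z * z\<^sup>2 \<partial>lborel)) at_top"
  proof (rule integral_dominated_convergence_at_top[where w=gaussian_bound])
    show "\<forall>\<^sub>F \<tau> in at_top. AE z in lborel. norm (gaussian_rate \<tau> z) \<le> gaussian_bound z"
      using eventually_ge_at_top[of 1] by eventually_elim (simp add: gaussian_rate_le)
    show "AE z in lborel. ((\<lambda>\<tau>. gaussian_rate \<tau> z) \<longlongrightarrow> std_normal_density z * z\<^sup>2) at_top"
    proof (rule AE_I2)
      fix z :: real
      have a: "((\<lambda>\<tau>. 1 + z / sqrt \<tau>) \<longlongrightarrow> 1) at_top" by real_asymp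
      have b: "((\<lambda>\<tau>. z + (z\<^sup>2 - 3) / (2 * sqrt \<tau>)) \<longlongrightarrow> z) at_top" by real_asymp
      have "((\<lambda>\<tau>. std_normal_density z * ((1 + z / sqrt \<tau>) *
          (((log_sinhc (\<tau> + sqrt \<tau> * z) - log_sinhc \<tau>) / sqrt \<tau>) * (z + (z\<^sup>2 - 3) / (2 * sqrt \<tau>)))))
          \<longlongrightarrow> std_normal_density z * (1 * (z * z))) at_top"
        by (intro tendsto_intros a b log_sinhc_asymp)
      moreover have "\<forall>\<^sub>F \<tau> in at_top. std_normal_density z * ((1 + z / sqrt \<tau>) *
          (((log_sinhc (\<tau> + sqrt \<tau> * z) - log_sinhc \<tau>) / sqrt \<tau>) * (z + (z\<^sup>2 - 3) / (2 * sqrt \<tau>))))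
          = gaussian_rate \<tau> z"
        using eventually_gt_at_top[of 0]
      proof eventually_elim
        fix \<tau> :: real assume \<tau>: "0 < \<tau>"
        then have "sqrt \<tau> * sqrt \<tau> = \<tau>" by simp
        then have "radial_rate \<tau> (\<tau> + sqrt \<tau> * z) = (z + (z\<^sup>2 - 3) / (2 * sqrt \<tau>)) / sqrt \<tau>"
          using \<tau> by (simp add: radial_rate_affine add_divide_distrib)
        then show "std_normal_density z * ((1 + z / sqrt \<tau>) *
          (((log_sinhc (\<tau> + sqrt \<tau> * z) - log_sinhc \<tau>) / sqrt \<tau>) * (z + (z\<^sup>2 - 3) / (2 * sqrt \<tau>))))
          = gaussian_rate \<tau> z"
          by (simp add: gaussian_rate_def)
      qed
      ultimately show "((\<lambda>\<tau>. gaussian_rate \<tau> z) \<longlongrightarrow> std_normal_density z * z\<^sup>2) at_top"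
        by (simp add: Lim_transform_eventually power2_eq_square)
    qed
  qed (use integrable_gaussian_bound in \<open>auto\<close>)
  moreover have "(\<integral>z. std_normal_density z * z\<^sup>2 \<partial>lborel) = 1"
    using integral_std_normal_moment_even[of 1] by simp
  moreover have "\<forall>\<^sub>F \<tau> in at_top. (\<integral>z. gaussian_rate \<tau> z \<partial>lborel) = deriv mean_log_sinhc \<tau>"
    using eventually_ge_at_top[of 1] by eventually_elim (simp add: deriv_mean_log_sinhc)
  ultimately show ?thesis by (simp add: Lim_transform_eventually)
qed


section \<open>Hyperbolic volume of balls\<close>

text \<open>The height is the first component, so that Tonelli's theorem integrates over horizontal
  planes first.\<close>

definition vec3 :: "real \<times> real \<times> real \<Rightarrow> real^3" where
  "vec3 p = vector [fst (snd p), snd (snd p), fst p]"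

lemma vec3_nth [simp]: "vec3 p $ 1 = fst (snd p)" "vec3 p $ 2 = snd (snd p)" "vec3 p $ 3 = fst p"
  by (simp_all add: vec3_def)

lemma measurable_vec3 [measurable]: "vec3 \<in> borel \<rightarrow>\<^sub>M borel"
proof (rule borel_measurable_continuous_onI)
  have eq: "vec3 = (\<lambda>p. \<chi> i. if i = 1 then fst (snd p) else if i = 2 then snd (snd p) else fst p)"
    by (auto simp: fun_eq_iff vec_eq_iff forall_3)
  have "continuous_on UNIV (\<lambda>p::real \<times> real \<times> real.
      \<chi> i::3. if i = 1 then fst (snd p) else if i = 2 then snd (snd p) else fst p)"
  proof (rule continuous_on_vec_lambda)
    show "continuous_on UNIV (\<lambda>p::real \<times> real \<times> real. if i = 1 then fst (snd p) else if i = 2 then snd (snd p) else fst p)"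
      for i :: 3
      by (cases "i = 1"; cases "i = 2") (auto intro!: continuous_intros)
  qed
  then show "continuous_on UNIV vec3" unfolding eq .
qed

lemma emeasure_lborel_Times:
  "A \<in> sets borel \<Longrightarrow> B \<in> sets borel \<Longrightarrow>
    emeasure (lborel :: ('a::euclidean_space \<times> 'b::euclidean_space) measure) (A \<times> B)
      = emeasure lborel A * emeasure lborel B"
  by (subst lborel_prod[symmetric]) (simp add: lborel.emeasure_pair_measure_Times)

lemma lborel_vec3: "(lborel :: (real^3) measure) = distr lborel borel vec3"
proof (rule lborel_eqI)
  fix l u :: "real^3" assume lu: "\<And>b. b \<in> Basis \<Longrightarrow> l \<bullet> b \<le> u \<bullet> b"
  have le: "l $ i \<le> u $ i" for i
    using lu[of "axis i 1"] by (auto simp: Basis_vec_def inner_axis)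
  have "vec3 -` box l u = {l$3<..<u$3} \<times> {l$1<..<u$1} \<times> {l$2<..<u$2}"
    by (auto simp: mem_box_cart forall_3)
  then have "emeasure (distr lborel borel vec3) (box l u)
      = emeasure lborel ({l$3<..<u$3} \<times> {l$1<..<u$1} \<times> {l$2<..<u$2})"
    by (simp add: emeasure_distr)
  also have "\<dots> = ennreal (u$3 - l$3) * (ennreal (u$1 - l$1) * ennreal (u$2 - l$2))"
    using le by (simp add: emeasure_lborel_Times borel_open open_Times)
  also have "\<dots> = ennreal (\<Prod>i\<in>UNIV. u$i - l$i)"
  proof -
    have "(\<Prod>i\<in>UNIV. u$i - l$i) = (u$3 - l$3) * ((u$1 - l$1) * (u$2 - l$2))"
      unfolding UNIV_3 by (simp add: mult.assoc mult.commute)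
    then show ?thesis using le by (simp add: ennreal_mult)
  qed
  also have "(\<Prod>i\<in>UNIV. u$i - l$i) = (\<Prod>b\<in>Basis. (u - l) \<bullet> b)"
    by (simp add: Basis_vec_def UNION_singleton_eq_range prod.reindex axis_eq_axis inj_on_def inner_axis)
  finally show "emeasure (distr lborel borel vec3) (box l u) = (\<Prod>b\<in>Basis. (u - l) \<bullet> b)" .
qed simp

lemma nn_integral_lborel_vec3:
  assumes [measurable]: "f \<in> borel_measurable borel"
  shows "(\<integral>\<^sup>+y. f y \<partial>(lborel :: (real^3) measure))
    = (\<integral>\<^sup>+c. (\<integral>\<^sup>+p. f (vec3 (c, p)) \<partial>lborel) \<partial>lborel)"
proof -
  have "(\<integral>\<^sup>+y. f y \<partial>(lborel :: (real^3) measure)) = (\<integral>\<^sup>+p. f (vec3 p) \<partial>lborel)"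
    by (subst lborel_vec3) (simp add: nn_integral_distr)
  also have "\<dots> = (\<integral>\<^sup>+c. (\<integral>\<^sup>+p. f (vec3 (c, p)) \<partial>lborel) \<partial>lborel)"
    unfolding lborel_prod[symmetric, where ?'a=real and ?'b="real \<times> real"]
    by (rule lborel.nn_integral_fst[symmetric]) (simp add: lborel_prod)
  finally show ?thesis .
qed

text \<open>The squared radius may be negative: the set is then empty and \<open>ennreal\<close>
  truncates the right-hand side to 0. The area of a horizontal slice of a ball thus has one formula
  at every positive height.\<close>

lemma emeasure_disc:
  fixes a b s :: real
  shows "emeasure lborel {p. (fst p - a)\<^sup>2 + (snd p - b)\<^sup>2 \<le> s} = ennreal (pi * s)"
proof (cases "0 \<le> s")
  case True
  have "{p. (fst p - a)\<^sup>2 + (snd p - b)\<^sup>2 \<le> s} = cball (a, b) (sqrt s)"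
    using True by (auto simp: mem_cball dist_prod_def dist_real_def power2_commute)
  then show ?thesis
    using True by (simp add: emeasure_cball unit_ball_vol_2 DIM_prod numeral_2_eq_2[symmetric])
next
  case False
  then have "{p. (fst p - a)\<^sup>2 + (snd p - b)\<^sup>2 \<le> s} = {}"
    using sum_power2_ge_zero[of "fst p - a" "snd p - b" for p] by (auto simp: not_le intro: less_le_trans)
  then show ?thesis using False
    by (simp add: ennreal_neg mult_nonneg_nonpos)
qed

section \<open>Volume measure and distance in the upper half-space\<close>

lemma det_hyp3_metric: "det (hyp3_metric k y) = (1 / (- k * (y $ 3)\<^sup>2)) ^ 3"
  by (simp add: hyp3_metric_def det_3 mat_def power3_eq_cube)

lemma sqrt_det_hyp3_metric:
  assumes "k < 0" "y \<in> hyp3"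
  shows "sqrt (det (hyp3_metric k y)) = 1 / (- k * sqrt (- k)) / (y $ 3) ^ 3"
proof -
  have y: "0 < y $ 3" using assms by (simp add: hyp3_def)
  have "(1 / (- k * sqrt (- k)) / (y $ 3) ^ 3)\<^sup>2 = (1 / (- k * (y $ 3)\<^sup>2)) ^ 3"
    using assms y by (simp add: power_divide power_mult_distrib) (simp add: field_simps power2_eq_square power3_eq_cube)
  moreover have "0 \<le> 1 / (- k * sqrt (- k)) / (y $ 3) ^ 3"
    using assms y by (intro divide_nonneg_nonneg mult_nonneg_nonneg) auto
  ultimately show ?thesis unfolding det_hyp3_metric by (rule real_sqrt_unique)
qed

lemma hyp3_borel [measurable]: "hyp3 \<in> sets borel"
  unfolding hyp3_def by measurable

lemma open_hyp3: "open hyp3"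
  unfolding hyp3_def by (rule open_Collect_less) (auto intro!: continuous_intros)

lemma hyp3_volume_eq:
  assumes "k < 0"
  shows "hyp3_volume k = density (restrict_space lborel hyp3) (\<lambda>y. ennreal (1 / (- k * sqrt (- k)) / (y $ 3) ^ 3))"
  unfolding riem_volume_def
proof (rule density_cong)
  show "(\<lambda>y. ennreal (sqrt (det (hyp3_metric k y)))) \<in> borel_measurable (restrict_space lborel hyp3)"
    unfolding det_hyp3_metric by (rule measurable_restrict_space1) measurable
  show "AE y in restrict_space lborel hyp3. ennreal (sqrt (det (hyp3_metric k y)))
      = ennreal (1 / (- k * sqrt (- k)) / (y $ 3) ^ 3)"
    by (rule AE_I2) (simp only: sqrt_det_hyp3_metric[OF assms] space_restrict_space Int_iff)
qed (rule measurable_restrict_space1, measurable)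

lemma space_hyp3_volume: "space (hyp3_volume k) = hyp3"
  by (simp add: riem_volume_def space_restrict_space)

lemma borel_measurable_hyp3_volume:
  "measurable (hyp3_volume k) N = measurable (restrict_space borel hyp3) N"
  by (rule measurable_cong_sets) (auto simp: riem_volume_def intro!: sets_restrict_space_cong)

text \<open>This equals 1 + |y - x|^2 / (2 x_3 y_3), the hyperbolic cosine of the distance in
  curvature -1. The metric of curvature k divides that distance by sqrt (-k).\<close>

definition cosh_dist :: "real^3 \<Rightarrow> real^3 \<Rightarrow> real" where
  "cosh_dist x y = ((y$1 - x$1)\<^sup>2 + (y$2 - x$2)\<^sup>2 + (y$3)\<^sup>2 + (x$3)\<^sup>2) / (2 * x$3 * y$3)"

lemma cosh_dist_ge_1:
  assumes "x \<in> hyp3" "y \<in> hyp3"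
  shows "1 \<le> cosh_dist x y"
proof -
  have "2 * x$3 * y$3 \<le> (y$1 - x$1)\<^sup>2 + (y$2 - x$2)\<^sup>2 + (y$3)\<^sup>2 + (x$3)\<^sup>2"
    using sum_squares_bound[of "x$3" "y$3"] sum_power2_ge_zero[of "y$1 - x$1" "y$2 - x$2"] by linarith
  then show ?thesis using assms by (simp add: cosh_dist_def hyp3_def)
qed

definition hyp_dist :: "real^3 \<Rightarrow> real^3 \<Rightarrow> real" where
  "hyp_dist x y = arcosh (cosh_dist x y)"

lemma cosh_hyp_dist: "x \<in> hyp3 \<Longrightarrow> y \<in> hyp3 \<Longrightarrow> cosh (hyp_dist x y) = cosh_dist x y"
  by (simp add: hyp_dist_def cosh_arcosh_real cosh_dist_ge_1)

lemma hyp_dist_nonneg: "x \<in> hyp3 \<Longrightarrow> y \<in> hyp3 \<Longrightarrow> 0 \<le> hyp_dist x y"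
  by (simp add: hyp_dist_def arcosh_nonneg_real cosh_dist_ge_1)

lemma measurable_cosh_dist [measurable]: "cosh_dist x \<in> borel_measurable borel"
  unfolding cosh_dist_def[abs_def] by measurable

lemma measurable_hyp_dist [measurable]: "hyp_dist x \<in> borel_measurable borel"
  unfolding hyp_dist_def[abs_def] arcosh_def by measurable

lemma hyp_dist_le_iff:
  assumes "x \<in> hyp3" "y \<in> hyp3" "0 \<le> r"
  shows "hyp_dist x y \<le> r \<longleftrightarrow> cosh_dist x y \<le> cosh r"
  using assms cosh_real_nonneg_le_iff[of "hyp_dist x y" r]
  by (simp add: cosh_hyp_dist hyp_dist_nonneg)

text \<open>A hyperbolic ball is a Euclidean ball. With h = x_3, its slice at height c is a disc of
  squared radius (c - h e^-r) (h e^r - c), and the volume is the integral of pi times this over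
  c^3.\<close>

lemma nn_integral_hyp_ball:
  assumes x: "x \<in> hyp3" and r: "0 \<le> r"
  shows "(\<integral>\<^sup>+y. ennreal (1 / (y$3) ^ 3) * indicator {y\<in>hyp3. cosh_dist x y \<le> cosh r} y \<partial>lborel)
    = ennreal (pi * (sinh (2 * r) - 2 * r))"
proof -
  define h where "h = x $ 3"
  have h: "0 < h" using x by (simp add: h_def hyp3_def)
  let ?s = "\<lambda>c. 2 * h * c * cosh r - c\<^sup>2 - h\<^sup>2"
  have s_eq: "?s c = - ((c - h * exp (- r)) * (c - h * exp r))" for c
  proof -
    have "exp (- r) * exp r = 1" by (simp add: mult_exp_exp)
    moreover have "2 * cosh r = exp r + exp (- r)" by (simp add: cosh_field_def)
    ultimately show ?thesis by algebra
  qed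
  let ?F = "\<lambda>c. pi * (h\<^sup>2 / (2 * c\<^sup>2) - 2 * h * cosh r / c - ln c)"
  have "(\<integral>\<^sup>+y. ennreal (1 / (y$3) ^ 3) * indicator {y\<in>hyp3. cosh_dist x y \<le> cosh r} y \<partial>lborel)
    = (\<integral>\<^sup>+c. (\<integral>\<^sup>+p. ennreal (1 / c ^ 3) * indicator {y\<in>hyp3. cosh_dist x y \<le> cosh r} (vec3 (c, p)) \<partial>lborel) \<partial>lborel)"
    by (subst nn_integral_lborel_vec3) simp_all
  also have "\<dots> = (\<integral>\<^sup>+c. ennreal (pi * ?s c / c ^ 3) * indicator {h * exp (- r)..h * exp r} c \<partial>lborel)"
  proof (rule nn_integral_cong)
    fix c :: real
    show "(\<integral>\<^sup>+p. ennreal (1 / c ^ 3) * indicator {y\<in>hyp3. cosh_dist x y \<le> cosh r} (vec3 (c, p)) \<partial>lborel)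
      = ennreal (pi * ?s c / c ^ 3) * indicator {h * exp (- r)..h * exp r} c"
    proof (cases "0 < c")
      case True
      have "indicator {y\<in>hyp3. cosh_dist x y \<le> cosh r} (vec3 (c, p))
          = (indicator {p. (fst p - x$1)\<^sup>2 + (snd p - x$2)\<^sup>2 \<le> ?s c} p :: ennreal)" for p
      proof -
        have "vec3 (c, p) \<in> hyp3" using True by (simp add: hyp3_def)
        moreover have "cosh_dist x (vec3 (c, p)) \<le> cosh r \<longleftrightarrow> (fst p - x$1)\<^sup>2 + (snd p - x$2)\<^sup>2 \<le> ?s c"
          using True h unfolding cosh_dist_def h_def by (simp add: field_simps)
        ultimately show ?thesis by (simp add: indicator_def)
      qed
      then have "(\<integral>\<^sup>+p. ennreal (1 / c ^ 3) * indicator {y\<in>hyp3. cosh_dist x y \<le> cosh r} (vec3 (c, p)) \<partial>lborel)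
        = (\<integral>\<^sup>+p. ennreal (1 / c ^ 3) * indicator {p. (fst p - x$1)\<^sup>2 + (snd p - x$2)\<^sup>2 \<le> ?s c} p \<partial>lborel)"
        by (simp only:)
      also have "\<dots> = ennreal (1 / c ^ 3) * emeasure lborel {p. (fst p - x$1)\<^sup>2 + (snd p - x$2)\<^sup>2 \<le> ?s c}"
      proof (rule nn_integral_cmult_indicator)
        have "closed {p. (fst p - x$1)\<^sup>2 + (snd p - x$2)\<^sup>2 \<le> ?s c}"
          by (intro closed_Collect_le continuous_intros)
        then show "{p. (fst p - x$1)\<^sup>2 + (snd p - x$2)\<^sup>2 \<le> ?s c} \<in> sets lborel"
          unfolding sets_lborel by (rule borel_closed)
      qed
      also have "\<dots> = ennreal (pi * ?s c / c ^ 3)"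
        unfolding emeasure_disc using True by (subst ennreal_mult'[symmetric]) auto
      \<comment> \<open>Outside the interval the squared radius is nonpositive, so
        \<open>ennreal\<close> already gives 0 and the indicator changes nothing.\<close>
      also have "\<dots> = ennreal (pi * ?s c / c ^ 3) * indicator {h * exp (- r)..h * exp r} c"
      proof (cases "c \<in> {h * exp (- r)..h * exp r}")
        case False
        have "?s c = - ((c - h * exp (- r)) * (c - h * exp r))" by (rule s_eq)
        moreover have "h * exp (- r) \<le> h * exp r" using h r by simp
        then have "0 < (c - h * exp (- r)) * (c - h * exp r)"
          using False by (auto simp: not_le intro: mult_pos_pos mult_neg_neg)
        ultimately have "pi * ?s c / c ^ 3 \<le> 0"
          using True by (simp add: mult_nonneg_nonpos divide_nonpos_pos)
        then show ?thesis by (simp add: ennreal_neg)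
      qed simp
      finally show ?thesis .
    next
      case False
      then have "vec3 (c, p) \<notin> hyp3" for p by (simp add: hyp3_def)
      moreover have "c \<notin> {h * exp (- r)..h * exp r}"
        using False mult_pos_pos[OF h exp_gt_zero[of "-r"]] by auto
      ultimately show ?thesis by simp
    qed
  qed
  also have "\<dots> = ennreal (?F (h * exp r) - ?F (h * exp (- r)))"
  proof (rule nn_integral_FTC_Icc)
    show "(\<lambda>c. pi * ?s c / c ^ 3) \<in> borel_measurable borel" by measurable
    show "h * exp (- r) \<le> h * exp r" using h r by simp
    fix c assume c: "c \<in> {h * exp (- r)..h * exp r}"
    have c0: "0 < c" using c mult_pos_pos[OF h exp_gt_zero[of "-r"]] by auto
    have "?s c = (c - h * exp (- r)) * (h * exp r - c)"
      using s_eq[of c] by (simp add: algebra_simps)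
    then have "0 \<le> ?s c" using c by simp
    then show "0 \<le> pi * ?s c / c ^ 3" using c0 by simp
    show "(?F has_real_derivative pi * ?s c / c ^ 3) (at c)"
      using c0 by (auto intro!: derivative_eq_intros simp: field_simps power2_eq_square power3_eq_cube)
  qed
  also have "?F (h * exp r) - ?F (h * exp (- r)) = pi * (sinh (2 * r) - 2 * r)"
  proof -
    have e: "exp (- r) = 1 / exp r" "exp (2 * r) = exp r * exp r" "exp (- (2 * r)) = 1 / (exp r * exp r)"
      by (simp_all add: exp_minus field_simps mult_exp_exp)
    define E where "E = exp r"
    have E: "0 < E" by (simp add: E_def)
    have l: "ln (h * exp r) = ln h + r" "ln (h * exp (- r)) = ln h - r"
      using h by (simp_all add: ln_mult)
    show ?thesis
      unfolding l unfolding sinh_field_def cosh_field_def e E_def[symmetric] using h E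
      by (simp add: field_simps power2_eq_square)
  qed
  finally show ?thesis .
qed

text \<open>Both measures give the ball of radius \<open>r\<close> the volume \<open>pi * (sinh (2 * r) - 2 * r)\<close>.\<close>

lemma distr_hyp_dist:
  assumes k: "k < 0" and x: "x \<in> hyp3"
  shows "distr (hyp3_volume k) borel (hyp_dist x)
    = density lborel (\<lambda>r. ennreal (indicator {0<..} r * (4 * pi / (- k * sqrt (- k)) * (sinh r)\<^sup>2)))"
    (is "?M = ?N")
proof (rule measure_eqI_generator_eq)
  define C where "C = 1 / (- k * sqrt (- k))"
  have C: "0 < C" unfolding C_def using k by (intro divide_pos_pos mult_pos_pos) auto
  let ?E = "range (\<lambda>a::real. {..a})" and ?A = "\<lambda>n. {..real n}"
  have meas: "hyp_dist x \<in> borel_measurable (hyp3_volume k)"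
    by (simp add: borel_measurable_hyp3_volume measurable_restrict_space1)
  have M: "emeasure ?M {..r} = (if 0 \<le> r then ennreal (C * (pi * (sinh (2 * r) - 2 * r))) else 0)" for r
  proof -
    have "emeasure ?M {..r} = emeasure (hyp3_volume k) {y\<in>hyp3. hyp_dist x y \<le> r}"
      using meas by (subst emeasure_distr) (auto simp: space_hyp3_volume intro!: arg_cong[where f="emeasure _"])
    also have "\<dots> = (if 0 \<le> r then ennreal (C * (pi * (sinh (2 * r) - 2 * r))) else 0)"
    proof (cases "0 \<le> r")
      case False
      then have "{y\<in>hyp3. hyp_dist x y \<le> r} = {}"
        using hyp_dist_nonneg[OF x] by fastforce
      then show ?thesis using False by (simp only: emeasure_empty if_False)
    next
      case True
      have eq: "{y\<in>hyp3. hyp_dist x y \<le> r} = {y\<in>hyp3. cosh_dist x y \<le> cosh r}"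
        using hyp_dist_le_iff[OF x _ True] by auto
      have "emeasure (hyp3_volume k) {y\<in>hyp3. cosh_dist x y \<le> cosh r}
        = (\<integral>\<^sup>+y. ennreal (C / (y$3) ^ 3) * indicator {y\<in>hyp3. cosh_dist x y \<le> cosh r} y \<partial>restrict_space lborel hyp3)"
        unfolding hyp3_volume_eq[OF k] C_def
        by (rule emeasure_density) (auto simp: sets_restrict_space_iff intro: measurable_restrict_space1)
      also have "\<dots> = (\<integral>\<^sup>+y. ennreal C * (ennreal (1 / (y$3) ^ 3) * indicator {y\<in>hyp3. cosh_dist x y \<le> cosh r} y) \<partial>lborel)"
        using C by (subst nn_integral_restrict_space)
          (auto intro!: nn_integral_cong simp: indicator_def hyp3_def ennreal_mult'[symmetric] divide_inverse)
      also have "\<dots> = ennreal C * ennreal (pi * (sinh (2 * r) - 2 * r))"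
        unfolding nn_integral_hyp_ball[OF x True, symmetric] by (rule nn_integral_cmult) measurable
      also have "\<dots> = ennreal (C * (pi * (sinh (2 * r) - 2 * r)))"
        using C by (simp add: ennreal_mult')
      finally show ?thesis using True eq by simp
    qed
    finally show ?thesis .
  qed
  have N: "emeasure ?N {..r} = (if 0 \<le> r then ennreal (C * (pi * (sinh (2 * r) - 2 * r))) else 0)" for r
  proof -
    have "emeasure ?N {..r} = (\<integral>\<^sup>+s. ennreal (indicator {0<..} s * (4 * pi / (- k * sqrt (- k)) * (sinh s)\<^sup>2)) * indicator {..r} s \<partial>lborel)"
      by (rule emeasure_density) (auto simp: sinh_field_def)
    also have "\<dots> = (\<integral>\<^sup>+s. ennreal (4 * pi * C * (sinh s)\<^sup>2) * indicator {0..r} s \<partial>lborel)"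
    proof (rule nn_integral_cong)
      fix s :: real
      show "ennreal (indicator {0<..} s * (4 * pi / (- k * sqrt (- k)) * (sinh s)\<^sup>2)) * indicator {..r} s
          = ennreal (4 * pi * C * (sinh s)\<^sup>2) * indicator {0..r} s"
        by (cases s "0 :: real" rule: linorder_cases) (auto simp: indicator_def C_def)
    qed
    also have "\<dots> = (if 0 \<le> r then ennreal (C * (pi * (sinh (2 * r) - 2 * r))) else 0)"
    proof (cases "0 \<le> r")
      case True
      have "(\<integral>\<^sup>+s. ennreal (4 * pi * C * (sinh s)\<^sup>2) * indicator {0..r} s \<partial>lborel)
          = ennreal (C * (pi * (sinh (2 * r) - 2 * r)) - C * (pi * (sinh (2 * 0) - 2 * 0)))"
      proof (rule nn_integral_FTC_Icc)
        fix s :: real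
        have "((\<lambda>r. C * (pi * (sinh (2 * r) - 2 * r))) has_real_derivative C * (pi * (cosh (2 * s) * 2 - 2))) (at s)"
          by (auto intro!: derivative_eq_intros)
        moreover have "C * (pi * (cosh (2 * s) * 2 - 2)) = 4 * pi * C * (sinh s)\<^sup>2"
          by (simp add: cosh_double cosh_square_eq)
        ultimately show "((\<lambda>r. C * (pi * (sinh (2 * r) - 2 * r))) has_real_derivative 4 * pi * C * (sinh s)\<^sup>2) (at s)"
          by simp
        show "0 \<le> 4 * pi * C * (sinh s)\<^sup>2" using C by simp
      qed (use True in \<open>auto simp: sinh_field_def\<close>)
      then show ?thesis using True by simp
    qed simp
    finally show ?thesis .
  qed
  show "emeasure ?M X = emeasure ?N X" if X: "X \<in> ?E" for X
  proof -
    from X obtain a where a: "X = {..a}" by auto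
    show ?thesis unfolding a M N ..
  qed
  show "Int_stable ?E" by (auto simp: Int_stable_def min_def intro!: image_eqI)
  show "?E \<subseteq> Pow UNIV" by simp
  show "sets ?M = sigma_sets UNIV ?E" "sets ?N = sigma_sets UNIV ?E"
    by (simp_all add: borel_eq_atMost)
  show "range ?A \<subseteq> ?E" by auto
  show "(\<Union>n. ?A n) = UNIV" by (auto intro: real_arch_simple)
  show "emeasure ?M (?A n) \<noteq> \<infinity>" for n by (simp add: M)
qed


section \<open>Integrals against the heat kernel\<close>

definition heat_kernel_const :: "real \<Rightarrow> real \<Rightarrow> real" where
  "heat_kernel_const k t = exp (k * t / 2) / (2 * pi * t * sqrt (2 * pi * t))"

text \<open>The explicit kernel in terms of q = cosh (sqrt (-k) d). Since \<open>arcosh_sq q\<close>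
  is -k d^2, the exponent equals - d^2 / (2 t).\<close>

definition heat_profile :: "real \<Rightarrow> real \<Rightarrow> real \<Rightarrow> real" where
  "heat_profile k t q = heat_kernel_const k t * (rsinh q * exp (arcosh_sq q / (2 * k * t)))"

definition heat_kernel :: "real \<Rightarrow> real^3 \<Rightarrow> real \<Rightarrow> real^3 \<Rightarrow> real" where
  "heat_kernel k x t y = heat_profile k t (cosh_dist x y)"

lemma heat_kernel_const_pos: "0 < t \<Longrightarrow> 0 < heat_kernel_const k t"
  by (simp add: heat_kernel_const_def)

lemma heat_kernel_pos: "0 < t \<Longrightarrow> x \<in> hyp3 \<Longrightarrow> y \<in> hyp3 \<Longrightarrow> 0 < heat_kernel k x t y"
  by (simp add: heat_kernel_def heat_profile_def heat_kernel_const_pos rsinh_pos cosh_dist_ge_1)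

lemma measurable_rsinh_cosh: "(\<lambda>r. rsinh (cosh r)) \<in> borel_measurable borel"
proof (rule borel_measurable_continuous_onI)
  have "-1 < cosh r" for r :: real using cosh_real_ge_1[of r] by linarith
  then show "continuous_on UNIV (\<lambda>r. rsinh (cosh r))"
    by (intro continuous_on_compose2[OF continuous_on_rsinh] continuous_intros) auto
qed

lemma heat_profile_cosh: "heat_profile k t (cosh r)
    = heat_kernel_const k t * (rsinh (cosh r) * exp (r\<^sup>2 / (2 * k * t)))"
  by (simp add: heat_profile_def arcosh_sq_cosh)

text \<open>After passing to the radius, k and t enter only through \<tau> = -k t: the volume scale
  (-k)^(-3/2) and the kernel factor t^(-3/2) combine into \<tau>^(-3/2).\<close>

lemma heat_profile_density:
  assumes k: "k < 0" and t: "0 < t"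
  shows "4 * pi / (- k * sqrt (- k)) * (sinh r)\<^sup>2 * heat_profile k t (cosh r) = radial_density (- k * t) r"
proof -
  define s where "s = sqrt (- k)"
  have s: "0 < s" "k = - s\<^sup>2" using k by (auto simp: s_def)
  define u where "u = sqrt (2 * pi * t)"
  have u: "0 < u" using t by (simp add: u_def)
  have su: "sqrt (2 * pi * (s\<^sup>2 * t)) = s * u"
    using s(1) unfolding u_def by (simp add: real_sqrt_mult)
  have "rsinh (cosh r) * (sinh r)\<^sup>2 = r * sinh r"
    by (metis rsinh_cosh_mult_sinh mult.assoc power2_eq_square)
  then have "4 * pi / (- k * sqrt (- k)) * (sinh r)\<^sup>2 * heat_profile k t (cosh r)
    = 4 * pi / (- k * sqrt (- k)) * heat_kernel_const k t * (r * sinh r * exp (r\<^sup>2 / (2 * k * t)))"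
    unfolding heat_profile_cosh by (simp add: mult_ac)
  also have "4 * pi / (- k * sqrt (- k)) * heat_kernel_const k t
      = 2 / (- k * t * sqrt (2 * pi * (- k * t))) * exp (- (- k * t) / 2)"
    unfolding heat_kernel_const_def s_def[symmetric] u_def[symmetric] unfolding s(2)
    using s(1) u t su by (simp add: field_simps power2_eq_square)
  also have "r\<^sup>2 / (2 * k * t) = - r\<^sup>2 / (2 * (- k * t))" by simp
  finally show ?thesis unfolding radial_density_def .
qed

lemma has_bochner_integral_heat_kernel:
  assumes k: "k < 0" and t: "0 < t" and x: "x \<in> hyp3"
    and G [measurable]: "G \<in> borel_measurable borel"
    and I: "has_bochner_integral lborel (\<lambda>r. indicator {0<..} r * (radial_density (- k * t) r * G r)) I"
  shows "has_bochner_integral (hyp3_volume k) (\<lambda>y. heat_kernel k x t y * G (hyp_dist x y)) I"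
proof -
  let ?w = "\<lambda>r. indicator {0<..} r * (4 * pi / (- k * sqrt (- k)) * (sinh r)\<^sup>2)"
  let ?H = "\<lambda>r. heat_profile k t (cosh r) * G r"
  note [measurable] = measurable_rsinh_cosh
  have H [measurable]: "?H \<in> borel_measurable borel" unfolding heat_profile_cosh by measurable
  have w [measurable]: "?w \<in> borel_measurable borel" unfolding sinh_field_def by measurable
  have "0 < - k * sqrt (- k)" using k by (intro mult_pos_pos) auto
  then have "0 \<le> 4 * pi / (- k * sqrt (- k))" by (intro divide_nonneg_nonneg less_imp_le) simp_all
  then have w0: "0 \<le> ?w r" for r by (intro mult_nonneg_nonneg) simp_all
  have meas: "hyp_dist x \<in> borel_measurable (hyp3_volume k)"
    by (simp add: borel_measurable_hyp3_volume measurable_restrict_space1)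
  have "?w r * ?H r = indicator {0<..} r * (radial_density (- k * t) r * G r)" for r
    unfolding heat_profile_density[OF k t, symmetric] by (simp only: mult_ac)
  then have 1: "has_bochner_integral lborel (\<lambda>r. ?w r *\<^sub>R ?H r) I"
    using I by (simp only: real_scaleR_def)
  then have "has_bochner_integral (density lborel ?w) ?H I"
    using H w w0 by (intro has_bochner_integral_density AE_I2) (simp_all only: measurable_lborel2)
  then have "has_bochner_integral (distr (hyp3_volume k) borel (hyp_dist x)) ?H I"
    unfolding distr_hyp_dist[OF k x] .
  then have "has_bochner_integral (hyp3_volume k) (\<lambda>y. ?H (hyp_dist x y)) I"
    using meas by (simp add: has_bochner_integral_iff integrable_distr_eq integral_distr)
  then show ?thesis
    by (rule has_bochner_integral_cong[THEN iffD1, rotated -1])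
      (auto simp: space_hyp3_volume heat_kernel_def cosh_hyp_dist x)
qed


lemma measurable_heat_kernel:
  assumes "x \<in> hyp3" shows "heat_kernel k x t \<in> borel_measurable (hyp3_volume k')"
proof -
  note [measurable] = measurable_rsinh_cosh
  have "(\<lambda>y. heat_profile k t (cosh (hyp_dist x y))) \<in> borel_measurable (hyp3_volume k')"
    unfolding borel_measurable_hyp3_volume heat_profile_cosh by (rule measurable_restrict_space1) measurable
  then show ?thesis
    by (rule measurable_cong[THEN iffD1, rotated])
      (auto simp: space_hyp3_volume heat_kernel_def cosh_hyp_dist assms)
qed

lemma heat_kernel_mass:
  assumes "k < 0" "0 < t" "x \<in> hyp3"
  shows "has_bochner_integral (hyp3_volume k) (heat_kernel k x t) 1"
  using has_bochner_integral_heat_kernel[OF assms, of "\<lambda>_. 1" 1] radial_mass[of "- k * t"] assms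
  by (simp add: mult_neg_pos)

lemma heat_kernel_cosh_moment:
  assumes "k < 0" "0 < t" "x \<in> hyp3"
  shows "has_bochner_integral (hyp3_volume k) (\<lambda>y. heat_kernel k x t y * cosh_dist x y) (exp (- 3 * k * t / 2))"
proof -
  have "cosh \<in> borel_measurable (borel :: real measure)"
    unfolding cosh_field_def[abs_def] by measurable
  then have "has_bochner_integral (hyp3_volume k) (\<lambda>y. heat_kernel k x t y * cosh (hyp_dist x y)) (exp (3 * (- k * t) / 2))"
    using assms by (intro has_bochner_integral_heat_kernel radial_cosh_moment) (simp_all add: mult_neg_pos)
  then show ?thesis
    by (rule has_bochner_integral_cong[THEN iffD1, rotated -1])
      (auto simp: space_hyp3_volume cosh_hyp_dist assms)
qed

text \<open>With \<rho> = |y - x| one has y_3 \<le> x_3 + \<rho>, hence q - 1 \<ge> \<rho>^2 / (2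
  x_3 (x_3 + \<rho>)), and this bound increases with \<rho>. It makes q - 1 a penalty for leaving a
  Euclidean neighbourhood of x.\<close>

lemma cosh_dist_ge_away:
  assumes x: "x \<in> hyp3" and y: "y \<in> hyp3" and d: "0 < d" "d \<le> dist y x"
  shows "d\<^sup>2 / (2 * x$3 * (x$3 + d)) \<le> cosh_dist x y - 1"
proof -
  define r where "r = dist y x"
  have pos: "0 < x$3" "0 < y$3" using x y by (auto simp: hyp3_def)
  have r: "r\<^sup>2 = (y$1 - x$1)\<^sup>2 + (y$2 - x$2)\<^sup>2 + (y$3 - x$3)\<^sup>2"
    unfolding r_def dist_norm norm_eq_sqrt_inner by (simp add: inner_vec_def sum_3 power2_eq_square)
  have "\<bar>(y - x)$3\<bar> \<le> r" unfolding r_def dist_norm by (rule component_le_norm_cart)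
  then have y3: "y$3 \<le> x$3 + r" by simp
  have "d\<^sup>2 * (x$3 + r) \<le> r\<^sup>2 * (x$3 + d)"
  proof -
    have "d\<^sup>2 \<le> r\<^sup>2" "d * (d * r) \<le> r * (d * r)" using d unfolding r_def[symmetric]
      by (auto intro: power_mono mult_right_mono)
    then show ?thesis using pos by (simp add: algebra_simps power2_eq_square add_mono mult_left_mono)
  qed
  moreover have "0 < x$3 + d" "0 < x$3 + r" using pos d unfolding r_def[symmetric] by auto
  ultimately have "d\<^sup>2 / (x$3 + d) \<le> r\<^sup>2 / (x$3 + r)" by (simp add: divide_simps)
  then have "d\<^sup>2 / (x$3 + d) / (2 * x$3) \<le> r\<^sup>2 / (x$3 + r) / (2 * x$3)"
    using pos by (intro divide_right_mono) auto
  then have "d\<^sup>2 / (2 * x$3 * (x$3 + d)) \<le> r\<^sup>2 / (2 * x$3 * (x$3 + r))"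
    by (simp add: mult.commute)
  also have "\<dots> \<le> r\<^sup>2 / (2 * x$3 * y$3)"
    using pos d y3 unfolding r_def[symmetric] by (intro divide_left_mono mult_left_mono mult_pos_pos) auto
  also have "\<dots> = cosh_dist x y - 1"
    unfolding cosh_dist_def r using pos by (simp add: field_simps power2_eq_square)
  finally show ?thesis .
qed

text \<open>A Chebyshev argument: |f y - f x| is at most e/2 plus a multiple of q - 1, and the mean
  of q - 1 under the kernel is exp (-3 k t / 2) - 1, which tends to 0.\<close>

lemma heat_kernel_initial:
  fixes f :: "real^3 \<Rightarrow> real"
  assumes k: "k < 0" and x: "x \<in> hyp3" and f: "continuous_on hyp3 f"
    and K: "compact K" "K \<subseteq> hyp3" "\<And>y. y \<in> hyp3 - K \<Longrightarrow> f y = 0"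
  shows "((\<lambda>t. \<integral>y. heat_kernel k x t y * f y \<partial>hyp3_volume k) \<longlongrightarrow> f x) (at_right 0)"
proof -
  have "compact (f ` K)" by (rule compact_continuous_image[OF continuous_on_subset[OF f K(2)] K(1)])
  then have "\<exists>B. \<forall>y\<in>K. \<bar>f y\<bar> \<le> B"
    by (auto simp: bounded_iff dest!: compact_imp_bounded)
  then obtain B0 where B0: "\<And>y. y \<in> K \<Longrightarrow> \<bar>f y\<bar> \<le> B0" by blast
  define B where "B = max B0 0"
  have B: "0 \<le> B" "\<And>y. y \<in> hyp3 \<Longrightarrow> \<bar>f y\<bar> \<le> B"
    using B0 K(3) unfolding B_def by (auto simp: le_max_iff_disj)
  have fm: "f \<in> borel_measurable (hyp3_volume k)"
    unfolding borel_measurable_hyp3_volume by (rule borel_measurable_continuous_on_restrict[OF f])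
  have int_pf: "integrable (hyp3_volume k) (\<lambda>y. heat_kernel k x t y * f y)" if t: "0 < t" for t
  proof (rule Bochner_Integration.integrable_bound)
    show "integrable (hyp3_volume k) (\<lambda>y. B * heat_kernel k x t y)"
      using heat_kernel_mass[OF k t x] by (auto simp: has_bochner_integral_iff)
    show "AE y in hyp3_volume k. norm (heat_kernel k x t y * f y) \<le> norm (B * heat_kernel k x t y)"
      using B heat_kernel_pos[OF t x, of _ k]
      by (intro AE_I2) (auto simp: space_hyp3_volume abs_mult mult.commute[of B] intro!: mult_left_mono)
  qed (use fm measurable_heat_kernel[OF x] in measurable)
  have diff: "\<bar>(\<integral>y. heat_kernel k x t y * f y \<partial>hyp3_volume k) - f x\<bar> \<le> e + C * (exp (- 3 * k * t / 2) - 1)"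
    if t: "0 < t" and C: "\<And>y. y \<in> hyp3 \<Longrightarrow> \<bar>f y - f x\<bar> \<le> e + C * (cosh_dist x y - 1)" for t e C
  proof -
    let ?p = "heat_kernel k x t"
    note m = heat_kernel_mass[OF k t x] and c = heat_kernel_cosh_moment[OF k t x]
    have "(\<integral>y. ?p y * f y \<partial>hyp3_volume k) - f x = (\<integral>y. ?p y * (f y - f x) \<partial>hyp3_volume k)"
      using m int_pf[OF t] by (simp add: has_bochner_integral_iff right_diff_distrib)
    also have "\<bar>\<dots>\<bar> \<le> (\<integral>y. (e - C) * ?p y + C * (?p y * cosh_dist x y) \<partial>hyp3_volume k)"
    proof (rule order_trans[OF integral_abs_bound integral_mono])
      show "integrable (hyp3_volume k) (\<lambda>y. \<bar>?p y * (f y - f x)\<bar>)"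
        using m int_pf[OF t] by (simp add: has_bochner_integral_iff right_diff_distrib)
      show "integrable (hyp3_volume k) (\<lambda>y. (e - C) * ?p y + C * (?p y * cosh_dist x y))"
        using m c by (simp add: has_bochner_integral_iff)
      fix y assume "y \<in> space (hyp3_volume k)"
      then have y: "y \<in> hyp3" by (simp add: space_hyp3_volume)
      have "\<bar>?p y * (f y - f x)\<bar> = ?p y * \<bar>f y - f x\<bar>"
        using heat_kernel_pos[OF t x y, of k] by (simp add: abs_mult)
      also have "\<dots> \<le> ?p y * (e + C * (cosh_dist x y - 1))"
        using C[OF y] heat_kernel_pos[OF t x y, of k] by (simp add: mult_left_mono)
      also have "\<dots> = (e - C) * ?p y + C * (?p y * cosh_dist x y)"
        by (simp add: algebra_simps)
      finally show "\<bar>?p y * (f y - f x)\<bar> \<le> (e - C) * ?p y + C * (?p y * cosh_dist x y)" .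
    qed
    also have "\<dots> = e + C * (exp (- 3 * k * t / 2) - 1)"
      using m c by (simp add: has_bochner_integral_iff algebra_simps)
    finally show ?thesis .
  qed
  show ?thesis
  proof (rule tendstoI)
    fix e :: real assume e: "0 < e"
    have "isCont f x" using f x open_hyp3 by (simp add: continuous_on_eq_continuous_at)
    then obtain d where d: "0 < d" "\<And>y. dist y x < d \<Longrightarrow> dist (f y) (f x) < e / 2"
      using e unfolding continuous_at_eps_delta by (metis half_gt_zero)
    have x3: "0 < x$3" using x by (simp add: hyp3_def)
    define c where "c = d\<^sup>2 / (2 * x$3 * (x$3 + d))"
    have c: "0 < c" unfolding c_def using d x3 by (intro divide_pos_pos mult_pos_pos) auto
    \<comment> \<open>Near x, continuity gives e/2. Away from x, the crude bound 2 B is absorbed by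
      q - 1 \<ge> c.\<close>
    have bnd: "\<bar>f y - f x\<bar> \<le> e / 2 + 2 * B / c * (cosh_dist x y - 1)" if y: "y \<in> hyp3" for y
    proof (cases "dist y x < d")
      case True
      have "0 \<le> 2 * B / c * (cosh_dist x y - 1)" using B c cosh_dist_ge_1[OF x y] by simp
      then show ?thesis using d(2)[OF True] by (simp add: dist_real_def)
    next
      case False
      then have "c \<le> cosh_dist x y - 1" unfolding c_def using d by (intro cosh_dist_ge_away x y) auto
      then have "2 * B / c * c \<le> 2 * B / c * (cosh_dist x y - 1)" using B c by (intro mult_left_mono) auto
      then show ?thesis using B(2)[OF y] B(2)[OF x] c e by simp
    qed
    have "((\<lambda>t. 2 * B / c * (exp (- 3 * k * t / 2) - 1)) \<longlongrightarrow> 2 * B / c * (exp (- 3 * k * 0 / 2) - 1)) (at_right 0)"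
      by (intro tendsto_intros) simp
    then have "\<forall>\<^sub>F t in at_right 0. 2 * B / c * (exp (- 3 * k * t / 2) - 1) < e / 2"
      using e by (intro order_tendstoD) auto
    moreover have "\<forall>\<^sub>F t in at_right (0::real). 0 < t" by (simp add: eventually_at_right_less)
    ultimately show "\<forall>\<^sub>F t in at_right 0. dist (\<integral>y. heat_kernel k x t y * f y \<partial>hyp3_volume k) (f x) < e"
      by eventually_elim (use diff[OF _ bnd] in \<open>fastforce simp: dist_real_def\<close>)
  qed
qed


section \<open>The Laplacian of radial functions\<close>

lemma has_real_derivative_along_axis:
  fixes f :: "real^'n::finite \<Rightarrow> real"
  assumes "(f has_derivative f') (at (y + t *\<^sub>R axis i 1))"
  shows "((\<lambda>s. f (y + s *\<^sub>R axis i 1)) has_real_derivative f' (axis i 1)) (at t)"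
proof -
  have "((\<lambda>s. y + s *\<^sub>R axis i 1) has_derivative (\<lambda>h. h *\<^sub>R axis i 1)) (at t)"
    by (auto intro!: derivative_eq_intros)
  from has_derivative_compose[OF this assms]
  have "((\<lambda>s. f (y + s *\<^sub>R axis i 1)) has_derivative (\<lambda>h. f' (h *\<^sub>R axis i 1))) (at t)" .
  moreover have "(\<lambda>h. f' (h *\<^sub>R axis i 1)) = (*) (f' (axis i 1))"
    using has_derivative_linear[OF assms] by (simp add: fun_eq_iff linear_scale mult.commute)
  ultimately show ?thesis by (simp only: has_field_derivative_def)
qed

lemma partial_deriv_eq:
  "(f has_derivative f') (at y) \<Longrightarrow> partial_deriv i f y = f' (axis i 1)"
  unfolding partial_deriv_def
  by (rule DERIV_imp_deriv) (use has_real_derivative_along_axis[of f f' y 0 i] in simp)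

lemma partial_deriv_along_axis:
  fixes f :: "real^'n::finite \<Rightarrow> real"
  assumes "f differentiable (at (y + t *\<^sub>R axis i 1))"
  shows "((\<lambda>s. f (y + s *\<^sub>R axis i 1)) has_real_derivative partial_deriv i f (y + t *\<^sub>R axis i 1)) (at t)"
proof -
  obtain f' where f': "(f has_derivative f') (at (y + t *\<^sub>R axis i 1))"
    using assms by (auto simp: differentiable_def)
  show ?thesis
    using has_real_derivative_along_axis[OF f'] partial_deriv_eq[OF f'] by simp
qed

lemma matrix_inv_mat:
  fixes c :: "'a::field"
  assumes "c \<noteq> 0"
  shows "matrix_inv (mat c :: 'a^'n::finite^'n) = mat (1 / c)"
proof -
  have *: "(mat a :: 'a^'n^'n) ** mat b = mat (a * b)" for a b
  proof -
    have "(\<Sum>k\<in>UNIV. (if i = k then a else 0) * (if k = j then b else 0))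
        = (\<Sum>k\<in>UNIV. if i = k then a * (if i = j then b else 0) else 0)" for i j :: 'n
      by (rule sum.cong) auto
    then show ?thesis by (simp add: matrix_matrix_mult_def mat_def vec_eq_iff)
  qed
  have "mat c ** matrix_inv (mat c :: 'a^'n^'n) = mat 1 \<and> matrix_inv (mat c) ** (mat c :: 'a^'n^'n) = mat 1"
    unfolding matrix_inv_def by (rule someI[of _ "mat (1 / c)"]) (use assms in \<open>simp add: *\<close>)
  then have "matrix_inv (mat c :: 'a^'n^'n) = matrix_inv (mat c) ** (mat c ** mat (1 / c))"
    using assms by (simp add: *)
  also have "\<dots> = mat (1 / c)"
    using \<open>mat c ** matrix_inv (mat c :: 'a^'n^'n) = mat 1 \<and> _\<close> by (simp add: matrix_mul_assoc)
  finally show ?thesis .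
qed

lemma has_derivative_vec_nth: "((\<lambda>y. y $ i) has_derivative (\<lambda>v. v $ i)) (at y)" for y :: "real^'n::finite"
  by (rule bounded_linear_imp_has_derivative[OF bounded_linear_vec_nth])

text \<open>The volume density times the inverse metric is the scalar (-k)^(-1/2) / y_3. The
  divergence form is thus -k y_3^3 times the Euclidean divergence of grad f / y_3, and the
  first-order term comes from differentiating 1 / y_3.\<close>

lemma laplace_hyp3:
  assumes k: "k < 0" and y: "y \<in> hyp3" and f: "\<And>i. partial_deriv i f differentiable (at y)"
  shows "laplace_beltrami (hyp3_metric k) f y =
    - k * ((y$3)\<^sup>2 * (\<Sum>i\<in>UNIV. partial_deriv i (partial_deriv i f) y) - y$3 * partial_deriv 3 f y)"
proof -
  define c where "c = 1 / sqrt (- k)"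
  have c: "0 < c" using k by (simp add: c_def)
  have y3: "0 < y$3" using y by (simp add: hyp3_def)
  have inner: "sqrt (det (hyp3_metric k z)) * (\<Sum>j\<in>UNIV. matrix_inv (hyp3_metric k z) $ i $ j * partial_deriv j f z)
      = c * (partial_deriv i f z / z$3)" if z: "z \<in> hyp3" for z i
  proof -
    have z3: "0 < z$3" using z by (simp add: hyp3_def)
    have "matrix_inv (hyp3_metric k z) = mat (- k * (z$3)\<^sup>2)"
      unfolding hyp3_metric_def using k z3 by (subst matrix_inv_mat) auto
    then have "(\<Sum>j\<in>UNIV. matrix_inv (hyp3_metric k z) $ i $ j * partial_deriv j f z)
        = (\<Sum>j\<in>UNIV. if i = j then - k * (z$3)\<^sup>2 * partial_deriv j f z else 0)"
      by (intro sum.cong) (simp_all add: mat_def)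
    also have "\<dots> = - k * (z$3)\<^sup>2 * partial_deriv i f z" by simp
    finally show ?thesis
      unfolding sqrt_det_hyp3_metric[OF k z] c_def using k z3
      by (simp add: power2_eq_square power3_eq_cube)
  qed
  have pd: "partial_deriv i (\<lambda>z. sqrt (det (hyp3_metric k z)) *
        (\<Sum>j\<in>UNIV. matrix_inv (hyp3_metric k z) $ i $ j * partial_deriv j f z)) y
      = c * (partial_deriv i (partial_deriv i f) y / y$3
          - (if i = 3 then partial_deriv i f y / (y$3)\<^sup>2 else 0))" for i
  proof -
    obtain f' where f': "(partial_deriv i f has_derivative f') (at y)"
      using f by (auto simp: differentiable_def)
    have "((\<lambda>z. c * (partial_deriv i f z / z$3)) has_derivative
        (\<lambda>v. c * ((f' v * y$3 - partial_deriv i f y * v$3) / (y$3 * y$3)))) (at y)"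
      using y3 by (auto intro!: derivative_eq_intros f' has_derivative_vec_nth simp: fun_eq_iff field_simps)
    then have "((\<lambda>z. sqrt (det (hyp3_metric k z)) *
        (\<Sum>j\<in>UNIV. matrix_inv (hyp3_metric k z) $ i $ j * partial_deriv j f z)) has_derivative
        (\<lambda>v. c * ((f' v * y$3 - partial_deriv i f y * v$3) / (y$3 * y$3)))) (at y)"
      by (rule has_derivative_transform_within_open[OF _ open_hyp3 y]) (simp only: inner)
    from partial_deriv_eq[OF this, of i] show ?thesis
      using y3 partial_deriv_eq[OF f', of i]
      by (auto simp: axis_def field_simps power2_eq_square)
  qed
  have "(\<Sum>i\<in>UNIV. if i = 3 then partial_deriv i f y / (y$3)\<^sup>2 else 0) = partial_deriv 3 f y / (y$3)\<^sup>2"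
    by simp
  then have "laplace_beltrami (hyp3_metric k) f y
     = c * ((\<Sum>i\<in>UNIV. partial_deriv i (partial_deriv i f) y) / y$3 - partial_deriv 3 f y / (y$3)\<^sup>2)
      / (1 / (- k * sqrt (- k)) / (y $ 3) ^ 3)"
    unfolding laplace_beltrami_def pd sqrt_det_hyp3_metric[OF k y]
    by (simp only: sum_distrib_left[symmetric] sum_subtractf sum_divide_distrib[symmetric])
  also have "\<dots> = - k * ((y$3)\<^sup>2 * (\<Sum>i\<in>UNIV. partial_deriv i (partial_deriv i f) y) - y$3 * partial_deriv 3 f y)"
    unfolding c_def using k y3 by (simp add: field_simps power2_eq_square power3_eq_cube)
  finally show ?thesis .
qed

text \<open>One expression for all three coordinates: (y_i - x_i) / (x_3 y_3) for i = 1, 2, and 1 /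
  x_3 - q / y_3 for i = 3, where y_3 occurs in the denominator as well.\<close>

definition cosh_dist_grad :: "real^3 \<Rightarrow> 3 \<Rightarrow> real^3 \<Rightarrow> real" where
  "cosh_dist_grad x i y = (y$i - (1 - of_bool (i = 3)) * x$i) / (x$3 * y$3) - of_bool (i = 3) * cosh_dist x y / y$3"

definition cosh_dist_hess :: "real^3 \<Rightarrow> 3 \<Rightarrow> 3 \<Rightarrow> real^3 \<Rightarrow> real" where
  "cosh_dist_hess x i j y = of_bool (i = j) / (x$3 * y$3)
    - of_bool (j = 3) * (y$i - (1 - of_bool (i = 3)) * x$i) / (x$3 * (y$3)\<^sup>2)
    - of_bool (i = 3) * cosh_dist_grad x j y / y$3
    + of_bool (i = 3) * of_bool (j = 3) * cosh_dist x y / (y$3)\<^sup>2"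

lemma has_derivative_cosh_dist:
  assumes "x \<in> hyp3" "y \<in> hyp3"
  shows "(cosh_dist x has_derivative (\<lambda>v. \<Sum>i\<in>UNIV. cosh_dist_grad x i y * v$i)) (at y)"
proof -
  have p: "x$3 \<noteq> 0" "y$3 \<noteq> 0" using assms by (auto simp: hyp3_def)
  let ?n = "\<lambda>y. (y$1 - x$1)\<^sup>2 + (y$2 - x$2)\<^sup>2 + (y$3)\<^sup>2 + (x$3)\<^sup>2"
  have "(cosh_dist x has_derivative (\<lambda>v. (2 * (y$1 - x$1) * v$1 + 2 * (y$2 - x$2) * v$2 + 2 * y$3 * v$3) / (2 * x$3 * y$3)
      - ?n y * (2 * x$3 * v$3) / ((2 * x$3 * y$3) * (2 * x$3 * y$3)))) (at y)"
    unfolding cosh_dist_def[abs_def] using p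
    by (auto intro!: derivative_eq_intros has_derivative_vec_nth simp: fun_eq_iff divide_simps)
      (simp add: algebra_simps)
  moreover have "(2 * (y$1 - x$1) * v$1 + 2 * (y$2 - x$2) * v$2 + 2 * y$3 * v$3) / (2 * x$3 * y$3)
      - ?n y * (2 * x$3 * v$3) / ((2 * x$3 * y$3) * (2 * x$3 * y$3)) = (\<Sum>i\<in>UNIV. cosh_dist_grad x i y * v$i)" for v
  proof -
    have "(\<Sum>i\<in>UNIV. cosh_dist_grad x i y * v$i)
      = (y$1 - x$1) / (x$3 * y$3) * v$1 + (y$2 - x$2) / (x$3 * y$3) * v$2 + (y$3 / (x$3 * y$3) - cosh_dist x y / y$3) * v$3"
      unfolding sum_3 cosh_dist_grad_def by simp
    then show ?thesis unfolding cosh_dist_def using p by (simp add: divide_simps) (simp add: algebra_simps)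
  qed
  ultimately show ?thesis by simp
qed

lemma has_derivative_cosh_dist_grad:
  assumes "x \<in> hyp3" "y \<in> hyp3"
  shows "(cosh_dist_grad x i has_derivative (\<lambda>v. \<Sum>j\<in>UNIV. cosh_dist_hess x i j y * v$j)) (at y)"
proof -
  have p: "x$3 \<noteq> 0" "y$3 \<noteq> 0" using assms by (auto simp: hyp3_def)
  define e where "e = (of_bool (i = 3) :: real)"
  define G where "G v = (\<Sum>j\<in>UNIV. cosh_dist_grad x j y * v$j)" for v :: "real^3"
  have "(cosh_dist_grad x i has_derivative (\<lambda>v. v$i / (x$3 * y$3) - (y$i - (1 - e) * x$i) * v$3 / (x$3 * (y$3)\<^sup>2)
      - (e * G v / y$3 - e * cosh_dist x y * v$3 / (y$3)\<^sup>2))) (at y)"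
    unfolding cosh_dist_grad_def[abs_def] e_def[symmetric] using p
    by (auto intro!: derivative_eq_intros has_derivative_vec_nth has_derivative_cosh_dist[OF assms, folded G_def]
        simp: fun_eq_iff) (simp add: divide_simps power2_eq_square, simp add: algebra_simps)
  moreover have "v$i / (x$3 * y$3) - (y$i - (1 - e) * x$i) * v$3 / (x$3 * (y$3)\<^sup>2)
      - (e * G v / y$3 - e * cosh_dist x y * v$3 / (y$3)\<^sup>2) = (\<Sum>j\<in>UNIV. cosh_dist_hess x i j y * v$j)" for v
  proof -
    have "(\<Sum>j\<in>UNIV. cosh_dist_hess x i j y * v$j) = (\<Sum>j\<in>UNIV. if i = j then v$j / (x$3 * y$3) else 0)
      - (\<Sum>j\<in>UNIV. if j = 3 then (y$i - (1 - e) * x$i) * v$j / (x$3 * (y$3)\<^sup>2) else 0)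
      - e / y$3 * G v + (\<Sum>j\<in>UNIV. if j = 3 then e * cosh_dist x y * v$j / (y$3)\<^sup>2 else 0)"
      unfolding G_def sum_distrib_left sum_subtractf[symmetric] sum.distrib[symmetric]
      by (rule sum.cong) (auto simp: cosh_dist_hess_def e_def algebra_simps diff_divide_distrib add_divide_distrib)
    then show ?thesis by (simp add: e_def)
  qed
  ultimately show ?thesis by simp
qed

text \<open>In curvature -1 this is |grad (cosh r)|^2 = (sinh r)^2, the distance having a gradient
  of length one.\<close>

lemma cosh_dist_grad_norm:
  assumes "x \<in> hyp3" "y \<in> hyp3"
  shows "(y$3)\<^sup>2 * (\<Sum>i\<in>UNIV. (cosh_dist_grad x i y)\<^sup>2) = (cosh_dist x y)\<^sup>2 - 1"
proof -
  have p: "x$3 \<noteq> 0" "y$3 \<noteq> 0" using assms by (auto simp: hyp3_def)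
  have q: "2 * x$3 * y$3 * cosh_dist x y = (y$1 - x$1)\<^sup>2 + (y$2 - x$2)\<^sup>2 + (y$3)\<^sup>2 + (x$3)\<^sup>2"
    using p by (simp add: cosh_dist_def)
  have "(x$3)\<^sup>2 * ((y$3)\<^sup>2 * (\<Sum>i\<in>UNIV. (cosh_dist_grad x i y)\<^sup>2))
      = (y$1 - x$1)\<^sup>2 + (y$2 - x$2)\<^sup>2 + (y$3 - cosh_dist x y * x$3)\<^sup>2"
    unfolding sum_3 cosh_dist_grad_def using p by (simp add: field_simps power2_eq_square)
  also have "\<dots> = (x$3)\<^sup>2 * ((cosh_dist x y)\<^sup>2 - 1)" using q by algebra
  finally show ?thesis using p by simp
qed

text \<open>In curvature -1 and dimension n, cosh r is an eigenfunction of the Laplacian with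
  eigenvalue n; here n = 3.\<close>

lemma cosh_dist_laplace:
  assumes "x \<in> hyp3" "y \<in> hyp3"
  shows "(y$3)\<^sup>2 * (\<Sum>i\<in>UNIV. cosh_dist_hess x i i y) - y$3 * cosh_dist_grad x 3 y = 3 * cosh_dist x y"
proof -
  have p: "x$3 \<noteq> 0" "y$3 \<noteq> 0" using assms by (auto simp: hyp3_def)
  show ?thesis
    unfolding sum_3 cosh_dist_hess_def cosh_dist_grad_def using p by (simp add: field_simps power2_eq_square)
qed


lemma continuous_on_cosh_dist: "x \<in> hyp3 \<Longrightarrow> continuous_on hyp3 (cosh_dist x)"
  by (meson has_derivative_cosh_dist has_derivative_continuous continuous_at_imp_continuous_on)

lemma continuous_on_cosh_dist_grad: "x \<in> hyp3 \<Longrightarrow> continuous_on hyp3 (cosh_dist_grad x i)"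
  by (meson has_derivative_cosh_dist_grad has_derivative_continuous continuous_at_imp_continuous_on)

lemma continuous_on_cosh_dist_hess: "x \<in> hyp3 \<Longrightarrow> continuous_on hyp3 (cosh_dist_hess x i j)"
  unfolding cosh_dist_hess_def[abs_def]
  by (intro continuous_intros continuous_on_cosh_dist continuous_on_cosh_dist_grad)
    (auto simp: hyp3_def)

text \<open>Instantiated by the heat profile and by the cutoff. Derivatives are required on q > -1,
  so that y = x, where q = 1, needs no separate treatment.\<close>

locale radial_function =
  fixes x :: "real^3" and P P1 P2 :: "real \<Rightarrow> real"
  assumes x: "x \<in> hyp3"
    and P: "\<And>q. -1 < q \<Longrightarrow> (P has_real_derivative P1 q) (at q)"
    and P1: "\<And>q. -1 < q \<Longrightarrow> (P1 has_real_derivative P2 q) (at q)"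
begin

abbreviation F :: "real^3 \<Rightarrow> real" where "F y \<equiv> P (cosh_dist x y)"

lemma cosh_dist_gt: "y \<in> hyp3 \<Longrightarrow> -1 < cosh_dist x y"
  using cosh_dist_ge_1[OF x, of y] by linarith

lemma has_derivative_F:
  assumes y: "y \<in> hyp3"
  shows "(F has_derivative (\<lambda>v. P1 (cosh_dist x y) * (\<Sum>i\<in>UNIV. cosh_dist_grad x i y * v$i))) (at y)"
  using has_derivative_compose[OF has_derivative_cosh_dist[OF x y] P[OF cosh_dist_gt[OF y], unfolded has_field_derivative_def]] .

lemma partial_deriv_F:
  assumes y: "y \<in> hyp3"
  shows "partial_deriv i F y = P1 (cosh_dist x y) * cosh_dist_grad x i y"
  unfolding partial_deriv_eq[OF has_derivative_F[OF y]] by (simp add: axis_def if_distrib cong: if_cong)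

lemma has_derivative_partial_deriv_F:
  assumes y: "y \<in> hyp3"
  shows "(partial_deriv i F has_derivative (\<lambda>v. \<Sum>j\<in>UNIV.
    (P2 (cosh_dist x y) * cosh_dist_grad x i y * cosh_dist_grad x j y + P1 (cosh_dist x y) * cosh_dist_hess x i j y) * v$j)) (at y)"
proof -
  have "((\<lambda>y. P1 (cosh_dist x y)) has_derivative
      (\<lambda>v. P2 (cosh_dist x y) * (\<Sum>i\<in>UNIV. cosh_dist_grad x i y * v$i))) (at y)"
    using has_derivative_compose[OF has_derivative_cosh_dist[OF x y] P1[OF cosh_dist_gt[OF y], unfolded has_field_derivative_def]] .
  from has_derivative_mult[OF this has_derivative_cosh_dist_grad[OF x y, of i]]
  have "((\<lambda>y. P1 (cosh_dist x y) * cosh_dist_grad x i y) has_derivative (\<lambda>v. \<Sum>j\<in>UNIV.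
    (P2 (cosh_dist x y) * cosh_dist_grad x i y * cosh_dist_grad x j y + P1 (cosh_dist x y) * cosh_dist_hess x i j y) * v$j)) (at y)"
    by (rule has_derivative_eq_rhs)
      (simp add: fun_eq_iff sum_distrib_left sum_distrib_right sum.distrib[symmetric] algebra_simps)
  then show ?thesis
    by (rule has_derivative_transform_within_open[OF _ open_hyp3 y]) (simp add: partial_deriv_F)
qed

lemma partial_deriv2_F:
  assumes y: "y \<in> hyp3"
  shows "partial_deriv j (partial_deriv i F) y = P2 (cosh_dist x y) * cosh_dist_grad x i y * cosh_dist_grad x j y
    + P1 (cosh_dist x y) * cosh_dist_hess x i j y"
  unfolding partial_deriv_eq[OF has_derivative_partial_deriv_F[OF y]] by (simp add: axis_def if_distrib cong: if_cong)

lemma differentiable_F: "y \<in> hyp3 \<Longrightarrow> F differentiable (at y)"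
  using has_derivative_F by (auto simp: differentiable_def)

lemma differentiable_partial_deriv_F: "y \<in> hyp3 \<Longrightarrow> partial_deriv i F differentiable (at y)"
  using has_derivative_partial_deriv_F by (auto simp: differentiable_def)

lemma laplace_F:
  assumes k: "k < 0" and y: "y \<in> hyp3"
  shows "laplace_beltrami (hyp3_metric k) F y
    = - k * (((cosh_dist x y)\<^sup>2 - 1) * P2 (cosh_dist x y) + 3 * cosh_dist x y * P1 (cosh_dist x y))"
proof -
  let ?q = "cosh_dist x y"
  have "(y$3)\<^sup>2 * (\<Sum>i\<in>UNIV. partial_deriv i (partial_deriv i F) y) - y$3 * partial_deriv 3 F y
    = P2 ?q * ((y$3)\<^sup>2 * (\<Sum>i\<in>UNIV. (cosh_dist_grad x i y)\<^sup>2))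
      + P1 ?q * ((y$3)\<^sup>2 * (\<Sum>i\<in>UNIV. cosh_dist_hess x i i y) - y$3 * cosh_dist_grad x 3 y)"
    unfolding partial_deriv2_F[OF y] partial_deriv_F[OF y]
    by (simp add: sum.distrib sum_distrib_left algebra_simps power2_eq_square)
  also have "\<dots> = (?q\<^sup>2 - 1) * P2 ?q + 3 * ?q * P1 ?q"
    unfolding cosh_dist_grad_norm[OF x y] cosh_dist_laplace[OF x y] by (simp add: mult_ac)
  finally show ?thesis
    using laplace_hyp3[OF k y differentiable_partial_deriv_F[OF y]] by simp
qed

end

section \<open>The heat equation for the explicit profile in the variable q\<close>

definition heat_profile1 :: "real \<Rightarrow> real \<Rightarrow> real \<Rightarrow> real" where
  "heat_profile1 k t q = heat_kernel_const k t *
    ((rsinh' q + (rsinh q)\<^sup>2 / (k * t)) * exp (arcosh_sq q / (2 * k * t)))"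

definition heat_profile2 :: "real \<Rightarrow> real \<Rightarrow> real \<Rightarrow> real" where
  "heat_profile2 k t q = heat_kernel_const k t *
    ((rsinh'' q + 3 * rsinh q * rsinh' q / (k * t) + (rsinh q) ^ 3 / (k * t)\<^sup>2) * exp (arcosh_sq q / (2 * k * t)))"

lemma DERIV_heat_exp:
  assumes "-1 < q" "k \<noteq> 0" "t \<noteq> 0"
  shows "((\<lambda>q. exp (arcosh_sq q / (2 * k * t))) has_real_derivative
    rsinh q / (k * t) * exp (arcosh_sq q / (2 * k * t))) (at q)"
  using assms by (auto intro!: derivative_eq_intros DERIV_arcosh_sq)

lemma DERIV_heat_profile:
  assumes "-1 < q" "k \<noteq> 0" "t \<noteq> 0"
  shows "(heat_profile k t has_real_derivative heat_profile1 k t q) (at q)"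
proof -
  note [derivative_intros] = DERIV_heat_exp[OF assms] DERIV_rsinh[OF assms(1)]
  have "((\<lambda>q. heat_kernel_const k t * (rsinh q * exp (arcosh_sq q / (2 * k * t)))) has_real_derivative
     heat_kernel_const k t * (rsinh' q * exp (arcosh_sq q / (2 * k * t)) +
       rsinh q / (k * t) * exp (arcosh_sq q / (2 * k * t)) * rsinh q)) (at q)"
    by (intro DERIV_cmult DERIV_mult derivative_intros)
  then show ?thesis unfolding heat_profile_def[abs_def] heat_profile1_def
    by (simp add: algebra_simps power2_eq_square)
qed

lemma DERIV_heat_profile1:
  assumes "-1 < q" "k \<noteq> 0" "t \<noteq> 0"
  shows "(heat_profile1 k t has_real_derivative heat_profile2 k t q) (at q)"
proof -
  let ?E = "\<lambda>q. exp (arcosh_sq q / (2 * k * t))"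
  have "((\<lambda>q. rsinh' q + (rsinh q)\<^sup>2 / (k * t)) has_real_derivative rsinh'' q + 2 * rsinh q * rsinh' q / (k * t)) (at q)"
    using assms by (auto intro!: derivative_eq_intros DERIV_rsinh DERIV_rsinh')
  from DERIV_cmult[OF DERIV_mult[OF this DERIV_heat_exp[OF assms]], of "heat_kernel_const k t"]
  have "(heat_profile1 k t has_real_derivative heat_kernel_const k t *
      ((rsinh'' q + 2 * rsinh q * rsinh' q / (k * t)) * ?E q
        + rsinh q / (k * t) * ?E q * (rsinh' q + (rsinh q)\<^sup>2 / (k * t)))) (at q)"
    unfolding heat_profile1_def[abs_def] .
  moreover have "(rsinh'' q + 2 * rsinh q * rsinh' q / (k * t)) * ?E q
        + rsinh q / (k * t) * ?E q * (rsinh' q + (rsinh q)\<^sup>2 / (k * t))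
      = (rsinh'' q + 3 * rsinh q * rsinh' q / (k * t) + (rsinh q) ^ 3 / (k * t)\<^sup>2) * ?E q"
    using assms by (simp add: field_simps power2_eq_square power3_eq_cube)
  ultimately show ?thesis unfolding heat_profile2_def by simp
qed

text \<open>The left-hand side is the radial Laplacian in curvature -1; multiplied by -k/2, the
  right-hand side is the time derivative found in \<open>DERIV_heat_profile_time\<close>.\<close>

lemma heat_profile_ode:
  assumes "-1 < q" "k \<noteq> 0" "t \<noteq> 0"
  shows "(q\<^sup>2 - 1) * heat_profile2 k t q + 3 * q * heat_profile1 k t q
    = heat_profile k t q * (arcosh_sq q / (k * t)\<^sup>2 + 3 / (k * t) - 1)"
proof -
  \<comment> \<open>A polynomial identity in a. The constant terms agree by
    \<open>rsinh_ode2\<close>, the linear ones by 3 \<open>rsinh q\<close> times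
    \<open>rsinh_ode1\<close>, and the quadratic ones by the form of
    \<open>arcosh_sq\<close>.\<close>
  define a where "a = 1 / (k * t)"
  note ode = rsinh_ode1[OF assms(1)] rsinh_ode2[OF assms(1)]
  have "(q\<^sup>2 - 1) * (rsinh'' q + 3 * rsinh q * rsinh' q * a + (rsinh q) ^ 3 * a\<^sup>2)
     + 3 * q * (rsinh' q + (rsinh q)\<^sup>2 * a) = rsinh q * ((q\<^sup>2 - 1) * (rsinh q)\<^sup>2 * a\<^sup>2 + 3 * a - 1)"
    using ode by algebra
  then have "(q\<^sup>2 - 1) * (rsinh'' q + 3 * rsinh q * rsinh' q / (k * t) + (rsinh q) ^ 3 / (k * t)\<^sup>2)
     + 3 * q * (rsinh' q + (rsinh q)\<^sup>2 / (k * t)) = rsinh q * (arcosh_sq q / (k * t)\<^sup>2 + 3 / (k * t) - 1)"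
    by (simp add: a_def arcosh_sq_def power_divide)
  then show ?thesis
    unfolding heat_profile2_def heat_profile1_def heat_profile_def by algebra
qed

lemma DERIV_heat_kernel_const:
  assumes "0 < t"
  shows "(heat_kernel_const k has_real_derivative heat_kernel_const k t * (k / 2 - 3 / (2 * t))) (at t)"
proof -
  have "((\<lambda>t. exp (k * t / 2)) has_real_derivative k / 2 * exp (k * t / 2)) (at t)"
    by (auto intro!: derivative_eq_intros)
  from DERIV_cdivide[OF DERIV_mult[OF this DERIV_gaussian_const[OF assms]], of "4 * pi"]
  have "((\<lambda>t. exp (k * t / 2) * (2 / (t * sqrt (2 * pi * t))) / (4 * pi)) has_real_derivative
      exp (k * t / 2) * (2 / (t * sqrt (2 * pi * t))) / (4 * pi) * (k / 2 - 3 / (2 * t))) (at t)"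
    by (rule DERIV_cong) (simp add: algebra_simps diff_divide_distrib)
  moreover have "heat_kernel_const k = (\<lambda>t. exp (k * t / 2) * (2 / (t * sqrt (2 * pi * t))) / (4 * pi))"
    unfolding heat_kernel_const_def[abs_def] by (auto simp: field_simps)
  ultimately show ?thesis by (simp only:)
qed

lemma DERIV_heat_profile_time:
  assumes "k \<noteq> 0" "0 < t"
  shows "((\<lambda>t. heat_profile k t q) has_real_derivative
    heat_profile k t q * (k / 2 - 3 / (2 * t) - arcosh_sq q / (2 * k * t\<^sup>2))) (at t)"
proof -
  have "((\<lambda>t. rsinh q * exp (arcosh_sq q / (2 * k * t))) has_real_derivative
     - (arcosh_sq q / (2 * k * t\<^sup>2)) * (rsinh q * exp (arcosh_sq q / (2 * k * t)))) (at t)"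
    using assms by (auto intro!: derivative_eq_intros simp: field_simps power2_eq_square)
  from DERIV_mult[OF DERIV_heat_kernel_const[OF assms(2), of k] this] show ?thesis
    unfolding heat_profile_def by (rule DERIV_cong) (simp add: algebra_simps)
qed


section \<open>The explicit kernel is a fundamental solution\<close>

lemma heat_radial_function:
  assumes "x \<in> hyp3" "k < 0" "0 < t"
  shows "radial_function x (heat_profile k t) (heat_profile1 k t) (heat_profile2 k t)"
  using assms by unfold_locales (auto intro!: DERIV_heat_profile DERIV_heat_profile1)

lemma heat_kernel_eq: "heat_kernel k x t = (\<lambda>y. heat_profile k t (cosh_dist x y))"
  by (simp add: fun_eq_iff heat_kernel_def)

lemma continuous_on_heat_kernel_const:
  assumes "continuous_on S a" "\<And>z. z \<in> S \<Longrightarrow> 0 < a z"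
  shows "continuous_on S (\<lambda>z. heat_kernel_const k (a z))"
  unfolding heat_kernel_const_def using assms by (intro continuous_intros) (auto simp: less_imp_neq[symmetric])

lemma continuous_on_heat_profiles:
  assumes a: "continuous_on S a" and a0: "\<And>z. z \<in> S \<Longrightarrow> 0 < a z" and k: "k < 0"
    and b: "continuous_on S b" and b0: "\<And>z. z \<in> S \<Longrightarrow> -1 < b z"
  shows "continuous_on S (\<lambda>z. heat_profile k (a z) (b z))"
    and "continuous_on S (\<lambda>z. heat_profile1 k (a z) (b z))"
    and "continuous_on S (\<lambda>z. heat_profile2 k (a z) (b z))"
proof -
  have n: "k * a z \<noteq> 0" "2 * k * a z \<noteq> 0" "(k * a z)\<^sup>2 \<noteq> 0" if "z \<in> S" for z using a0[OF that] k by auto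
  have c: "continuous_on S (\<lambda>z. rsinh (b z))" "continuous_on S (\<lambda>z. rsinh' (b z))"
    "continuous_on S (\<lambda>z. rsinh'' (b z))" "continuous_on S (\<lambda>z. arcosh_sq (b z))"
    using b b0 by (auto intro!: continuous_on_compose2[OF continuous_on_rsinh]
      continuous_on_compose2[OF continuous_on_rsinh'] continuous_on_compose2[OF continuous_on_rsinh'']
      continuous_on_compose2[OF continuous_on_arcosh_sq])
  show "continuous_on S (\<lambda>z. heat_profile k (a z) (b z))"
    and "continuous_on S (\<lambda>z. heat_profile1 k (a z) (b z))"
    and "continuous_on S (\<lambda>z. heat_profile2 k (a z) (b z))"
    unfolding heat_profile_def heat_profile1_def heat_profile2_def
    by (intro continuous_intros a c continuous_on_heat_kernel_const ballI n a0; assumption)+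
qed

lemma heat_kernel_time_derivative:
  assumes "k < 0" "0 < t"
  shows "((\<lambda>s. heat_kernel k x s y) has_real_derivative heat_profile k t (cosh_dist x y) *
    (k / 2 - 3 / (2 * t) - arcosh_sq (cosh_dist x y) / (2 * k * t\<^sup>2))) (at t)"
  unfolding heat_kernel_def by (rule DERIV_heat_profile_time) (use assms in auto)

lemma heat_kernel_C12:
  assumes k: "k < 0" and x: "x \<in> hyp3"
  shows "C12_on hyp3 (heat_kernel k x)"
proof -
  let ?T = "{0::real<..} \<times> hyp3"
  have q: "continuous_on ?T (\<lambda>z. cosh_dist x (snd z))"
    by (rule continuous_on_compose2[OF continuous_on_cosh_dist[OF x]]) (auto intro!: continuous_intros)
  have g: "continuous_on ?T (\<lambda>z. cosh_dist_grad x i (snd z))" for i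
    by (rule continuous_on_compose2[OF continuous_on_cosh_dist_grad[OF x]]) (auto intro!: continuous_intros)
  have h: "continuous_on ?T (\<lambda>z. cosh_dist_hess x i j (snd z))" for i j
    by (rule continuous_on_compose2[OF continuous_on_cosh_dist_hess[OF x]]) (auto intro!: continuous_intros)
  have q1: "-1 < cosh_dist x (snd z)" if "z \<in> ?T" for z
    using cosh_dist_ge_1[OF x, of "snd z"] that by auto
  have "continuous_on ?T fst" "\<And>z. z \<in> ?T \<Longrightarrow> 0 < fst z" by (auto intro!: continuous_intros)
  note c = continuous_on_heat_profiles[OF this k q q1]
  have W: "continuous_on ?T (\<lambda>z. arcosh_sq (cosh_dist x (snd z)))"
    by (rule continuous_on_compose2[OF continuous_on_arcosh_sq q]) (use q1 in auto)
  show ?thesis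
    unfolding C12_on_def
  proof (intro conjI allI impI ballI)
    fix t :: real and y :: "real^3" and i assume t: "0 < t" and y: "y \<in> hyp3"
    interpret radial_function x "heat_profile k t" "heat_profile1 k t" "heat_profile2 k t"
      by (rule heat_radial_function[OF x k t])
    show "(\<lambda>s. heat_kernel k x s y) differentiable at t"
      using heat_kernel_time_derivative[OF k t] by (auto simp: real_differentiable_def)
    show "heat_kernel k x t differentiable at y"
      unfolding heat_kernel_eq by (rule differentiable_F[OF y])
    show "partial_deriv i (heat_kernel k x t) differentiable at y"
      unfolding heat_kernel_eq by (rule differentiable_partial_deriv_F[OF y])
  next
    show "continuous_on ?T (\<lambda>(t, y). heat_kernel k x t y)"
      using c(1) by (simp add: split_beta heat_kernel_def)
    have "continuous_on ?T (\<lambda>z. heat_profile k (fst z) (cosh_dist x (snd z)) *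
        (k / 2 - 3 / (2 * fst z) - arcosh_sq (cosh_dist x (snd z)) / (2 * k * (fst z)\<^sup>2)))"
      using k by (intro continuous_intros c W) auto
    then show "continuous_on ?T (\<lambda>(t, y). deriv (\<lambda>s. heat_kernel k x s y) t)"
      by (rule continuous_on_eq) (auto simp: DERIV_imp_deriv[OF heat_kernel_time_derivative[OF k]])
  next
    fix i
    have "continuous_on ?T (\<lambda>z. heat_profile1 k (fst z) (cosh_dist x (snd z)) * cosh_dist_grad x i (snd z))"
      by (intro continuous_intros c g)
    then show "continuous_on ?T (\<lambda>(t, y). partial_deriv i (heat_kernel k x t) y)"
      by (rule continuous_on_eq)
        (auto simp: heat_kernel_eq radial_function.partial_deriv_F[OF heat_radial_function[OF x k]])
  next
    fix i j
    have "continuous_on ?T (\<lambda>z. heat_profile2 k (fst z) (cosh_dist x (snd z)) * cosh_dist_grad x i (snd z) * cosh_dist_grad x j (snd z)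
        + heat_profile1 k (fst z) (cosh_dist x (snd z)) * cosh_dist_hess x i j (snd z))"
      by (intro continuous_intros c g h)
    then show "continuous_on ?T (\<lambda>(t, y). partial_deriv j (partial_deriv i (heat_kernel k x t)) y)"
      by (rule continuous_on_eq)
        (auto simp: heat_kernel_eq radial_function.partial_deriv2_F[OF heat_radial_function[OF x k]])
  qed
qed

lemma heat_kernel_heat_equation:
  assumes k: "k < 0" and x: "x \<in> hyp3" and t: "0 < t" and y: "y \<in> hyp3"
  shows "deriv (\<lambda>s. heat_kernel k x s y) t = 1 / 2 * laplace_beltrami (hyp3_metric k) (heat_kernel k x t) y"
proof -
  let ?q = "cosh_dist x y"
  interpret radial_function x "heat_profile k t" "heat_profile1 k t" "heat_profile2 k t"
    by (rule heat_radial_function[OF x k t])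
  have "1 / 2 * laplace_beltrami (hyp3_metric k) (heat_kernel k x t) y
      = - k / 2 * (heat_profile k t ?q * (arcosh_sq ?q / (k * t)\<^sup>2 + 3 / (k * t) - 1))"
    unfolding heat_kernel_eq laplace_F[OF k y] using k t
    by (subst heat_profile_ode[OF cosh_dist_gt[OF y]]) auto
  also have "\<dots> = heat_profile k t ?q * (k / 2 - 3 / (2 * t) - arcosh_sq ?q / (2 * k * t\<^sup>2))"
    using k t by (simp add: field_simps power2_eq_square)
  finally show ?thesis
    unfolding DERIV_imp_deriv[OF heat_kernel_time_derivative[OF k t]] by simp
qed

lemma positive_fundamental_solution_heat_kernel:
  assumes k: "k < 0" and x: "x \<in> hyp3"
  shows "positive_fundamental_solution hyp3 (hyp3_metric k) x (heat_kernel k x)"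
  unfolding positive_fundamental_solution_def
  using heat_kernel_pos[OF _ x] heat_kernel_C12[OF k x] heat_kernel_heat_equation[OF k x]
    heat_kernel_initial[OF k x] by blast

section \<open>Integrals of compactly supported partial derivatives\<close>

lemma partial_deriv_outside_support:
  fixes F :: "real^'n::finite \<Rightarrow> real"
  assumes "closed K" "\<And>y. y \<notin> K \<Longrightarrow> F y = 0" "y \<notin> K"
  shows "F differentiable (at y)" "partial_deriv i F y = 0"
proof -
  have "(F has_derivative (\<lambda>_. 0)) (at y)"
    by (rule has_derivative_transform_within_open[where f="\<lambda>_. 0" and s="- K"]) (use assms in auto)
  then show "F differentiable (at y)" "partial_deriv i F y = 0"
    by (auto simp: differentiable_def partial_deriv_eq)
qed

text \<open>Differentiate the integral of \<open>F (y + s *\<^sub>R axis i 1)\<close> in \<open>s\<close>: by translation invariance it is constant.\<close>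

lemma integral_partial_deriv_eq_0:
  fixes F :: "real^'n::finite \<Rightarrow> real"
  assumes K: "compact K" "K \<subseteq> U" and F0: "\<And>y. y \<notin> K \<Longrightarrow> F y = 0"
    and diff: "\<And>y. y \<in> U \<Longrightarrow> F differentiable (at y)"
    and cont: "continuous_on U (partial_deriv i F)"
  shows "(\<integral>y. partial_deriv i F y \<partial>lborel) = 0"
proof -
  let ?D = "partial_deriv i F" and ?e = "axis i 1 :: real^'n"
  have cl: "closed K" using K by (simp add: compact_imp_closed)
  have D0: "?D y = 0" if "y \<notin> K" for y
    using partial_deriv_outside_support[OF cl F0 that] by auto
  have dF: "F differentiable (at y)" for y
  proof (cases "y \<in> K")
    case True
    then show ?thesis using diff K(2) by blast
  next
    case False
    show ?thesis by (rule partial_deriv_outside_support(1)[OF cl F0 False])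
  qed
  have Fc: "continuous_on K F"
    using dF by (meson continuous_at_imp_continuous_on differentiable_imp_continuous_within)
  have Dc: "continuous_on K ?D" using cont K(2) by (rule continuous_on_subset)
  \<comment> \<open>Measurability on the whole space comes from continuity on K together with
    vanishing off K.\<close>
  have ind: "g = (\<lambda>y. indicator K y *\<^sub>R g y)" if "\<And>y. y \<notin> K \<Longrightarrow> g y = 0" for g :: "real^'n \<Rightarrow> real"
    using that by (auto simp: fun_eq_iff indicator_def)
  have m: "F \<in> borel_measurable borel" "?D \<in> borel_measurable borel"
    by (subst ind, erule F0 D0,
        rule borel_measurable_continuous_on_indicator[OF borel_closed[OF cl]], rule Fc Dc)+
  note [measurable] = m
  have "\<exists>B. \<forall>y\<in>K. \<bar>?D y\<bar> \<le> B" "\<exists>B. \<forall>y\<in>K. \<bar>F y\<bar> \<le> B"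
    using compact_imp_bounded[OF compact_continuous_image[OF Dc K(1)]]
      compact_imp_bounded[OF compact_continuous_image[OF Fc K(1)]] by (auto simp: bounded_iff)
  then obtain B0 B1 where B0: "\<And>y. y \<in> K \<Longrightarrow> \<bar>?D y\<bar> \<le> B0" "\<And>y. y \<in> K \<Longrightarrow> \<bar>F y\<bar> \<le> B1" by blast
  define B where "B = max 0 (max B0 B1)"
  have B: "0 \<le> B" "\<bar>?D y\<bar> \<le> B" "\<bar>F y\<bar> \<le> B" for y
    using B0[of y] D0[of y] F0[of y] unfolding B_def by (cases "y \<in> K"; auto)+
  obtain r where r: "\<And>y. y \<in> K \<Longrightarrow> norm y \<le> r"
    using compact_imp_bounded[OF K(1)] by (auto simp: bounded_iff)
  \<comment> \<open>K lies in the ball of radius r, so all translates with |s| < 1 are supported in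
    the ball of radius r + 1.\<close>
  let ?w = "\<lambda>y. B * indicator (cball 0 (r + 1)) y :: real"
  have w: "integrable lborel ?w"
    by (intro integrable_mult_right integrable_real_indicator emeasure_bounded_finite) auto
  have inball: "y \<in> cball 0 (r + 1)" if "s \<in> {-1<..<1}" "y + s *\<^sub>R ?e \<in> K" for s y
  proof -
    have "norm y \<le> norm (y + s *\<^sub>R ?e) + norm (s *\<^sub>R ?e)"
      using norm_triangle_ineq4[of "y + s *\<^sub>R ?e" "s *\<^sub>R ?e"] by simp
    then show ?thesis using r[OF that(2)] that(1) by auto
  qed
  have le: "\<bar>g (y + s *\<^sub>R ?e)\<bar> \<le> ?w y"
    if "s \<in> {-1<..<1}" "\<And>y. \<bar>g y\<bar> \<le> B" "\<And>y. y \<notin> K \<Longrightarrow> g y = 0" for g y s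
    using that(2)[of "y + s *\<^sub>R ?e"] that(3)[of "y + s *\<^sub>R ?e"] inball[OF that(1), of y] B(1)
    by (cases "y + s *\<^sub>R ?e \<in> K") (auto simp: indicator_def)
  have int: "integrable lborel (\<lambda>y. F (y + s *\<^sub>R ?e))" if "s \<in> {-1<..<1}" for s
  proof (rule Bochner_Integration.integrable_bound[OF w])
    show "AE y in lborel. norm (F (y + s *\<^sub>R ?e)) \<le> norm (?w y)"
      using le[OF that B(3) F0] B(1) by (intro AE_I2) (auto simp: abs_mult intro: order_trans)
  qed measurable
  have "((\<lambda>s. \<integral>y. F (y + s *\<^sub>R ?e) \<partial>lborel) has_real_derivative
      (\<integral>y. ?D (y + 0 *\<^sub>R ?e) \<partial>lborel)) (at 0)"
  proof (rule has_real_derivative_integral[where a="-1" and b=1 and w="?w"])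
    fix s y assume "s \<in> {-1<..<1::real}"
    then show "\<bar>?D (y + s *\<^sub>R ?e)\<bar> \<le> ?w y" by (rule le[OF _ B(2) D0])
    show "((\<lambda>s. F (y + s *\<^sub>R ?e)) has_real_derivative ?D (y + s *\<^sub>R ?e)) (at s)"
      by (rule partial_deriv_along_axis[OF dF])
  qed (use int w m in simp_all)
  moreover have "(\<integral>y. F (y + s *\<^sub>R ?e) \<partial>lborel) = (\<integral>y. F y \<partial>lborel)" for s
  proof -
    have "(\<integral>y. F y \<partial>lborel) = (\<integral>y. F y \<partial>distr lborel borel ((+) (s *\<^sub>R ?e)))"
      by (simp only: lborel_distr_plus)
    also have "\<dots> = (\<integral>y. F (y + s *\<^sub>R ?e) \<partial>lborel)"
      by (subst integral_distr) (auto simp: add.commute)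
    finally show ?thesis ..
  qed
  ultimately have "((\<lambda>s. \<integral>y. F y \<partial>lborel) has_real_derivative (\<integral>y. ?D y \<partial>lborel)) (at (0::real))"
    by simp
  from DERIV_unique[OF this DERIV_const] show ?thesis .
qed


section \<open>Green's identity\<close>

lemma integrable_hyp3_compact_support:
  fixes g :: "real^3 \<Rightarrow> real"
  assumes k: "k < 0" and g: "continuous_on hyp3 g"
    and K: "compact K" "K \<subseteq> hyp3" "\<And>y. y \<in> hyp3 - K \<Longrightarrow> g y = 0"
  shows "integrable (hyp3_volume k) g"
    and "(\<integral>y. g y \<partial>hyp3_volume k) = (\<integral>y. indicator hyp3 y * (1 / (- k * sqrt (- k)) / (y$3) ^ 3 * g y) \<partial>lborel)"
proof -
  let ?r = "\<lambda>y. 1 / (- k * sqrt (- k)) / (y$3) ^ 3 :: real"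
  have C: "0 < 1 / (- k * sqrt (- k))" using k by (intro divide_pos_pos mult_pos_pos) auto
  have "measurable (restrict_space lborel hyp3) borel = measurable (restrict_space borel hyp3) (borel :: real measure)"
    by (rule measurable_cong_sets) (auto intro!: sets_restrict_space_cong)
  then have gm: "g \<in> borel_measurable (restrict_space lborel hyp3)"
    using borel_measurable_continuous_on_restrict[OF g] by blast
  have rm: "?r \<in> borel_measurable (restrict_space lborel hyp3)"
    by (rule measurable_restrict_space1) measurable
  have r0: "AE y in restrict_space lborel hyp3. 0 \<le> ?r y"
    by (intro AE_I2 divide_nonneg_nonneg less_imp_le[OF C]) (auto simp: space_restrict_space hyp3_def)
  have c: "continuous_on K (\<lambda>y. ?r y * g y)"
    using k K(2) by (intro continuous_intros continuous_on_subset[OF g]) (auto simp: hyp3_def)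
  have "integrable lborel (\<lambda>y. indicator K y *\<^sub>R (?r y * g y))"
    using borel_integrable_compact[OF K(1) c] .
  moreover have "indicator K y *\<^sub>R (?r y * g y) = indicator hyp3 y *\<^sub>R (?r y *\<^sub>R g y)" for y
    using K(2,3) by (auto simp: indicator_def)
  ultimately have "integrable lborel (\<lambda>y. indicator hyp3 y *\<^sub>R (?r y *\<^sub>R g y))"
    by (simp only:)
  then have "integrable (restrict_space lborel hyp3) (\<lambda>y. ?r y *\<^sub>R g y)"
    by (subst integrable_restrict_space) auto
  then show "integrable (hyp3_volume k) g"
    unfolding hyp3_volume_eq[OF k] using integrable_density[OF gm rm r0] by blast
  show "(\<integral>y. g y \<partial>hyp3_volume k) = (\<integral>y. indicator hyp3 y * (?r y * g y) \<partial>lborel)"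
    unfolding hyp3_volume_eq[OF k] integral_density[OF gm rm r0]
    by (subst integral_restrict_space) auto
qed

definition C2_on :: "(real^'n::finite) set \<Rightarrow> (real^'n \<Rightarrow> real) \<Rightarrow> bool" where
  "C2_on U f \<longleftrightarrow> (\<forall>y\<in>U. f differentiable (at y)) \<and>
    (\<forall>i. \<forall>y\<in>U. partial_deriv i f differentiable (at y)) \<and>
    (\<forall>i j. continuous_on U (partial_deriv j (partial_deriv i f)))"

lemma C2_onD:
  assumes "C2_on U f"
  shows "y \<in> U \<Longrightarrow> f differentiable (at y)"
    and "y \<in> U \<Longrightarrow> partial_deriv i f differentiable (at y)"
    and "continuous_on U f" and "continuous_on U (partial_deriv i f)"
    and "continuous_on U (partial_deriv j (partial_deriv i f))"
  using assms unfolding C2_on_def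
  by (auto intro!: continuous_at_imp_continuous_on differentiable_imp_continuous_within)

lemma C12_on_slice:
  assumes "C12_on U u" "0 < t"
  shows "C2_on U (u t)" and "continuous_on U (\<lambda>y. deriv (\<lambda>s. u s y) t)"
proof -
  have p: "continuous_on U (Pair t)" by (intro continuous_intros)
  have s: "continuous_on U (\<lambda>y. f t y)" if "continuous_on ({0<..} \<times> U) (\<lambda>(t, y). f t y)" for f :: "real \<Rightarrow> _ \<Rightarrow> real"
    using continuous_on_compose2[OF that p] assms(2) by auto
  show "C2_on U (u t)" "continuous_on U (\<lambda>y. deriv (\<lambda>s. u s y) t)"
    using assms s[of "\<lambda>t. partial_deriv j (partial_deriv i (u t))" for i j] s[of "\<lambda>t y. deriv (\<lambda>s. u s y) t"]
    unfolding C12_on_def C2_on_def by simp_all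
qed

lemma continuous_on_laplace_hyp3:
  assumes "k < 0" "C2_on hyp3 f"
  shows "continuous_on hyp3 (laplace_beltrami (hyp3_metric k) f)"
proof -
  have "continuous_on hyp3 (\<lambda>y. - k * ((y$3)\<^sup>2 * (\<Sum>i\<in>UNIV. partial_deriv i (partial_deriv i f) y) - y$3 * partial_deriv 3 f y))"
    by (intro continuous_intros C2_onD[OF assms(2)])
  then show ?thesis
    by (rule continuous_on_eq) (simp add: laplace_hyp3[OF assms(1) _ C2_onD(2)[OF assms(2)]])
qed

lemma C2_on_outside_support:
  assumes U: "open U" and K: "compact K" "\<And>y. y \<in> U - K \<Longrightarrow> f y = 0" and y: "y \<in> U - K"
  shows "partial_deriv i f y = 0" and "partial_deriv j (partial_deriv i f) y = 0"
proof -
  have op: "open (U - K)" using U K(1) by (simp add: open_Diff compact_imp_closed)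
  have 0: "(g has_derivative (\<lambda>_. 0)) (at z)" if "\<And>z. z \<in> U - K \<Longrightarrow> g z = 0" "z \<in> U - K" for g :: "real^'a \<Rightarrow> real" and z
    by (rule has_derivative_transform_within_open[where f="\<lambda>_. 0", OF _ op that(2)]) (use that(1) in auto)
  have 1: "partial_deriv i f z = 0" if "z \<in> U - K" for z
    using partial_deriv_eq[OF 0[OF K(2) that]] .
  show "partial_deriv i f y = 0" by (rule 1[OF y])
  show "partial_deriv j (partial_deriv i f) y = 0"
    using partial_deriv_eq[OF 0[OF 1 y]] .
qed

text \<open>The density \<open>f * Lw - w * Lf\<close> is a divergence.\<close>

lemma laplace_hyp3_symmetric:
  assumes k: "k < 0" and w: "C2_on hyp3 w" and f: "C2_on hyp3 f"
    and K: "compact K" "K \<subseteq> hyp3" "\<And>y. y \<in> hyp3 - K \<Longrightarrow> f y = 0"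
  shows "(\<integral>y. laplace_beltrami (hyp3_metric k) w y * f y \<partial>hyp3_volume k)
    = (\<integral>y. w y * laplace_beltrami (hyp3_metric k) f y \<partial>hyp3_volume k)"
proof -
  let ?L = "laplace_beltrami (hyp3_metric k)"
  have f0: "partial_deriv i f y = 0" "partial_deriv j (partial_deriv i f) y = 0" if "y \<in> hyp3 - K" for i j y
    by (rule C2_on_outside_support[OF open_hyp3 K(1) _ that], rule K(3), assumption)+
  have Lf0: "?L f y = 0" if "y \<in> hyp3 - K" for y
    using that laplace_hyp3[OF k _ C2_onD(2)[OF f], of y] by (simp add: f0[OF that])
  \<comment> \<open>The components of f grad w - w grad f with the weight 1 / y_3, which is the
    volume density times the inverse metric up to a constant. Extension by 0 makes G a function on
    all of space that vanishes off K, as \<open>integral_partial_deriv_eq_0\<close> asks.\<close>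
  define G where "G i y = (if y \<in> hyp3 then (f y * partial_deriv i w y - w y * partial_deriv i f y) / y$3 else 0)" for i y
  have G0: "G i y = 0" if "y \<notin> K" for i y
    using that K(3) f0(1) by (auto simp: G_def)
  have dG: "\<exists>G'. (G i has_derivative G') (at y) \<and> G' (axis i 1)
      = (f y * partial_deriv i (partial_deriv i w) y - w y * partial_deriv i (partial_deriv i f) y) / y$3
        - (if i = 3 then (f y * partial_deriv i w y - w y * partial_deriv i f y) / (y$3)\<^sup>2 else 0)"
    if y: "y \<in> hyp3" for i y
  proof -
    obtain w' f' w'' f'' where d: "(w has_derivative w') (at y)" "(f has_derivative f') (at y)"
      "(partial_deriv i w has_derivative w'') (at y)" "(partial_deriv i f has_derivative f'') (at y)"
      using C2_onD(1,2)[OF w y] C2_onD(1,2)[OF f y] unfolding differentiable_def by metis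
    have y3: "y$3 \<noteq> 0" using y by (simp add: hyp3_def)
    let ?g = "\<lambda>y. (f y * partial_deriv i w y - w y * partial_deriv i f y) / y$3"
    let ?g' = "\<lambda>v. ((f y * w'' v + f' v * partial_deriv i w y - (w y * f'' v + w' v * partial_deriv i f y)) * y$3
        - (f y * partial_deriv i w y - w y * partial_deriv i f y) * v$3) / (y$3 * y$3)"
    have "(?g has_derivative ?g') (at y)"
      by (intro has_derivative_divide' has_derivative_diff has_derivative_mult d has_derivative_vec_nth y3)
    then have "(G i has_derivative ?g') (at y)"
      by (rule has_derivative_transform_within_open[OF _ open_hyp3 y]) (simp add: G_def)
    moreover have "?g' (axis i 1) = (f y * partial_deriv i (partial_deriv i w) y - w y * partial_deriv i (partial_deriv i f) y) / y$3
        - (if i = 3 then ?g y / y$3 else 0)"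
      using y3 unfolding partial_deriv_eq[OF d(1)] partial_deriv_eq[OF d(2)] partial_deriv_eq[OF d(3)] partial_deriv_eq[OF d(4)]
      by (auto simp: axis_def field_simps)
    ultimately show ?thesis by (auto simp: power2_eq_square)
  qed
  have pG: "partial_deriv i (G i) y
      = (f y * partial_deriv i (partial_deriv i w) y - w y * partial_deriv i (partial_deriv i f) y) / y$3
        - (if i = 3 then (f y * partial_deriv i w y - w y * partial_deriv i f y) / (y$3)\<^sup>2 else 0)"
    if y: "y \<in> hyp3" for i y
    using dG[OF y, of i] partial_deriv_eq by metis
  have cG: "continuous_on hyp3 (partial_deriv i (G i))" for i
  proof -
    have "continuous_on hyp3 (\<lambda>y. (f y * partial_deriv i (partial_deriv i w) y - w y * partial_deriv i (partial_deriv i f) y) / y$3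
        - of_bool (i = 3) * ((f y * partial_deriv i w y - w y * partial_deriv i f y) / (y$3)\<^sup>2))"
      by (intro continuous_intros C2_onD[OF w] C2_onD[OF f]) (auto simp: hyp3_def)
    then show ?thesis by (rule continuous_on_eq) (simp add: pG)
  qed
  have diffG: "G i differentiable (at y)" if "y \<in> hyp3" for i y
    using dG[OF that, of i] by (auto simp: differentiable_def)
  have int0: "(\<integral>y. partial_deriv i (G i) y \<partial>lborel) = 0" for i
    by (rule integral_partial_deriv_eq_0[OF K(1,2) G0 diffG cG])
  have outK: "partial_deriv i (G i) y = 0" if "y \<notin> K" for i y
    using partial_deriv_outside_support(2)[OF compact_imp_closed[OF K(1)] G0 that] .
  have "integrable lborel (\<lambda>y. indicator K y *\<^sub>R partial_deriv i (G i) y)" for i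
    by (rule borel_integrable_compact[OF K(1) continuous_on_subset[OF cG K(2)]])
  moreover have "indicator K y *\<^sub>R partial_deriv i (G i) y = partial_deriv i (G i) y" for i y
    using outK by (auto simp: indicator_def)
  ultimately have intG: "integrable lborel (partial_deriv i (G i))" for i by (simp only:)
  define c where "c = 1 / (- k * sqrt (- k))"
  have sum: "(\<Sum>i\<in>UNIV. partial_deriv i (G i) y) = (?L w y * f y - w y * ?L f y) / (- k * (y$3) ^ 3)"
    if y: "y \<in> hyp3" for y
  proof -
    have y3: "y$3 \<noteq> 0" using y by (simp add: hyp3_def)
    have "(\<Sum>i\<in>UNIV. partial_deriv i (G i) y)
      = (f y * (\<Sum>i\<in>UNIV. partial_deriv i (partial_deriv i w) y) - w y * (\<Sum>i\<in>UNIV. partial_deriv i (partial_deriv i f) y)) / y$3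
        - (f y * partial_deriv 3 w y - w y * partial_deriv 3 f y) / (y$3)\<^sup>2"
      by (simp add: pG[OF y] sum_subtractf sum_distrib_left sum_divide_distrib[symmetric])
    also have "\<dots> = (?L w y * f y - w y * ?L f y) / (- k * (y$3) ^ 3)"
      unfolding laplace_hyp3[OF k y C2_onD(2)[OF f y]] laplace_hyp3[OF k y C2_onD(2)[OF w y]]
      using k y3 by (simp add: field_simps power2_eq_square power3_eq_cube)
    finally show ?thesis .
  qed
  have eq: "indicator hyp3 y * (c / (y$3) ^ 3 * (?L w y * f y - w y * ?L f y))
      = (- k * c) * (\<Sum>i\<in>UNIV. partial_deriv i (G i) y)" for y
  proof (cases "y \<in> hyp3")
    case True
    then show ?thesis using k by (simp add: sum)
  next
    case False
    then have "y \<notin> K" using K(2) by auto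
    then show ?thesis using False by (simp add: outK)
  qed
  have 0: "(\<integral>y. indicator hyp3 y * (c / (y$3) ^ 3 * (?L w y * f y - w y * ?L f y)) \<partial>lborel) = 0"
    unfolding eq using intG int0 by simp
  have cont: "continuous_on hyp3 (\<lambda>y. ?L w y * f y)" "continuous_on hyp3 (\<lambda>y. w y * ?L f y)"
    by (intro continuous_intros continuous_on_laplace_hyp3[OF k] C2_onD[OF w] C2_onD[OF f] w f)+
  have "integrable (hyp3_volume k) (\<lambda>y. ?L w y * f y)" "integrable (hyp3_volume k) (\<lambda>y. w y * ?L f y)"
    by (rule integrable_hyp3_compact_support(1)[OF k _ K(1,2)], rule cont, simp add: K(3) Lf0)+
  moreover have "(\<integral>y. ?L w y * f y - w y * ?L f y \<partial>hyp3_volume k) = 0"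
    using 0 unfolding c_def
    by (subst integrable_hyp3_compact_support(2)[OF k continuous_on_diff[OF cont] K(1,2)])
      (simp_all add: K(3) Lf0)
  ultimately show ?thesis by simp
qed


section \<open>Uniqueness below the explicit kernel\<close>

text \<open>On the compact set [t/2, 2t] x K the time derivative of u is bounded, which permits
  differentiation under the integral. The heat equation and the symmetry of the Laplacian then move
  all space derivatives onto f.\<close>

lemma heat_solution_tested_DERIV:
  assumes k: "k < 0" and u: "C12_on hyp3 u"
    and eq: "\<And>t y. 0 < t \<Longrightarrow> y \<in> hyp3 \<Longrightarrow>
      deriv (\<lambda>s. u s y) t = 1 / 2 * laplace_beltrami (hyp3_metric k) (u t) y"
    and f: "C2_on hyp3 f"
    and K: "compact K" "K \<subseteq> hyp3" "\<And>y. y \<in> hyp3 - K \<Longrightarrow> f y = 0"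
    and t: "0 < t"
  shows "((\<lambda>s. \<integral>y. u s y * f y \<partial>hyp3_volume k) has_real_derivative
    1 / 2 * (\<integral>y. u t y * laplace_beltrami (hyp3_metric k) f y \<partial>hyp3_volume k)) (at t)"
proof -
  let ?D = "\<lambda>s y. deriv (\<lambda>s. u s y) s"
  have fc: "continuous_on hyp3 f" by (rule C2_onD(3)[OF f])
  have "continuous_on ({t/2..2*t} \<times> K) (\<lambda>(s, y). ?D s y)"
    using u t K(2) unfolding C12_on_def by (auto elim!: continuous_on_subset)
  from compact_imp_bounded[OF compact_continuous_image[OF this compact_Times[OF compact_Icc K(1)]]]
  have "\<exists>B. \<forall>s\<in>{t/2..2*t}. \<forall>y\<in>K. \<bar>?D s y\<bar> \<le> B"
    by (auto simp: bounded_iff)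
  then obtain B where B: "\<And>s y. s \<in> {t/2..2*t} \<Longrightarrow> y \<in> K \<Longrightarrow> \<bar>?D s y\<bar> \<le> B" by blast
  have "((\<lambda>s. \<integral>y. u s y * f y \<partial>hyp3_volume k) has_real_derivative
      (\<integral>y. ?D t y * f y \<partial>hyp3_volume k)) (at t)"
  proof (rule has_real_derivative_integral[where a="t/2" and b="2*t" and w="\<lambda>y. B * \<bar>f y\<bar>"])
    show "t \<in> {t / 2<..<2 * t}" using t by simp
    fix s assume s: "s \<in> {t / 2<..<2 * t}"
    then have s0: "0 < s" using t by auto
    show "integrable (hyp3_volume k) (\<lambda>y. u s y * f y)"
      using C2_onD(3)[OF C12_on_slice(1)[OF u s0]] fc K
      by (intro integrable_hyp3_compact_support(1)[OF k _ K(1,2)] continuous_intros) auto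
    fix y assume "y \<in> space (hyp3_volume k)"
    then have y: "y \<in> hyp3" by (simp add: space_hyp3_volume)
    have "(\<lambda>s. u s y) differentiable (at s)" using u s0 y unfolding C12_on_def by auto
    then have "((\<lambda>s. u s y) has_real_derivative ?D s y) (at s)"
      using DERIV_deriv_iff_real_differentiable by blast
    then show "((\<lambda>s. u s y * f y) has_real_derivative ?D s y * f y) (at s)"
      by (rule DERIV_cmult_right)
    show "\<bar>?D s y * f y\<bar> \<le> B * \<bar>f y\<bar>"
    proof (cases "y \<in> K")
      case True
      then show ?thesis using B[of s y] s by (simp add: abs_mult mult_right_mono)
    qed (use K(3) y in auto)
  next
    show "integrable (hyp3_volume k) (\<lambda>y. B * \<bar>f y\<bar>)"
      using fc K by (intro integrable_hyp3_compact_support(1)[OF k _ K(1,2)] continuous_intros) auto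
    have "integrable (hyp3_volume k) (\<lambda>y. ?D t y * f y)"
      using C12_on_slice(2)[OF u t] fc K
      by (intro integrable_hyp3_compact_support(1)[OF k _ K(1,2)] continuous_intros) auto
    then show "(\<lambda>y. ?D t y * f y) \<in> borel_measurable (hyp3_volume k)" by auto
  qed
  moreover have "(\<integral>y. ?D t y * f y \<partial>hyp3_volume k)
      = (\<integral>y. 1 / 2 * (laplace_beltrami (hyp3_metric k) (u t) y * f y) \<partial>hyp3_volume k)"
    by (rule Bochner_Integration.integral_cong) (simp_all add: space_hyp3_volume eq[OF t])
  moreover have "\<dots> = 1 / 2 * (\<integral>y. u t y * laplace_beltrami (hyp3_metric k) f y \<partial>hyp3_volume k)"
    by (subst laplace_hyp3_symmetric[OF k C12_on_slice(1)[OF u t] f K(1,2), symmetric]) (auto simp: K(3))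
  ultimately show ?thesis by simp
qed

text \<open>The cube is the least power of the positive part that is twice continuously
  differentiable. Being a function of q / R, it loses a factor 1/R with each derivative.\<close>

definition cutoff :: "real \<Rightarrow> real \<Rightarrow> real" where
  "cutoff R q = (max 0 (1 - q / R)) ^ 3"

definition cutoff1 :: "real \<Rightarrow> real \<Rightarrow> real" where
  "cutoff1 R q = - 3 / R * (max 0 (1 - q / R))\<^sup>2"

definition cutoff2 :: "real \<Rightarrow> real \<Rightarrow> real" where
  "cutoff2 R q = 6 / R\<^sup>2 * max 0 (1 - q / R)"

lemma DERIV_max_0_power:
  "((\<lambda>s. (max 0 s) ^ Suc (Suc n)) has_real_derivative real (Suc (Suc n)) * (max 0 s) ^ Suc n) (at s)"
proof (cases s "0 :: real" rule: linorder_cases)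
  case less
  have "((\<lambda>_. 0) has_real_derivative 0) (at s)" by simp
  then have "((\<lambda>s. (max 0 s) ^ Suc (Suc n)) has_real_derivative 0) (at s)"
    by (rule has_field_derivative_transform_within_open[where S="{..<0}"]) (use less in auto)
  then show ?thesis using less by simp
next
  case greater
  have "((\<lambda>s. s ^ Suc (Suc n)) has_real_derivative real (Suc (Suc n)) * s ^ Suc n) (at s)"
    by (auto intro!: derivative_eq_intros simp del: power_Suc)
  then have "((\<lambda>s. (max 0 s) ^ Suc (Suc n)) has_real_derivative real (Suc (Suc n)) * s ^ Suc n) (at s)"
    by (rule has_field_derivative_transform_within_open[where S="{0<..}"]) (use greater in \<open>auto simp del: power_Suc\<close>)
  then show ?thesis using greater by simp
next
  case equal
  \<comment> \<open>At the kink Caratheodory's criterion applies with the continuous slope function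
    max(0, z)^(n+1).\<close>
  have "(max 0 z) ^ Suc (Suc n) - (max 0 s) ^ Suc (Suc n) = (max 0 z) ^ Suc n * (z - s)" for z
    unfolding equal by (cases "0 \<le> z") (simp_all add: max_def mult.commute)
  moreover have "isCont (\<lambda>z. (max 0 z) ^ Suc n) s" by (intro continuous_intros)
  ultimately show ?thesis
    unfolding CARAT_DERIV by (intro exI[of _ "\<lambda>z. (max 0 z) ^ Suc n"]) (simp add: equal)
qed

lemma DERIV_cutoff:
  assumes "R \<noteq> 0"
  shows "(cutoff R has_real_derivative cutoff1 R q) (at q)"
    and "(cutoff1 R has_real_derivative cutoff2 R q) (at q)"
proof -
  have d: "((\<lambda>q. 1 - q / R) has_real_derivative - 1 / R) (at q)"
    using assms by (auto intro!: derivative_eq_intros)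
  show "(cutoff R has_real_derivative cutoff1 R q) (at q)"
    using DERIV_chain2[OF DERIV_max_0_power[of 1] d]
    by (simp add: cutoff_def[abs_def] cutoff1_def numeral_3_eq_3 numeral_2_eq_2)
  show "(cutoff1 R has_real_derivative cutoff2 R q) (at q)"
    using DERIV_cmult[OF DERIV_chain2[OF DERIV_max_0_power[of 0] d], of "- 3 / R"]
    by (simp add: cutoff1_def[abs_def] cutoff2_def numeral_2_eq_2)
qed

text \<open>This is the radial Laplacian of the cutoff. For q < R the second-order term is at most 6
  (q/R)^2 \<le> 6 q/R and the first-order term at most 9 q/R, whence 15; for q \<ge> R everything
  vanishes.\<close>

lemma cutoff_bound:
  assumes "1 \<le> q" "0 < R"
  shows "\<bar>(q\<^sup>2 - 1) * cutoff2 R q + 3 * q * cutoff1 R q\<bar> \<le> 15 * q / R"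
proof (cases "q < R")
  case True
  define z where "z = max 0 (1 - q / R)"
  have z: "0 \<le> z" "z \<le> 1" using assms by (auto simp: z_def)
  have qR: "0 \<le> q / R" "q / R \<le> 1" using assms True by auto
  have "(q\<^sup>2 - 1) * cutoff2 R q = 6 * ((q\<^sup>2 - 1) / R\<^sup>2 * z)"
    by (simp add: cutoff2_def z_def)
  moreover have q2: "0 \<le> q\<^sup>2 - 1" using assms by simp
  then have "(q\<^sup>2 - 1) / R\<^sup>2 * z \<le> q\<^sup>2 / R\<^sup>2 * 1"
    using z by (intro mult_mono divide_right_mono) auto
  then have "(q\<^sup>2 - 1) / R\<^sup>2 * z \<le> (q / R) * (q / R)" by (simp add: power2_eq_square)
  then have "(q\<^sup>2 - 1) / R\<^sup>2 * z \<le> q / R"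
    using mult_left_mono[OF qR(2,1)] by simp
  moreover have "0 \<le> (q\<^sup>2 - 1) / R\<^sup>2 * z" using q2 z by simp
  moreover have "3 * q * cutoff1 R q = - 9 * (q / R * z\<^sup>2)" by (simp add: cutoff1_def z_def)
  moreover have "q / R * z\<^sup>2 \<le> q / R * 1" using z qR by (intro mult_left_mono) (auto simp: power_le_one)
  moreover have "0 \<le> q / R * z\<^sup>2" using z qR by (intro mult_nonneg_nonneg) auto
  ultimately show ?thesis using qR by (simp add: abs_le_iff)
next
  case False
  then show ?thesis using assms by (simp add: cutoff1_def cutoff2_def)
qed

lemma cutoff_0: "0 < R \<Longrightarrow> R \<le> q \<Longrightarrow> cutoff R q = 0"
  by (simp add: cutoff_def)

lemma cutoff_range: "0 < R \<Longrightarrow> 0 \<le> q \<Longrightarrow> 0 \<le> cutoff R q \<and> cutoff R q \<le> 1"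
  by (simp add: cutoff_def power_le_one)

text \<open>Clearing the denominator leaves a closed Euclidean condition that implies y_3 > 0 by
  itself, because its left-hand side is at least x_3^2. The ball is therefore closed in the whole
  space and stays away from the boundary plane.\<close>

lemma compact_cosh_dist_ball:
  assumes x: "x \<in> hyp3" and R: "0 < R"
  shows "compact {y\<in>hyp3. cosh_dist x y \<le> R}"
proof -
  have x3: "0 < x$3" using x by (simp add: hyp3_def)
  let ?n = "\<lambda>y::real^3. (y$1 - x$1)\<^sup>2 + (y$2 - x$2)\<^sup>2 + (y$3)\<^sup>2 + (x$3)\<^sup>2"
  have eq: "{y\<in>hyp3. cosh_dist x y \<le> R} = {y. ?n y \<le> 2 * R * x$3 * y$3}"
  proof (intro set_eqI iffI)
    fix y assume "y \<in> {y\<in>hyp3. cosh_dist x y \<le> R}"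
    then have y: "0 < y$3" "?n y / (2 * x$3 * y$3) \<le> R" by (auto simp: cosh_dist_def hyp3_def)
    have "0 < 2 * x$3 * y$3" using x3 y by simp
    with y(2) have "?n y \<le> R * (2 * x$3 * y$3)" by (simp only: pos_divide_le_eq)
    then show "y \<in> {y. ?n y \<le> 2 * R * x$3 * y$3}" by (simp add: mult_ac)
  next
    fix y assume y: "y \<in> {y. ?n y \<le> 2 * R * x$3 * y$3}"
    have "0 < ?n y" using x3 by (intro add_nonneg_pos add_nonneg_nonneg) auto
    then have "0 < (2 * R * x$3) * y$3" using y by simp
    then have "0 < y$3" by (rule zero_less_mult_pos) (use R x3 in simp)
    moreover from this have "0 < 2 * x$3 * y$3" using x3 by simp
    then have "?n y / (2 * x$3 * y$3) \<le> R" using y by (simp only: pos_divide_le_eq) (simp add: mult_ac)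
    ultimately show "y \<in> {y\<in>hyp3. cosh_dist x y \<le> R}"
      by (simp add: cosh_dist_def hyp3_def)
  qed
  have "closed {y. ?n y \<le> 2 * R * x$3 * y$3}"
    by (intro closed_Collect_le continuous_intros)
  moreover have "bounded {y. ?n y \<le> 2 * R * x$3 * y$3}"
  proof -
    define M where "M = 2 * R * x$3"
    have M: "0 < M" using R x3 by (simp add: M_def)
    have "norm y \<le> (\<bar>x$1\<bar> + M) + (\<bar>x$2\<bar> + M) + M" if y: "?n y \<le> M * y$3" for y
    proof -
      have nn: "0 \<le> (y$1 - x$1)\<^sup>2" "0 \<le> (y$2 - x$2)\<^sup>2" "0 \<le> (y$3)\<^sup>2" "0 < (x$3)\<^sup>2"
        using x3 by auto
      then have "0 < M * y$3" using y by linarith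
      then have y3: "0 < y$3" using M by (simp add: zero_less_mult_iff)
      have "(y$3)\<^sup>2 \<le> M * y$3" using nn y by linarith
      then have "y$3 * y$3 \<le> M * y$3" by (simp add: power2_eq_square)
      then have y3M: "y$3 \<le> M" using y3 by simp
      then have "M * y$3 \<le> M\<^sup>2" using M by (simp add: power2_eq_square)
      then have "(y$1 - x$1)\<^sup>2 \<le> M\<^sup>2" "(y$2 - x$2)\<^sup>2 \<le> M\<^sup>2" using y nn by linarith+
      then have "\<bar>y$1 - x$1\<bar> \<le> M" "\<bar>y$2 - x$2\<bar> \<le> M"
        using M by (auto intro: abs_le_square_iff[THEN iffD2] simp: abs_le_square_iff[symmetric])
      moreover have "norm y \<le> \<bar>y$1\<bar> + \<bar>y$2\<bar> + \<bar>y$3\<bar>"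
        using norm_le_l1_cart[of y] by (simp add: sum_3)
      ultimately show ?thesis using y3 y3M by linarith
    qed
    then show ?thesis unfolding bounded_iff M_def by blast
  qed
  ultimately show ?thesis unfolding eq by (simp add: compact_eq_bounded_closed)
qed

lemma C2_on_radial:
  assumes r: "radial_function x P P1 P2" and c: "continuous_on {-1<..} P2"
  shows "C2_on hyp3 (\<lambda>y. P (cosh_dist x y))"
proof -
  interpret radial_function x P P1 P2 by fact
  have q: "continuous_on hyp3 (\<lambda>y. P2 (cosh_dist x y))"
    by (rule continuous_on_compose2[OF c continuous_on_cosh_dist[OF x]]) (use cosh_dist_gt in auto)
  have "continuous_on {-1<..} P1"
    using P1 by (meson DERIV_isCont continuous_at_imp_continuous_on greaterThan_iff)
  then have q1: "continuous_on hyp3 (\<lambda>y. P1 (cosh_dist x y))"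
    by (rule continuous_on_compose2[OF _ continuous_on_cosh_dist[OF x]]) (use cosh_dist_gt in auto)
  have "continuous_on hyp3 (partial_deriv j (partial_deriv i F))" for i j
  proof -
    have "continuous_on hyp3 (\<lambda>y. P2 (cosh_dist x y) * cosh_dist_grad x i y * cosh_dist_grad x j y
        + P1 (cosh_dist x y) * cosh_dist_hess x i j y)"
      by (intro continuous_intros q q1 continuous_on_cosh_dist_grad continuous_on_cosh_dist_hess x)
    then show ?thesis by (rule continuous_on_eq) (simp add: partial_deriv2_F)
  qed
  then show ?thesis
    unfolding C2_on_def using differentiable_F differentiable_partial_deriv_F by blast
qed


lemma cutoff_radial_function:
  assumes "x \<in> hyp3" "0 < R"
  shows "radial_function x (cutoff R) (cutoff1 R) (cutoff2 R)"
  using assms by unfold_locales (auto intro!: DERIV_cutoff)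

lemma C2_on_cutoff:
  assumes "x \<in> hyp3" "0 < R"
  shows "C2_on hyp3 (\<lambda>y. cutoff R (cosh_dist x y))"
proof (rule C2_on_radial[OF cutoff_radial_function[OF assms]])
  show "continuous_on {-1<..} (cutoff2 R)"
    unfolding cutoff2_def[abs_def] using assms by (intro continuous_intros) auto
qed

text \<open>The difference \<open>p - h\<close> is a nonnegative solution, and its mass against the cutoff is
  \<open>O(1 / R)\<close> because \<open>h \<le> p\<close> and the hyperbolic cosine of the distance has finite mean under \<open>p\<close>.\<close>

lemma heat_kernel_unique_AE:
  assumes k: "k < 0" and x: "x \<in> hyp3"
    and h: "positive_fundamental_solution hyp3 (hyp3_metric k) x h"
    and le: "\<And>t y. 0 < t \<Longrightarrow> y \<in> hyp3 \<Longrightarrow> h t y \<le> heat_kernel k x t y"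
    and t: "0 < t"
  shows "AE y in hyp3_volume k. h t y = heat_kernel k x t y"
proof -
  let ?p = "heat_kernel k x" and ?V = "hyp3_volume k" and ?L = "laplace_beltrami (hyp3_metric k)"
  let ?f = "\<lambda>R y. cutoff R (cosh_dist x y)"
  have h0: "0 < h s y" if "0 < s" "y \<in> hyp3" for s y
    using h that unfolding positive_fundamental_solution_def by blast
  have hC: "C12_on hyp3 h" using h unfolding positive_fundamental_solution_def by blast
  have heq: "deriv (\<lambda>s. h s y) s = 1 / 2 * ?L (h s) y" if "0 < s" "y \<in> hyp3" for s y
    using h that unfolding positive_fundamental_solution_def by blast
  have hm: "h s \<in> borel_measurable ?V" if "0 < s" for s
    unfolding borel_measurable_hyp3_volume
    by (rule borel_measurable_continuous_on_restrict[OF C2_onD(3)[OF C12_on_slice(1)[OF hC that]]])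
  have pint: "integrable ?V (?p s)" if "0 < s" for s
    using heat_kernel_mass[OF k that x] by (simp add: has_bochner_integral_iff)
  have hint: "integrable ?V (h s)" if s: "0 < s" for s
  proof (rule Bochner_Integration.integrable_bound[OF pint[OF s] hm[OF s]])
    show "AE y in ?V. norm (h s y) \<le> norm (?p s y)"
    proof (rule AE_I2)
      fix y assume "y \<in> space ?V"
      then have y: "y \<in> hyp3" by (simp add: space_hyp3_volume)
      show "norm (h s y) \<le> norm (?p s y)" using h0[OF s y] le[OF s y] by simp
    qed
  qed
  have tested: "(\<integral>y. (?p t y - h t y) * ?f R y \<partial>?V) \<le> t * (8 * - k / R * exp (- 3 * k * t / 2))"
    if R: "0 < R" for R
  proof -
    interpret radial_function x "cutoff R" "cutoff1 R" "cutoff2 R"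
      by (rule cutoff_radial_function[OF x R])
    let ?K = "{y\<in>hyp3. cosh_dist x y \<le> R}"
    have K: "compact ?K" "?K \<subseteq> hyp3" by (auto intro: compact_cosh_dist_ball x R)
    have K0: "?f R y = 0" if "y \<in> hyp3 - ?K" for y using that cutoff_0[OF R] by auto
    have fC: "C2_on hyp3 (?f R)" by (rule C2_on_cutoff[OF x R])
    have intf: "integrable ?V (\<lambda>y. u s y * ?f R y)" "integrable ?V (\<lambda>y. u s y * ?L (?f R) y)"
      if u: "C12_on hyp3 u" and s: "0 < s" for u s
    proof -
      have L0: "?L (?f R) y = 0" if "y \<in> hyp3 - ?K" for y
        using that R laplace_F[OF k, of y] by (auto simp: cutoff1_def cutoff2_def)
      have c: "continuous_on hyp3 (\<lambda>y. u s y * ?f R y)" "continuous_on hyp3 (\<lambda>y. u s y * ?L (?f R) y)"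
        by (intro continuous_intros C2_onD(3)[OF C12_on_slice(1)[OF u s]] C2_onD(3)[OF fC]
            continuous_on_laplace_hyp3[OF k fC])+
      show "integrable ?V (\<lambda>y. u s y * ?f R y)"
        by (rule integrable_hyp3_compact_support(1)[OF k c(1) K]) (simp only: K0 mult_zero_right)
      show "integrable ?V (\<lambda>y. u s y * ?L (?f R) y)"
        by (rule integrable_hyp3_compact_support(1)[OF k c(2) K]) (simp only: L0 mult_zero_right)
    qed
    note pC = heat_kernel_C12[OF k x]
    define m where "m s = (\<integral>y. ?p s y * ?f R y \<partial>?V) - (\<integral>y. h s y * ?f R y \<partial>?V)" for s
    define m' where "m' s = 1 / 2 * (\<integral>y. ?p s y * ?L (?f R) y \<partial>?V) - 1 / 2 * (\<integral>y. h s y * ?L (?f R) y \<partial>?V)" for s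
    have dm: "(m has_real_derivative m' s) (at s)" if s: "0 < s" for s
      unfolding m_def[abs_def] m'_def
      by (intro DERIV_diff heat_solution_tested_DERIV[OF k pC heat_kernel_heat_equation[OF k x] fC K K0 s]
          heat_solution_tested_DERIV[OF k hC heq fC K K0 s])
    \<comment> \<open>Only 0 \<le> p - h \<le> p is used about h. Half of the constant 15 from
      \<open>cutoff_bound\<close> is rounded up to 8, and the mean of q at time s is bounded by its
      larger value at time t.\<close>
    have m'le: "m' s \<le> 8 * - k / R * exp (- 3 * k * t / 2)" if s: "0 < s" "s \<le> t" for s
    proof -
      have c: "has_bochner_integral ?V (\<lambda>y. 8 * - k / R * (?p s y * cosh_dist x y)) (8 * - k / R * exp (- 3 * k * s / 2))"
        by (intro has_bochner_integral_mult_right heat_kernel_cosh_moment k x s)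
      have "m' s = (\<integral>y. 1 / 2 * ((?p s y - h s y) * ?L (?f R) y) \<partial>?V)"
        unfolding m'_def using intf(2)[OF pC s(1)] intf(2)[OF hC s(1)]
        by (simp add: left_diff_distrib right_diff_distrib diff_divide_distrib)
      also have "\<dots> \<le> (\<integral>y. 8 * - k / R * (?p s y * cosh_dist x y) \<partial>?V)"
      proof (rule integral_mono)
        show "integrable ?V (\<lambda>y. 1 / 2 * ((?p s y - h s y) * ?L (?f R) y))"
          using intf(2)[OF pC s(1)] intf(2)[OF hC s(1)] by (simp add: left_diff_distrib)
        show "integrable ?V (\<lambda>y. 8 * - k / R * (?p s y * cosh_dist x y))"
          using c by (simp only: has_bochner_integral_iff)
        fix y assume "y \<in> space ?V"
        then have y: "y \<in> hyp3" by (simp add: space_hyp3_volume)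
        let ?q = "cosh_dist x y"
        have q: "1 \<le> ?q" by (rule cosh_dist_ge_1[OF x y])
        have d: "0 \<le> ?p s y - h s y" "?p s y - h s y \<le> ?p s y"
          using le[OF s(1) y] h0[OF s(1) y] by auto
        have k': "\<bar>- k\<bar> = - k" using k by simp
        have L: "\<bar>?L (?f R) y\<bar> \<le> - k * (15 * ?q / R)"
          unfolding laplace_F[OF k y] abs_mult k' by (rule mult_left_mono[OF cutoff_bound[OF q R]]) (use k in simp)
        have "(?p s y - h s y) * ?L (?f R) y \<le> (?p s y - h s y) * (- k * (15 * ?q / R))"
          using d L by (intro mult_left_mono) auto
        also have "(?p s y - h s y) * (- k * (15 * ?q / R)) \<le> ?p s y * (- k * (15 * ?q / R))"
          using d k q R by (intro mult_right_mono mult_nonneg_nonneg) auto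
        finally have 1: "1 / 2 * ((?p s y - h s y) * ?L (?f R) y) \<le> 15 / 2 * (- k / R * (?p s y * ?q))"
          using d by (simp add: mult_left_mono mult_ac)
        have "0 \<le> - k / R * (?p s y * ?q)"
          using k R q heat_kernel_pos[OF s(1) x y, of k] by (intro mult_nonneg_nonneg divide_nonneg_nonneg) auto
        then have "15 / 2 * (- k / R * (?p s y * ?q)) \<le> 8 * (- k / R * (?p s y * ?q))"
          by (intro mult_right_mono) auto
        also have "\<dots> = 8 * - k / R * (?p s y * ?q)" by simp
        finally show "1 / 2 * ((?p s y - h s y) * ?L (?f R) y) \<le> 8 * - k / R * (?p s y * ?q)"
          by (rule order_trans[OF 1])
      qed
      also have "\<dots> = 8 * - k / R * exp (- 3 * k * s / 2)" using c by (simp only: has_bochner_integral_iff)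
      also have "\<dots> \<le> 8 * - k / R * exp (- 3 * k * t / 2)"
      proof (rule mult_left_mono)
        have "- k * s \<le> - k * t" using k s by (intro mult_left_mono) auto
        then show "exp (- 3 * k * s / 2) \<le> exp (- 3 * k * t / 2)" by simp
        show "0 \<le> 8 * - k / R" using k R by (intro divide_nonneg_nonneg) auto
      qed
      finally show ?thesis .
    qed
    let ?C = "8 * - k / R * exp (- 3 * k * t / 2)"
    have C: "0 \<le> ?C" using k R by (intro mult_nonneg_nonneg divide_nonneg_nonneg) auto
    \<comment> \<open>The mean value theorem is applied on [s, t] with s > 0, since nothing is known
      at time 0 itself. As s tends to 0, m s tends to 0 because both solutions start from the same
      Dirac mass.\<close>
    have "m t - t * ?C \<le> m s" if s: "s \<in> {0<..<t}" for s
    proof -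
      obtain z where z: "s < z" "z < t" "m t - m s = (t - s) * m' z"
        using MVT2[of s t m m'] dm s by auto
      have "(t - s) * m' z \<le> (t - s) * ?C" using m'le[of z] z s by (intro mult_left_mono) auto
      also have "\<dots> \<le> t * ?C" using s C by (intro mult_right_mono) auto
      finally show ?thesis using z by linarith
    qed
    then have "\<forall>\<^sub>F s in at_right 0. m t - t * ?C \<le> m s"
      using eventually_at_right_less[of 0] t
      by (auto simp: eventually_at_right[of 0 t] intro!: exI[of _ t])
    moreover have "(m \<longlongrightarrow> ?f R x - ?f R x) (at_right 0)"
      unfolding m_def[abs_def]
    proof (rule tendsto_diff)
      have c: "continuous_on hyp3 (?f R) \<and> (\<exists>K. compact K \<and> K \<subseteq> hyp3 \<and> (\<forall>y\<in>hyp3 - K. ?f R y = 0))"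
        using C2_onD(3)[OF fC] K K0 by blast
      show "((\<lambda>s. \<integral>y. ?p s y * ?f R y \<partial>?V) \<longlongrightarrow> ?f R x) (at_right 0)"
        using positive_fundamental_solution_heat_kernel[OF k x] c
        unfolding positive_fundamental_solution_def by blast
      show "((\<lambda>s. \<integral>y. h s y * ?f R y \<partial>?V) \<longlongrightarrow> ?f R x) (at_right 0)"
        using h c unfolding positive_fundamental_solution_def by blast
    qed
    ultimately have "m t - t * ?C \<le> ?f R x - ?f R x"
      by (intro tendsto_lowerbound[of m _ "at_right 0"]) auto
    moreover have "m t = (\<integral>y. (?p t y - h t y) * ?f R y \<partial>?V)"
      unfolding m_def using intf(1)[OF pC t] intf(1)[OF hC t] by (simp add: left_diff_distrib)
    ultimately show ?thesis by simp
  qed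
  have d0: "0 \<le> ?p t y - h t y" if "y \<in> hyp3" for y using le[OF t that] by simp
  \<comment> \<open>R runs through n + 1, which keeps it positive. The cutoffs lie between 0 and 1
    and tend to 1, so p - h is itself the majorant.\<close>
  have "(\<lambda>n. \<integral>y. (?p t y - h t y) * ?f (real (Suc n)) y \<partial>?V) \<longlonglongrightarrow> (\<integral>y. ?p t y - h t y \<partial>?V)"
  proof (rule integral_dominated_convergence)
    have fm: "?f (real (Suc n)) \<in> borel_measurable ?V" for n
      unfolding borel_measurable_hyp3_volume
      by (rule borel_measurable_continuous_on_restrict[OF C2_onD(3)[OF C2_on_cutoff[OF x]]]) simp
    show "integrable ?V (\<lambda>y. ?p t y - h t y)" using pint[OF t] hint[OF t] by simp
    then show "(\<lambda>y. ?p t y - h t y) \<in> borel_measurable ?V" by auto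
    then show "(\<lambda>y. (?p t y - h t y) * ?f (real (Suc n)) y) \<in> borel_measurable ?V" for n
      using fm by measurable
    show "AE y in ?V. (\<lambda>n. (?p t y - h t y) * ?f (real (Suc n)) y) \<longlonglongrightarrow> ?p t y - h t y"
    proof (rule AE_I2)
      fix y :: "real^3"
      have "(\<lambda>n. 1 - cosh_dist x y / real (Suc n)) \<longlonglongrightarrow> 1 - 0"
        by (intro tendsto_intros LIMSEQ_Suc lim_const_over_n)
      then have "(\<lambda>n. ?f (real (Suc n)) y) \<longlonglongrightarrow> (max 0 (1 - 0)) ^ 3"
        unfolding cutoff_def by (intro tendsto_power tendsto_max tendsto_const)
      from tendsto_mult[OF tendsto_const[of "?p t y - h t y"] this]
      show "(\<lambda>n. (?p t y - h t y) * ?f (real (Suc n)) y) \<longlonglongrightarrow> ?p t y - h t y" by simp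
    qed
    show "AE y in ?V. norm ((?p t y - h t y) * ?f (real (Suc n)) y) \<le> ?p t y - h t y" for n
    proof (rule AE_I2)
      fix y assume "y \<in> space ?V"
      then have y: "y \<in> hyp3" by (simp add: space_hyp3_volume)
      have "0 \<le> ?f (real (Suc n)) y \<and> ?f (real (Suc n)) y \<le> 1"
        using cosh_dist_ge_1[OF x y] by (intro cutoff_range) auto
      then show "norm ((?p t y - h t y) * ?f (real (Suc n)) y) \<le> ?p t y - h t y"
        using d0[OF y] by (simp add: abs_mult mult_left_le)
    qed
  qed
  moreover have "(\<lambda>n. t * (8 * - k / real (Suc n) * exp (- 3 * k * t / 2))) \<longlonglongrightarrow> t * (0 * exp (- 3 * k * t / 2))"
    by (intro tendsto_intros LIMSEQ_Suc lim_const_over_n)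
  ultimately have "(\<integral>y. ?p t y - h t y \<partial>?V) \<le> t * (0 * exp (- 3 * k * t / 2))"
    by (rule LIMSEQ_le) (use tested[of "real (Suc n)" for n] in auto)
  moreover have "0 \<le> (\<integral>y. ?p t y - h t y \<partial>?V)"
    by (rule Bochner_Integration.integral_nonneg) (use d0 in \<open>simp add: space_hyp3_volume\<close>)
  ultimately have "(\<integral>y. ?p t y - h t y \<partial>?V) = 0" by simp
  moreover have "AE y in ?V. 0 \<le> ?p t y - h t y"
    by (rule AE_I2) (use d0 in \<open>simp add: space_hyp3_volume\<close>)
  moreover have "integrable ?V (\<lambda>y. ?p t y - h t y)" using pint[OF t] hint[OF t] by simp
  ultimately have "AE y in ?V. ?p t y - h t y = 0"
    using integral_nonneg_eq_0_iff_AE[of ?V "\<lambda>y. ?p t y - h t y"] by blast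
  then show ?thesis by eventually_elim simp
qed


section \<open>Entropy\<close>

lemma ln_heat_kernel:
  assumes t: "0 < t" and x: "x \<in> hyp3" and y: "y \<in> hyp3"
  shows "ln (heat_kernel k x t y)
    = ln (heat_kernel_const k t) - log_sinhc (hyp_dist x y) + (hyp_dist x y)\<^sup>2 / (2 * k * t)"
proof -
  define r where "r = hyp_dist x y"
  have r: "cosh_dist x y = cosh r" by (simp add: r_def cosh_hyp_dist x y)
  have "0 < rsinh (cosh r)" using cosh_real_ge_1[of r] by (rule rsinh_pos)
  then show ?thesis
    unfolding heat_kernel_def r r_def[symmetric] heat_profile_cosh log_sinhc_def
    using heat_kernel_const_pos[OF t, of k] by (simp add: ln_mult)
qed

text \<open>The logarithm of the kernel is a constant, minus ln (sinh r / r), plus r^2 / (2 k t).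
  The last term has mean (\<tau>^2 + 3 \<tau>) / (2 k t) = (k t - 3) / 2.\<close>

lemma has_bochner_integral_heat_kernel_ln:
  assumes k: "k < 0" and t: "0 < t" and x: "x \<in> hyp3"
  shows "has_bochner_integral (hyp3_volume k) (\<lambda>y. heat_kernel k x t y * ln (heat_kernel k x t y))
    (ln (heat_kernel_const k t) - mean_log_sinhc (- k * t) + (k * t - 3) / 2)"
proof -
  let ?\<tau> = "- k * t" and ?c = "ln (heat_kernel_const k t)"
  have \<tau>: "0 < ?\<tau>" using k t by (simp add: mult_neg_pos)
  have "has_bochner_integral lborel (\<lambda>r. indicator {0<..} r * (radial_density ?\<tau> r * log_sinhc r)) (mean_log_sinhc ?\<tau>)"
    unfolding mean_log_sinhc_def using integrable_radial_log_sinhc[OF \<tau>, of 0]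
    by (intro has_bochner_integral_integrable) simp
  then have "has_bochner_integral lborel (\<lambda>r. ?c * (indicator {0<..} r * radial_density ?\<tau> r)
      - indicator {0<..} r * (radial_density ?\<tau> r * log_sinhc r)
      + 1 / (2 * k * t) * (indicator {0<..} r * (radial_density ?\<tau> r * r\<^sup>2)))
      (?c * 1 - mean_log_sinhc ?\<tau> + 1 / (2 * k * t) * (?\<tau>\<^sup>2 + 3 * ?\<tau>))"
    by (intro has_bochner_integral_add has_bochner_integral_diff has_bochner_integral_mult_right
        radial_mass radial_second_moment \<tau>)
  moreover have "?c * (indicator {0<..} r * radial_density ?\<tau> r)
      - indicator {0<..} r * (radial_density ?\<tau> r * log_sinhc r)
      + 1 / (2 * k * t) * (indicator {0<..} r * (radial_density ?\<tau> r * r\<^sup>2))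
      = indicator {0<..} r * (radial_density ?\<tau> r * (?c - log_sinhc r + r\<^sup>2 / (2 * k * t)))" for r
    by (simp add: algebra_simps)
  moreover have "?c * 1 - mean_log_sinhc ?\<tau> + 1 / (2 * k * t) * (?\<tau>\<^sup>2 + 3 * ?\<tau>)
      = ?c - mean_log_sinhc ?\<tau> + (k * t - 3) / 2"
    using k t by (simp add: field_simps power2_eq_square)
  ultimately have "has_bochner_integral lborel
      (\<lambda>r. indicator {0<..} r * (radial_density ?\<tau> r * (?c - log_sinhc r + r\<^sup>2 / (2 * k * t))))
      (?c - mean_log_sinhc ?\<tau> + (k * t - 3) / 2)"
    by (simp only:)
  then have "has_bochner_integral (hyp3_volume k)
      (\<lambda>y. heat_kernel k x t y * (?c - log_sinhc (hyp_dist x y) + (hyp_dist x y)\<^sup>2 / (2 * k * t)))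
      (?c - mean_log_sinhc ?\<tau> + (k * t - 3) / 2)"
    by (rule has_bochner_integral_heat_kernel[OF k t x, rotated]) measurable
  then show ?thesis
    by (rule has_bochner_integral_cong[THEN iffD1, rotated -1])
      (auto simp: space_hyp3_volume ln_heat_kernel[OF t x])
qed

lemma entropy_heat_kernel:
  assumes "k < 0" "0 < t" "x \<in> hyp3"
  shows "entropy (hyp3_volume k) (heat_kernel k x t)
    = mean_log_sinhc (- k * t) - ln (heat_kernel_const k t) - (k * t - 3) / 2"
  using has_bochner_integral_heat_kernel_ln[OF assms]
  by (simp add: entropy_def has_bochner_integral_iff)

text \<open>The normalizing constant contributes - k/2 + 3 / (2 t) and the quadratic term another -
  k/2; the rest is the chain rule for \<tau> = -k t.\<close>

lemma DERIV_entropy_heat_kernel: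
  assumes k: "k < 0" and t: "0 < t" and x: "x \<in> hyp3"
  shows "((\<lambda>s. entropy (hyp3_volume k) (heat_kernel k x s)) has_real_derivative
    - k * deriv mean_log_sinhc (- k * t) + 3 / (2 * t) - k) (at t)"
proof -
  have \<tau>: "0 < - k * t" using k t by (simp add: mult_neg_pos)
  have M: "(mean_log_sinhc has_real_derivative deriv mean_log_sinhc (- k * t)) (at (- k * t))"
    using DERIV_mean_log_sinhc[OF \<tau>] by (metis DERIV_imp_deriv)
  have 1: "((\<lambda>s. mean_log_sinhc (- k * s)) has_real_derivative deriv mean_log_sinhc (- k * t) * - k) (at t)"
    by (rule DERIV_chain2[where f=mean_log_sinhc], rule M) (auto intro!: derivative_eq_intros)
  have 2: "((\<lambda>s. ln (heat_kernel_const k s)) has_real_derivative k / 2 - 3 / (2 * t)) (at t)"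
    using heat_kernel_const_pos[OF t, of k]
    by (auto intro!: derivative_eq_intros DERIV_heat_kernel_const[OF t])
  have 3: "((\<lambda>s. (k * s - 3) / 2) has_real_derivative k / 2) (at t)"
    by (auto intro!: derivative_eq_intros)
  have "((\<lambda>s. mean_log_sinhc (- k * s) - ln (heat_kernel_const k s) - (k * s - 3) / 2) has_real_derivative
    - k * deriv mean_log_sinhc (- k * t) + 3 / (2 * t) - k) (at t)"
    by (rule DERIV_cong[OF DERIV_diff[OF DERIV_diff[OF 1 2] 3]]) (simp add: algebra_simps)
  then show ?thesis
    by (rule has_field_derivative_transform_within_open[where S="{0<..}"])
      (use t entropy_heat_kernel[OF k _ x] in auto)
qed

lemma deriv_entropy_heat_kernel_tendsto:
  assumes k: "k < 0" and x: "x \<in> hyp3"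
  shows "((\<lambda>t. deriv (\<lambda>s. entropy (hyp3_volume k) (heat_kernel k x s)) t) \<longlongrightarrow> - 2 * k) at_top"
proof -
  have "filterlim (\<lambda>t. - k * t) at_top at_top"
    using k by (intro filterlim_tendsto_pos_mult_at_top[OF tendsto_const] filterlim_ident) auto
  then have "((\<lambda>t. deriv mean_log_sinhc (- k * t)) \<longlongrightarrow> 1) at_top"
    by (rule filterlim_compose[OF deriv_mean_log_sinhc_tendsto])
  moreover have "((\<lambda>t::real. 3 / (2 * t)) \<longlongrightarrow> 0) at_top" by real_asymp
  ultimately have "((\<lambda>t. - k * deriv mean_log_sinhc (- k * t) + 3 / (2 * t) - k) \<longlongrightarrow> - k * 1 + 0 - k) at_top"
    by (intro tendsto_intros)
  moreover have "\<forall>\<^sub>F t in at_top. - k * deriv mean_log_sinhc (- k * t) + 3 / (2 * t) - k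
      = deriv (\<lambda>s. entropy (hyp3_volume k) (heat_kernel k x s)) t"
    using eventually_gt_at_top[of 0]
    by eventually_elim (simp only: DERIV_imp_deriv[OF DERIV_entropy_heat_kernel[OF k _ x]])
  ultimately show ?thesis by (simp add: Lim_transform_eventually)
qed

text \<open>The derivative has the limit -2 k, and ln (sqrt 2) \<ge> 0 places it between the bounds.
  Integrability and differentiability are asserted as well, so that neither the integral in
  \<open>entropy\<close> nor \<open>deriv\<close> stands for a default value.\<close>

theorem theorem4p1:
  fixes k :: real and h :: "real \<Rightarrow> real^3 \<Rightarrow> real^3 \<Rightarrow> real" and x :: "real^3"
  assumes "k < 0"
    and "is_heat_kernel hyp3 (hyp3_metric k) h"
    and "x \<in> hyp3"
  shows "(\<forall>t>0. integrable (hyp3_volume k) (\<lambda>y. h t x y * ln (h t x y))) \<and>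
    (\<forall>t>0. (\<lambda>s. entropy (hyp3_volume k) (h s x)) differentiable (at t)) \<and>
    ereal (- k * (2 - ln (sqrt 2)))
      \<le> Liminf at_top (\<lambda>t. ereal (deriv (\<lambda>s. entropy (hyp3_volume k) (h s x)) t)) \<and>
    Liminf at_top (\<lambda>t. ereal (deriv (\<lambda>s. entropy (hyp3_volume k) (h s x)) t))
      \<le> Limsup at_top (\<lambda>t. ereal (deriv (\<lambda>s. entropy (hyp3_volume k) (h s x)) t)) \<and>
    Limsup at_top (\<lambda>t. ereal (deriv (\<lambda>s. entropy (hyp3_volume k) (h s x)) t))
      \<le> ereal (- k * (2 + ln (sqrt 2)))"
proof -
  note k = assms(1) and x = assms(3)
  let ?V = "hyp3_volume k" and ?p = "heat_kernel k x"
  have h: "positive_fundamental_solution hyp3 (hyp3_metric k) x (\<lambda>t. h t x)"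
    using assms(2) x unfolding is_heat_kernel_def by blast
  have le: "h t x y \<le> ?p t y" if "0 < t" "y \<in> hyp3" for t y
    using assms(2) x positive_fundamental_solution_heat_kernel[OF k x] that
    unfolding is_heat_kernel_def by blast
  have hm: "h t x \<in> borel_measurable ?V" if "0 < t" for t
  proof -
    have "C12_on hyp3 (\<lambda>t. h t x)" using h unfolding positive_fundamental_solution_def by blast
    from C2_onD(3)[OF C12_on_slice(1)[OF this that]] show ?thesis
      unfolding borel_measurable_hyp3_volume by (rule borel_measurable_continuous_on_restrict)
  qed
  have AE: "AE y in ?V. ?p t y * ln (?p t y) = h t x y * ln (h t x y)" if "0 < t" for t
  proof -
    have "AE y in ?V. h t x y = ?p t y"
      by (rule heat_kernel_unique_AE[OF k x h _ that]) (rule le)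
    then show ?thesis by eventually_elim simp
  qed
  have lnm: "(\<lambda>y. f y * ln (f y)) \<in> borel_measurable ?V" if [measurable]: "f \<in> borel_measurable ?V" for f :: "real^3 \<Rightarrow> real"
    by measurable
  have int: "integrable ?V (\<lambda>y. h t x y * ln (h t x y))" if t: "0 < t" for t
    using integrable_cong_AE[OF lnm[OF measurable_heat_kernel[OF x]] lnm[OF hm[OF t]] AE[OF t]]
      has_bochner_integral_heat_kernel_ln[OF k t x] by (simp add: has_bochner_integral_iff)
  have ent: "entropy ?V (?p t) = entropy ?V (h t x)" if t: "0 < t" for t
    unfolding entropy_def
    using integral_cong_AE[OF lnm[OF measurable_heat_kernel[OF x]] lnm[OF hm[OF t]] AE[OF t]] by simp
  \<comment> \<open>The two entropies agree at every positive time, hence on a neighbourhood of t,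
    and so the derivative carries over.\<close>
  have D: "((\<lambda>s. entropy ?V (h s x)) has_real_derivative deriv (\<lambda>s. entropy ?V (?p s)) t) (at t)" if t: "0 < t" for t
  proof (rule has_field_derivative_transform_within_open[where S="{0<..}"])
    show "((\<lambda>s. entropy ?V (?p s)) has_real_derivative deriv (\<lambda>s. entropy ?V (?p s)) t) (at t)"
      using DERIV_entropy_heat_kernel[OF k t x] by (metis DERIV_imp_deriv)
  qed (use t ent in auto)
  have "\<forall>\<^sub>F t in at_top. deriv (\<lambda>s. entropy ?V (?p s)) t = deriv (\<lambda>s. entropy ?V (h s x)) t"
    using eventually_gt_at_top[of 0] by eventually_elim (simp add: DERIV_imp_deriv[OF D])
  with deriv_entropy_heat_kernel_tendsto[OF k x]
  have "((\<lambda>t. deriv (\<lambda>s. entropy ?V (h s x)) t) \<longlongrightarrow> - 2 * k) at_top"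
    by (rule Lim_transform_eventually)
  then have lim: "((\<lambda>t. ereal (deriv (\<lambda>s. entropy ?V (h s x)) t)) \<longlongrightarrow> ereal (- 2 * k)) at_top"
    by (rule tendsto_ereal)
  have "0 \<le> ln (sqrt 2)" by simp
  then have "0 \<le> - k * ln (sqrt 2)" using k by (intro mult_nonneg_nonneg) auto
  then have "- k * (2 - ln (sqrt 2)) \<le> - 2 * k" "- 2 * k \<le> - k * (2 + ln (sqrt 2))"
    by (simp_all add: algebra_simps)
  then show ?thesis
    using lim_imp_Liminf[OF _ lim] lim_imp_Limsup[OF _ lim] int D
    by (auto simp: real_differentiable_def)
qed

end
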